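(* Let $\mathbb{V}$ be a subvariety of the variety $\mathbb{SRL}$ of Stonean residuated lattices, and let $\mathbb{V}^\ast=\{\mathbf{A}\in\mathbb{RL}:\mathbf{S}(\mathbf{A})\in\mathbb{V}\}$. Let $\mathfrak{T}_{\mathbb{V}}$ be the full subcategory of $\mathfrak{T}$ whose objects are the triples $(\mathbf{B},\mathbf{D},\phi)$ with $\mathbf{D}\in\mathbb{V}^\ast$. Then the restriction of the functor $\mathbf{T}$ to $\mathbb{V}$ defines an equivalence between the categories $\mathbb{V}$ (with homomorphisms) and $\mathfrak{T}_{\mathbb{V}}$.
   Context: A residuated lattice is an algebra $(A,\ast,\to,\vee,\wedge,\top)$ with $(A,\ast,\top)$ a commutative monoid, $(A,\vee,\wedge)$ a lattice with top $\top$, and $x\ast y\le z$ iff $x\le y\to z$; $\mathbb{RL}$ is their variety. A bounded residuated lattice also has a least element $\bot$; $\neg x:=x\to\bot$. Dense elements: $\neg x=\bot$, forming a residuated lattice $\mathbf{D}(\mathbf{A})$. Boolean elements: $x\vee\neg x=\top$, $x\wedge\neg x=\bot$, forming a Boolean algebra $\mathbf{B}(\mathbf{A})$. Stonean: bounded residuated lattice satisfying $\neg x\vee\neg\neg x=\top$. For $\mathbf{A}\in\mathbb{RL}$ and $o\notin A$, $\mathbf{S}(\mathbf{A})$ is the bounded residuated lattice on $A\cup\{o\}$ with $o$ as new least element (the constant $\bot$), operations on $A$ unchanged, $x\ast o=o\ast x=o$, $x\to o=o$ for $x\in A$, and $o\to y=\top$ for all $y$. i-filters of $\mathbf{D}$: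 subsets $F\ni\top$ with $x,x\to y\in F\Rightarrow y\in F$; $\mathcal{F}_i(\mathbf{D})$ their lattice under inclusion. $\phi_{\mathbf{A}}(a)=\{x\in D(\mathbf{A}):x\ge\neg a\}$ for $a\in B(\mathbf{A})$. Category $\mathfrak{T}$: objects $(\mathbf{B},\mathbf{D},\phi)$ with $\mathbf{B}$ a Boolean algebra, $\mathbf{D}$ a residuated lattice, $\phi:\mathbf{B}\to\mathcal{F}_i(\mathbf{D})$ a lattice homomorphism preserving bottom and top; morphisms pairs $(h,k)$ of a Boolean homomorphism and a residuated lattice homomorphism with $k(\phi_1(a))\subseteq\phi_2(h(a))$. The functor $\mathbf{T}$ sends $\mathbf{A}$ to $(\mathbf{B}(\mathbf{A}),\mathbf{D}(\mathbf{A}),\phi_{\mathbf{A}})$ and a homomorphism $f$ to its pair of restrictions to Boolean and dense elements.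
   Formalization: V is assumed nontrivial: for the trivial variety V* and T_V are empty (S(A) has at least two elements) while V contains the one-element algebra, so the claim fails there. All algebras have carriers inside one arbitrary infinite set serving as universe. *)

theory Defs
  imports "HOL-Algebra.Group"
begin

section \<open>Categories, functors and equivalences\<close>

text \<open>Hom-sets of different pairs of objects need not be disjoint; therefore composition
  \<open>Comp C a b c g f\<close> of \<open>f : a \<rightarrow> b\<close> with \<open>g : b \<rightarrow> c\<close> and the arrow part of a functor take
  the objects as arguments.\<close>

record ('o, 'm) cat =
  Obj :: "'o set"
  Hom :: "'o \<Rightarrow> 'o \<Rightarrow> 'm set"
  Id :: "'o \<Rightarrow> 'm"
  Comp :: "'o \<Rightarrow> 'o \<Rightarrow> 'o \<Rightarrow> 'm \<Rightarrow> 'm \<Rightarrow> 'm"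

definition category :: "('o, 'm) cat \<Rightarrow> bool" where
  "category C \<longleftrightarrow>
     (\<forall>a\<in>Obj C. Id C a \<in> Hom C a a) \<and>
     (\<forall>a\<in>Obj C. \<forall>b\<in>Obj C. \<forall>c\<in>Obj C. \<forall>f\<in>Hom C a b. \<forall>g\<in>Hom C b c.
        Comp C a b c g f \<in> Hom C a c) \<and>
     (\<forall>a\<in>Obj C. \<forall>b\<in>Obj C. \<forall>f\<in>Hom C a b.
        Comp C a a b f (Id C a) = f \<and> Comp C a b b (Id C b) f = f) \<and>
     (\<forall>a\<in>Obj C. \<forall>b\<in>Obj C. \<forall>c\<in>Obj C. \<forall>d\<in>Obj C.
        \<forall>f\<in>Hom C a b. \<forall>g\<in>Hom C b c. \<forall>h\<in>Hom C c d.
        Comp C a c d h (Comp C a b c g f) = Comp C a b d (Comp C b c d h g) f)"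

definition full_subcategory :: "('o, 'm) cat \<Rightarrow> ('o \<Rightarrow> bool) \<Rightarrow> ('o, 'm) cat" where
  "full_subcategory C P = C\<lparr>Obj := {a \<in> Obj C. P a}\<rparr>"

record ('o1, 'm1, 'o2, 'm2) func =
  onObj :: "'o1 \<Rightarrow> 'o2"
  onArr :: "'o1 \<Rightarrow> 'o1 \<Rightarrow> 'm1 \<Rightarrow> 'm2"

definition is_functor ::
  "('o1, 'm1) cat \<Rightarrow> ('o2, 'm2) cat \<Rightarrow> ('o1, 'm1, 'o2, 'm2) func \<Rightarrow> bool" where
  "is_functor C D F \<longleftrightarrow> category C \<and> category D \<and>
     (\<forall>a\<in>Obj C. onObj F a \<in> Obj D) \<and>
     (\<forall>a\<in>Obj C. \<forall>b\<in>Obj C. \<forall>f\<in>Hom C a b.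
        onArr F a b f \<in> Hom D (onObj F a) (onObj F b)) \<and>
     (\<forall>a\<in>Obj C. onArr F a a (Id C a) = Id D (onObj F a)) \<and>
     (\<forall>a\<in>Obj C. \<forall>b\<in>Obj C. \<forall>c\<in>Obj C. \<forall>f\<in>Hom C a b. \<forall>g\<in>Hom C b c.
        onArr F a c (Comp C a b c g f) =
          Comp D (onObj F a) (onObj F b) (onObj F c) (onArr F b c g) (onArr F a b f))"

definition id_func :: "('o, 'm, 'o, 'm) func" where
  "id_func = \<lparr>onObj = (\<lambda>a. a), onArr = (\<lambda>a b f. f)\<rparr>"

definition comp_func ::
  "('o2, 'm2, 'o3, 'm3) func \<Rightarrow> ('o1, 'm1, 'o2, 'm2) func \<Rightarrow> ('o1, 'm1, 'o3, 'm3) func" where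
  "comp_func G F =
     \<lparr>onObj = (\<lambda>a. onObj G (onObj F a)),
      onArr = (\<lambda>a b f. onArr G (onObj F a) (onObj F b) (onArr F a b f))\<rparr>"

definition is_iso :: "('o, 'm) cat \<Rightarrow> 'o \<Rightarrow> 'o \<Rightarrow> 'm \<Rightarrow> bool" where
  "is_iso C a b f \<longleftrightarrow> f \<in> Hom C a b \<and>
     (\<exists>g\<in>Hom C b a. Comp C a b a g f = Id C a \<and> Comp C b a b f g = Id C b)"

definition natural_iso ::
  "('o1, 'm1) cat \<Rightarrow> ('o2, 'm2) cat \<Rightarrow>
   ('o1, 'm1, 'o2, 'm2) func \<Rightarrow> ('o1, 'm1, 'o2, 'm2) func \<Rightarrow> ('o1 \<Rightarrow> 'm2) \<Rightarrow> bool" where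
  "natural_iso C D F G \<eta> \<longleftrightarrow>
     (\<forall>a\<in>Obj C. is_iso D (onObj F a) (onObj G a) (\<eta> a)) \<and>
     (\<forall>a\<in>Obj C. \<forall>b\<in>Obj C. \<forall>f\<in>Hom C a b.
        Comp D (onObj F a) (onObj F b) (onObj G b) (\<eta> b) (onArr F a b f) =
        Comp D (onObj F a) (onObj G a) (onObj G b) (onArr G a b f) (\<eta> a))"

definition is_equivalence ::
  "('o1, 'm1) cat \<Rightarrow> ('o2, 'm2) cat \<Rightarrow> ('o1, 'm1, 'o2, 'm2) func \<Rightarrow> bool" where
  "is_equivalence C D F \<longleftrightarrow> is_functor C D F \<and>
     (\<exists>G. is_functor D C G \<and>
        (\<exists>\<eta>. natural_iso C C id_func (comp_func G F) \<eta>) \<and>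
        (\<exists>\<epsilon>. natural_iso D D (comp_func F G) id_func \<epsilon>))"


section \<open>Residuated lattices\<close>

text \<open>The monoid unit \<open>\<one>\<close> is the top element \<open>\<top>\<close> of the lattice.\<close>

record 'a rlat = "'a monoid" +
  rimp :: "'a \<Rightarrow> 'a \<Rightarrow> 'a" (infixr \<open>\<leadsto>\<index>\<close> 60)
  rjoin :: "'a \<Rightarrow> 'a \<Rightarrow> 'a" (infixl \<open>\<curlyvee>\<index>\<close> 65)
  rmeet :: "'a \<Rightarrow> 'a \<Rightarrow> 'a" (infixl \<open>\<curlywedge>\<index>\<close> 70)

record 'a brlat = "'a rlat" +
  rbot :: 'a (\<open>\<zero>\<index>\<close>)

locale lattice_ops =
  fixes L :: "'a set" and join meet :: "'a \<Rightarrow> 'a \<Rightarrow> 'a"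
  assumes join_closed: "\<lbrakk>x \<in> L; y \<in> L\<rbrakk> \<Longrightarrow> join x y \<in> L"
    and meet_closed: "\<lbrakk>x \<in> L; y \<in> L\<rbrakk> \<Longrightarrow> meet x y \<in> L"
    and join_comm: "\<lbrakk>x \<in> L; y \<in> L\<rbrakk> \<Longrightarrow> join x y = join y x"
    and meet_comm: "\<lbrakk>x \<in> L; y \<in> L\<rbrakk> \<Longrightarrow> meet x y = meet y x"
    and join_assoc: "\<lbrakk>x \<in> L; y \<in> L; z \<in> L\<rbrakk> \<Longrightarrow> join (join x y) z = join x (join y z)"
    and meet_assoc: "\<lbrakk>x \<in> L; y \<in> L; z \<in> L\<rbrakk> \<Longrightarrow> meet (meet x y) z = meet x (meet y z)"
    and join_meet_absorb: "\<lbrakk>x \<in> L; y \<in> L\<rbrakk> \<Longrightarrow> join x (meet x y) = x"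
    and meet_join_absorb: "\<lbrakk>x \<in> L; y \<in> L\<rbrakk> \<Longrightarrow> meet x (join x y) = x"

definition rle :: "('a, 'm) rlat_scheme \<Rightarrow> 'a \<Rightarrow> 'a \<Rightarrow> bool" (infix \<open>\<preceq>\<index>\<close> 50) where
  "x \<preceq>\<^bsub>A\<^esub> y \<longleftrightarrow> x \<curlywedge>\<^bsub>A\<^esub> y = x"

locale residuated_lattice =
  comm_monoid A + lattice_ops "carrier A" "rjoin A" "rmeet A" for A (structure) +
  assumes le_top: "x \<in> carrier A \<Longrightarrow> x \<preceq> \<one>"
    and imp_closed: "\<lbrakk>x \<in> carrier A; y \<in> carrier A\<rbrakk> \<Longrightarrow> x \<leadsto> y \<in> carrier A"
    and residuation: "\<lbrakk>x \<in> carrier A; y \<in> carrier A; z \<in> carrier A\<rbrakk>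
      \<Longrightarrow> x \<otimes> y \<preceq> z \<longleftrightarrow> x \<preceq> y \<leadsto> z"

locale bounded_residuated_lattice = residuated_lattice +
  assumes bot_closed: "\<zero> \<in> carrier A"
    and bot_le: "x \<in> carrier A \<Longrightarrow> \<zero> \<preceq> x"

definition rneg :: "('a, 'm) brlat_scheme \<Rightarrow> 'a \<Rightarrow> 'a" (\<open>\<sim>\<index> _\<close> [81] 80) where
  "\<sim>\<^bsub>A\<^esub> x = x \<leadsto>\<^bsub>A\<^esub> \<zero>\<^bsub>A\<^esub>"

locale stonean_residuated_lattice = bounded_residuated_lattice +
  assumes stonean: "x \<in> carrier A \<Longrightarrow> \<sim> x \<curlyvee> \<sim> (\<sim> x) = \<one>"

definition rl_hom ::
  "('a, 'm) rlat_scheme \<Rightarrow> ('b, 'n) rlat_scheme \<Rightarrow> ('a \<Rightarrow> 'b) \<Rightarrow> bool" where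
  "rl_hom A A' f \<longleftrightarrow> f \<in> carrier A \<rightarrow> carrier A' \<and> f \<one>\<^bsub>A\<^esub> = \<one>\<^bsub>A'\<^esub> \<and>
     (\<forall>x\<in>carrier A. \<forall>y\<in>carrier A.
        f (x \<otimes>\<^bsub>A\<^esub> y) = f x \<otimes>\<^bsub>A'\<^esub> f y \<and>
        f (x \<leadsto>\<^bsub>A\<^esub> y) = f x \<leadsto>\<^bsub>A'\<^esub> f y \<and>
        f (x \<curlyvee>\<^bsub>A\<^esub> y) = f x \<curlyvee>\<^bsub>A'\<^esub> f y \<and>
        f (x \<curlywedge>\<^bsub>A\<^esub> y) = f x \<curlywedge>\<^bsub>A'\<^esub> f y)"

definition brl_hom ::
  "('a, 'm) brlat_scheme \<Rightarrow> ('b, 'n) brlat_scheme \<Rightarrow> ('a \<Rightarrow> 'b) \<Rightarrow> bool" where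
  "brl_hom A A' f \<longleftrightarrow> rl_hom A A' f \<and> f \<zero>\<^bsub>A\<^esub> = \<zero>\<^bsub>A'\<^esub>"


section \<open>Subvarieties of Stonean residuated lattices\<close>

datatype rterm =
    Var nat | Top | Bot
  | Mult rterm rterm | Imp rterm rterm | Join rterm rterm | Meet rterm rterm

fun rterm_val :: "('a, 'm) brlat_scheme \<Rightarrow> (nat \<Rightarrow> 'a) \<Rightarrow> rterm \<Rightarrow> 'a" where
  "rterm_val A v (Var n) = v n"
| "rterm_val A v Top = \<one>\<^bsub>A\<^esub>"
| "rterm_val A v Bot = \<zero>\<^bsub>A\<^esub>"
| "rterm_val A v (Mult s t) = rterm_val A v s \<otimes>\<^bsub>A\<^esub> rterm_val A v t"
| "rterm_val A v (Imp s t) = rterm_val A v s \<leadsto>\<^bsub>A\<^esub> rterm_val A v t"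
| "rterm_val A v (Join s t) = rterm_val A v s \<curlyvee>\<^bsub>A\<^esub> rterm_val A v t"
| "rterm_val A v (Meet s t) = rterm_val A v s \<curlywedge>\<^bsub>A\<^esub> rterm_val A v t"

definition satisfies :: "('a, 'm) brlat_scheme \<Rightarrow> (rterm \<times> rterm) set \<Rightarrow> bool" where
  "satisfies A E \<longleftrightarrow>
     (\<forall>(s, t)\<in>E. \<forall>v. (\<forall>n. v n \<in> carrier A) \<longrightarrow> rterm_val A v s = rterm_val A v t)"

text \<open>A subvariety of the variety of Stonean residuated lattices is the class of all Stonean
  residuated lattices satisfying some set \<open>E\<close> of identities. It is presented by \<open>E\<close>, so that the
  same subvariety can be taken over different carrier types.\<close>

definition subvariety :: "(rterm \<times> rterm) set \<Rightarrow> 'a brlat set" where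
  "subvariety E = {A. stonean_residuated_lattice A \<and> satisfies A E}"

text \<open>\<open>None\<close> is the new least element \<open>o\<close>.\<close>

definition S_alg :: "('a, 'm) rlat_scheme \<Rightarrow> 'a option brlat" where
  "S_alg A =
     \<lparr>carrier = insert None (Some ` carrier A),
      monoid.mult = (\<lambda>x y. case (x, y) of (Some a, Some b) \<Rightarrow> Some (a \<otimes>\<^bsub>A\<^esub> b) | _ \<Rightarrow> None),
      one = Some \<one>\<^bsub>A\<^esub>,
      rimp = (\<lambda>x y. case x of None \<Rightarrow> Some \<one>\<^bsub>A\<^esub>
        | Some a \<Rightarrow> (case y of None \<Rightarrow> None | Some b \<Rightarrow> Some (a \<leadsto>\<^bsub>A\<^esub> b))),
      rjoin = (\<lambda>x y. case x of None \<Rightarrow> y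
        | Some a \<Rightarrow> (case y of None \<Rightarrow> Some a | Some b \<Rightarrow> Some (a \<curlyvee>\<^bsub>A\<^esub> b))),
      rmeet = (\<lambda>x y. case (x, y) of (Some a, Some b) \<Rightarrow> Some (a \<curlywedge>\<^bsub>A\<^esub> b) | _ \<Rightarrow> None),
      rbot = None\<rparr>"

definition subvariety_star :: "(rterm \<times> rterm) set \<Rightarrow> 'a rlat set" where
  "subvariety_star E = {A. residuated_lattice A \<and> S_alg A \<in> subvariety E}"


section \<open>Boolean algebras, Boolean and dense elements\<close>

record 'a balg = "'a partial_object" +
  bjoin :: "'a \<Rightarrow> 'a \<Rightarrow> 'a"
  bmeet :: "'a \<Rightarrow> 'a \<Rightarrow> 'a"
  bcompl :: "'a \<Rightarrow> 'a"
  bbot :: 'a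
  btop :: 'a

locale boolean_alg =
  lattice_ops "carrier B" "bjoin B" "bmeet B" for B :: "('a, 'm) balg_scheme" +
  assumes bbot_closed: "bbot B \<in> carrier B"
    and btop_closed: "btop B \<in> carrier B"
    and bcompl_closed: "x \<in> carrier B \<Longrightarrow> bcompl B x \<in> carrier B"
    and distrib: "\<lbrakk>x \<in> carrier B; y \<in> carrier B; z \<in> carrier B\<rbrakk>
      \<Longrightarrow> bmeet B x (bjoin B y z) = bjoin B (bmeet B x y) (bmeet B x z)"
    and join_bbot: "x \<in> carrier B \<Longrightarrow> bjoin B x (bbot B) = x"
    and meet_btop: "x \<in> carrier B \<Longrightarrow> bmeet B x (btop B) = x"
    and join_bcompl: "x \<in> carrier B \<Longrightarrow> bjoin B x (bcompl B x) = btop B"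
    and meet_bcompl: "x \<in> carrier B \<Longrightarrow> bmeet B x (bcompl B x) = bbot B"

definition boolean_hom ::
  "('a, 'm) balg_scheme \<Rightarrow> ('b, 'n) balg_scheme \<Rightarrow> ('a \<Rightarrow> 'b) \<Rightarrow> bool" where
  "boolean_hom B B' h \<longleftrightarrow> h \<in> carrier B \<rightarrow> carrier B' \<and>
     h (bbot B) = bbot B' \<and> h (btop B) = btop B' \<and>
     (\<forall>x\<in>carrier B. h (bcompl B x) = bcompl B' (h x)) \<and>
     (\<forall>x\<in>carrier B. \<forall>y\<in>carrier B.
        h (bjoin B x y) = bjoin B' (h x) (h y) \<and> h (bmeet B x y) = bmeet B' (h x) (h y))"

definition boolean_elems :: "('a, 'm) brlat_scheme \<Rightarrow> 'a set" where
  "boolean_elems A = {x \<in> carrier A. x \<curlyvee>\<^bsub>A\<^esub> \<sim>\<^bsub>A\<^esub> x = \<one>\<^bsub>A\<^esub> \<and> x \<curlywedge>\<^bsub>A\<^esub> \<sim>\<^bsub>A\<^esub> x = \<zero>\<^bsub>A\<^esub>}"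

definition dense_elems :: "('a, 'm) brlat_scheme \<Rightarrow> 'a set" where
  "dense_elems A = {x \<in> carrier A. \<sim>\<^bsub>A\<^esub> x = \<zero>\<^bsub>A\<^esub>}"

definition B_alg :: "('a, 'm) brlat_scheme \<Rightarrow> 'a balg" where
  "B_alg A = \<lparr>carrier = boolean_elems A, bjoin = rjoin A, bmeet = rmeet A, bcompl = rneg A,
     bbot = \<zero>\<^bsub>A\<^esub>, btop = \<one>\<^bsub>A\<^esub>\<rparr>"

definition D_alg :: "('a, 'm) brlat_scheme \<Rightarrow> 'a rlat" where
  "D_alg A = \<lparr>carrier = dense_elems A, monoid.mult = monoid.mult A, one = \<one>\<^bsub>A\<^esub>,
     rimp = rimp A, rjoin = rjoin A, rmeet = rmeet A\<rparr>"


section \<open>The category of triples\<close>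

definition i_filter :: "('a, 'm) rlat_scheme \<Rightarrow> 'a set \<Rightarrow> bool" where
  "i_filter D F \<longleftrightarrow> F \<subseteq> carrier D \<and> \<one>\<^bsub>D\<^esub> \<in> F \<and>
     (\<forall>x\<in>carrier D. \<forall>y\<in>carrier D. x \<in> F \<longrightarrow> x \<leadsto>\<^bsub>D\<^esub> y \<in> F \<longrightarrow> y \<in> F)"

definition i_filters :: "('a, 'm) rlat_scheme \<Rightarrow> 'a set gorder" where
  "i_filters D = \<lparr>carrier = {F. i_filter D F}, eq = (=), le = (\<subseteq>)\<rparr>"

definition filter_hom ::
  "('b, 'm) balg_scheme \<Rightarrow> ('d, 'n) rlat_scheme \<Rightarrow> ('b \<Rightarrow> 'd set) \<Rightarrow> bool" where
  "filter_hom B D \<phi> \<longleftrightarrow> \<phi> \<in> carrier B \<rightarrow> carrier (i_filters D) \<and>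
     \<phi> (bbot B) = \<bottom>\<^bsub>i_filters D\<^esub> \<and> \<phi> (btop B) = \<top>\<^bsub>i_filters D\<^esub> \<and>
     (\<forall>a\<in>carrier B. \<forall>b\<in>carrier B.
        \<phi> (bjoin B a b) = \<phi> a \<squnion>\<^bsub>i_filters D\<^esub> \<phi> b \<and>
        \<phi> (bmeet B a b) = \<phi> a \<sqinter>\<^bsub>i_filters D\<^esub> \<phi> b)"

record ('b, 'd) triple =
  boolean_part :: "'b balg"
  dense_part :: "'d rlat"
  filter_map :: "'b \<Rightarrow> 'd set"

definition is_triple :: "('b, 'd) triple \<Rightarrow> bool" where
  "is_triple X \<longleftrightarrow> boolean_alg (boolean_part X) \<and> residuated_lattice (dense_part X) \<and>
     filter_hom (boolean_part X) (dense_part X) (filter_map X)"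

text \<open>Arrows are functions made extensional on the carrier, so that equality of arrows is
  equality on the carrier.\<close>

definition triple_cat :: "(('b, 'd) triple, ('b \<Rightarrow> 'b) \<times> ('d \<Rightarrow> 'd)) cat" where
  "triple_cat =
     \<lparr>Obj = {X. is_triple X},
      Hom = (\<lambda>X Y. {(h, k).
        h \<in> extensional (carrier (boolean_part X)) \<and> boolean_hom (boolean_part X) (boolean_part Y) h \<and>
        k \<in> extensional (carrier (dense_part X)) \<and> rl_hom (dense_part X) (dense_part Y) k \<and>
        (\<forall>a\<in>carrier (boolean_part X). k ` filter_map X a \<subseteq> filter_map Y (h a))}),
      Id = (\<lambda>X. (\<lambda>x\<in>carrier (boolean_part X). x, \<lambda>x\<in>carrier (dense_part X). x)),
      Comp = (\<lambda>X Y Z (h', k') (h, k).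
        (compose (carrier (boolean_part X)) h' h, compose (carrier (dense_part X)) k' k))\<rparr>"

definition subvariety_triple_cat ::
  "(rterm \<times> rterm) set \<Rightarrow> (('b, 'd) triple, ('b \<Rightarrow> 'b) \<times> ('d \<Rightarrow> 'd)) cat" where
  "subvariety_triple_cat E = full_subcategory triple_cat (\<lambda>X. dense_part X \<in> subvariety_star E)"

definition subvariety_cat :: "(rterm \<times> rterm) set \<Rightarrow> ('a brlat, 'a \<Rightarrow> 'a) cat" where
  "subvariety_cat E =
     \<lparr>Obj = subvariety E,
      Hom = (\<lambda>A A'. {f. f \<in> extensional (carrier A) \<and> brl_hom A A' f}),
      Id = (\<lambda>A. \<lambda>x\<in>carrier A. x),
      Comp = (\<lambda>A A' A'' g f. compose (carrier A) g f)\<rparr>"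


section \<open>The functor \<open>T\<close>\<close>

definition phi :: "('a, 'm) brlat_scheme \<Rightarrow> 'a \<Rightarrow> 'a set" where
  "phi A a = {x \<in> dense_elems A. \<sim>\<^bsub>A\<^esub> a \<preceq>\<^bsub>A\<^esub> x}"

definition T_func ::
  "('a brlat, 'a \<Rightarrow> 'a, ('a, 'a) triple, ('a \<Rightarrow> 'a) \<times> ('a \<Rightarrow> 'a)) func" where
  "T_func =
     \<lparr>onObj = (\<lambda>A. \<lparr>boolean_part = B_alg A, dense_part = D_alg A, filter_map = phi A\<rparr>),
      onArr = (\<lambda>A A' f. (restrict f (boolean_elems A), restrict f (dense_elems A)))\<rparr>"

end

theory Submission
  imports Defs
begin

text \<open>Every element \<open>x\<close> of a Stonean residuated lattice is the product of the Boolean element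
  \<open>\<sim> \<sim> x\<close> and the dense element \<open>x \<curlyvee> \<sim> x\<close>, so \<open>T\<close> is faithful. The operations on such
  products are given by terms in the two factors, and a morphism \<open>(h, k)\<close> of triples satisfies
  \<open>k (c \<curlyvee> d) = h c \<curlyvee> k d\<close> for Boolean \<open>c\<close> and dense \<open>d\<close>; hence
  \<open>c \<otimes> d \<mapsto> h c \<otimes> k d\<close> is a homomorphism and \<open>T\<close> is full.

  Given a triple \<open>(B, D, \<phi>)\<close>, each \<open>c\<close> in \<open>B\<close> gives an endomorphism of \<open>D\<close> with image \<open>\<phi> c\<close>,
  because \<open>\<phi> c\<close> and \<open>\<phi> (- c)\<close> are complementary filters. With these endomorphisms the pairs
  \<open>(a, d)\<close> with \<open>d \<in> \<phi> a\<close> become an algebra that is mapped to the triple up to isomorphism. On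
  finitely many of its elements it looks like a power of \<open>S(D)\<close>: a sufficiently fine element
  \<open>c\<close> of \<open>B\<close> lies below or is disjoint from each of the first components, and restricting to
  such a \<open>c\<close> is a homomorphism into \<open>S(D)\<close>. So the algebra satisfies every identity of
  \<open>S(D)\<close>.\<close>

section \<open>Recognising equivalences of categories\<close>

text \<open>The difficulty lies in essential surjectivity. In the picture of functions on the Stone
  space of the Boolean part, an element of \<open>\<phi> a\<close> is \<open>\<one>\<close> outside
  \<open>a\<close>, so congruence modulo \<open>\<phi> (\<complement>c)\<close> means agreement on
  \<open>c\<close>. Since \<open>\<phi> c\<close> and \<open>\<phi> (\<complement>c)\<close>
  generate \<open>D\<close> and meet in \<open>{\<one>}\<close>, a Chinese remainder argument lets
  \<open>d\<close> on \<open>c\<close> and \<open>\<one>\<close> elsewhere be pasted to one element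
  of \<open>D\<close>; this gives the endomorphisms. Checking the axioms and the identities of V
  directly on pairs would be laborious, above all because of the join. The usual remedy is a stalk
  at each ultrafilter, with a quotient of \<open>D\<close> as its dense part. Here a nonzero Boolean
  element that decides finitely many supports replaces the ultrafilter: the values then lie in S(D)
  itself, whose membership in V is the definition of V*. Both the residuated lattice axioms and the
  identities of V are pulled back along these partial homomorphisms.\<close>

lemma is_equivalenceI:
  fixes C :: "('o1, 'm1) cat" and D :: "('o2, 'm2) cat"
  assumes F: "is_functor C D F"
    and full: "\<And>a b g. \<lbrakk>a \<in> Obj C; b \<in> Obj C; g \<in> Hom D (onObj F a) (onObj F b)\<rbrakk>
      \<Longrightarrow> \<exists>f\<in>Hom C a b. onArr F a b f = g"
    and faithful: "\<And>a b f g. \<lbrakk>a \<in> Obj C; b \<in> Obj C; f \<in> Hom C a b; g \<in> Hom C a b;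
      onArr F a b f = onArr F a b g\<rbrakk> \<Longrightarrow> f = g"
    and surj: "\<And>d. d \<in> Obj D \<Longrightarrow> \<exists>a\<in>Obj C. \<exists>e. is_iso D (onObj F a) d e"
  shows "is_equivalence C D F"
proof -
  let ?F = "onObj F"
  have catC: "category C" and catD: "category D"
    using F unfolding is_functor_def by auto
  have idC: "\<And>a. a \<in> Obj C \<Longrightarrow> Id C a \<in> Hom C a a"
    and compC: "\<And>a b c f g. \<lbrakk>a \<in> Obj C; b \<in> Obj C; c \<in> Obj C; f \<in> Hom C a b; g \<in> Hom C b c\<rbrakk>
      \<Longrightarrow> Comp C a b c g f \<in> Hom C a c"
    using catC unfolding category_def by auto
  have idD: "\<And>a. a \<in> Obj D \<Longrightarrow> Id D a \<in> Hom D a a"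
    and compD: "\<And>a b c f g. \<lbrakk>a \<in> Obj D; b \<in> Obj D; c \<in> Obj D; f \<in> Hom D a b; g \<in> Hom D b c\<rbrakk>
      \<Longrightarrow> Comp D a b c g f \<in> Hom D a c"
    and idrD: "\<And>a b f. \<lbrakk>a \<in> Obj D; b \<in> Obj D; f \<in> Hom D a b\<rbrakk> \<Longrightarrow> Comp D a a b f (Id D a) = f"
    and idlD: "\<And>a b f. \<lbrakk>a \<in> Obj D; b \<in> Obj D; f \<in> Hom D a b\<rbrakk> \<Longrightarrow> Comp D a b b (Id D b) f = f"
    and assocD: "\<And>a b c d f g h. \<lbrakk>a \<in> Obj D; b \<in> Obj D; c \<in> Obj D; d \<in> Obj D;
        f \<in> Hom D a b; g \<in> Hom D b c; h \<in> Hom D c d\<rbrakk>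
      \<Longrightarrow> Comp D a c d h (Comp D a b c g f) = Comp D a b d (Comp D b c d h g) f"
    using catD unfolding category_def by auto
  have FO: "\<And>a. a \<in> Obj C \<Longrightarrow> ?F a \<in> Obj D"
    and FH: "\<And>a b f. \<lbrakk>a \<in> Obj C; b \<in> Obj C; f \<in> Hom C a b\<rbrakk> \<Longrightarrow> onArr F a b f \<in> Hom D (?F a) (?F b)"
    and FId: "\<And>a. a \<in> Obj C \<Longrightarrow> onArr F a a (Id C a) = Id D (?F a)"
    and FC: "\<And>a b c f g. \<lbrakk>a \<in> Obj C; b \<in> Obj C; c \<in> Obj C; f \<in> Hom C a b; g \<in> Hom C b c\<rbrakk>
      \<Longrightarrow> onArr F a c (Comp C a b c g f) =
          Comp D (?F a) (?F b) (?F c) (onArr F b c g) (onArr F a b f)"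
    using F unfolding is_functor_def by auto
  define L where "L a b g = (SOME f. f \<in> Hom C a b \<and> onArr F a b f = g)" for a b g
  have L: "L a b g \<in> Hom C a b" "onArr F a b (L a b g) = g"
    if "a \<in> Obj C" "b \<in> Obj C" "g \<in> Hom D (?F a) (?F b)" for a b g
    using someI_ex[of "\<lambda>f. f \<in> Hom C a b \<and> onArr F a b f = g"] full[OF that]
    unfolding L_def by blast+
  have "\<forall>d. \<exists>a e e'. d \<in> Obj D \<longrightarrow> a \<in> Obj C \<and> e \<in> Hom D (?F a) d \<and> e' \<in> Hom D d (?F a) \<and>
      Comp D (?F a) d (?F a) e' e = Id D (?F a) \<and> Comp D d (?F a) d e e' = Id D d"
    using surj unfolding is_iso_def by meson
  then obtain G e e' where G: "\<And>d. d \<in> Obj D \<Longrightarrow> G d \<in> Obj C"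
    and e: "\<And>d. d \<in> Obj D \<Longrightarrow> e d \<in> Hom D (?F (G d)) d"
    and e': "\<And>d. d \<in> Obj D \<Longrightarrow> e' d \<in> Hom D d (?F (G d))"
    and e'e: "\<And>d. d \<in> Obj D \<Longrightarrow> Comp D (?F (G d)) d (?F (G d)) (e' d) (e d) = Id D (?F (G d))"
    and ee': "\<And>d. d \<in> Obj D \<Longrightarrow> Comp D d (?F (G d)) d (e d) (e' d) = Id D d"
    by metis
  \<comment> \<open>\<open>H x y f\<close> is \<open>f\<close> conjugated by the chosen
    isomorphisms: \<open>e x\<close>, then \<open>f\<close>, then \<open>e' y\<close>. It runs
    between values of \<open>F\<close>, so \<open>L\<close> can lift it to \<open>C\<close>.\<close>
  define H where "H x y f = Comp D (?F (G x)) y (?F (G y)) (e' y) (Comp D (?F (G x)) x y f (e x))"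
    for x y f
  have FG: "\<And>d. d \<in> Obj D \<Longrightarrow> ?F (G d) \<in> Obj D" using G FO by blast
  have H: "H x y f \<in> Hom D (?F (G x)) (?F (G y))"
    if "x \<in> Obj D" "y \<in> Obj D" "f \<in> Hom D x y" for x y f
    unfolding H_def using that e e' FG by (intro compD) auto
  have eH: "Comp D (?F (G x)) (?F (G y)) y (e y) (H x y f) = Comp D (?F (G x)) x y f (e x)"
    if "x \<in> Obj D" "y \<in> Obj D" "f \<in> Hom D x y" for x y f
    unfolding H_def using that
    by (subst assocD) (simp_all add: compD FG e e' ee' idlD)
  \<comment> \<open>\<open>e y\<close> has the left inverse \<open>e' y\<close>, so arrows into
    \<open>?F (G y)\<close> may be compared after composing with \<open>e y\<close>; by
    \<open>eH\<close> this turns \<open>H\<close> back into the original arrow.\<close>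
  have e_mono: "g = h" if "x \<in> Obj D" "y \<in> Obj D" "g \<in> Hom D x (?F (G y))" "h \<in> Hom D x (?F (G y))"
    and eq: "Comp D x (?F (G y)) y (e y) g = Comp D x (?F (G y)) y (e y) h" for x y g h
  proof -
    have "Comp D x y (?F (G y)) (e' y) (Comp D x (?F (G y)) y (e y) k) = k"
      if "k \<in> Hom D x (?F (G y))" for k
      using that \<open>x \<in> Obj D\<close> \<open>y \<in> Obj D\<close>
      by (subst assocD) (simp_all add: compD FG e e' e'e idlD)
    then show ?thesis using that by metis
  qed
  define GF where "GF = \<lparr>onObj = G, onArr = (\<lambda>x y f. L (G x) (G y) (H x y f))\<rparr>"
  have GFs: "onObj GF = G" "onArr GF x y f = L (G x) (G y) (H x y f)" for x y f
    by (simp_all add: GF_def)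
  have HId: "H x x (Id D x) = Id D (?F (G x))" if "x \<in> Obj D" for x
    unfolding H_def using that by (simp add: idlD FG e e'e)
  have HC: "H x z (Comp D x y z g f) = Comp D (?F (G x)) (?F (G y)) (?F (G z)) (H y z g) (H x y f)"
    if "x \<in> Obj D" "y \<in> Obj D" "z \<in> Obj D" "f \<in> Hom D x y" "g \<in> Hom D y z" for x y z f g
  proof (rule e_mono)
    have "Comp D (?F (G x)) (?F (G z)) z (e z)
        (Comp D (?F (G x)) (?F (G y)) (?F (G z)) (H y z g) (H x y f)) =
        Comp D (?F (G x)) (?F (G y)) z (Comp D (?F (G y)) y z g (e y)) (H x y f)"
      using that by (subst assocD) (simp_all add: compD FG e H eH)
    also have "\<dots> = Comp D (?F (G x)) y z g (Comp D (?F (G x)) x y f (e x))"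
      using that by (subst assocD[symmetric]) (simp_all add: compD FG e H eH)
    also have "\<dots> = Comp D (?F (G x)) x z (Comp D x y z g f) (e x)"
      using that by (subst assocD) (simp_all add: FG e)
    also have "\<dots> = Comp D (?F (G x)) (?F (G z)) z (e z) (H x z (Comp D x y z g f))"
      using that by (subst eH) (auto intro: compD)
    finally show "Comp D (?F (G x)) (?F (G z)) z (e z) (H x z (Comp D x y z g f)) =
      Comp D (?F (G x)) (?F (G z)) z (e z)
        (Comp D (?F (G x)) (?F (G y)) (?F (G z)) (H y z g) (H x y f))" ..
  qed (use that in \<open>auto intro: FG H compD\<close>)
  \<comment> \<open>The lifts are chosen arrow by arrow; the functor laws hold for them because
    their images under \<open>F\<close> satisfy the laws and \<open>F\<close> is faithful.\<close>
  have funG: "is_functor D C GF"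
    unfolding is_functor_def GFs
  proof (intro conjI ballI catC catD)
    fix x assume x: "x \<in> Obj D"
    show "G x \<in> Obj C" by (rule G[OF x])
    show "L (G x) (G x) (H x x (Id D x)) = Id C (G x)"
      using x by (intro faithful[of "G x" "G x"]) (simp_all add: G L H idD idC FId HId FG)
    fix y assume y: "y \<in> Obj D"
    { fix f assume f: "f \<in> Hom D x y"
      show "L (G x) (G y) (H x y f) \<in> Hom C (G x) (G y)"
        using x y f by (simp add: L G H) }
    note LH = this
    fix z f g assume z: "z \<in> Obj D" and f: "f \<in> Hom D x y" and g: "g \<in> Hom D y z"
    show "L (G x) (G z) (H x z (Comp D x y z g f)) =
      Comp C (G x) (G y) (G z) (L (G y) (G z) (H y z g)) (L (G x) (G y) (H x y f))"
      using x y z f g by (intro faithful[of "G x" "G z"]) (simp_all add: G L H FG compC compD FC HC)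
  qed
  \<comment> \<open>The lift of \<open>e (?F a)\<close> will be the inverse of
    \<open>\<eta> a\<close>. The inverse laws and naturality are verified after applying
    \<open>F\<close>.\<close>
  define \<eta> where "\<eta> a = L a (G (?F a)) (e' (?F a))" for a
  have \<eta>: "\<eta> a \<in> Hom C a (G (?F a))" "onArr F a (G (?F a)) (\<eta> a) = e' (?F a)"
    if "a \<in> Obj C" for a
    using that L[of a "G (?F a)" "e' (?F a)"] by (simp_all add: \<eta>_def G FO e')
  have "natural_iso C C id_func (comp_func GF F) \<eta>"
    unfolding natural_iso_def id_func_def comp_func_def
  proof (intro conjI ballI; simp add: GFs)
    fix a assume a: "a \<in> Obj C"
    define \<theta> where "\<theta> = L (G (?F a)) a (e (?F a))"
    have \<theta>: "\<theta> \<in> Hom C (G (?F a)) a" "onArr F (G (?F a)) a \<theta> = e (?F a)"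
      using a L[of "G (?F a)" a "e (?F a)"] by (simp_all add: \<theta>_def G FO e)
    have "Comp C a (G (?F a)) a \<theta> (\<eta> a) = Id C a"
      using a \<theta> \<eta>[OF a] by (intro faithful[of a a]) (simp_all add: compC idC G FO FC FId ee')
    moreover have "Comp C (G (?F a)) a (G (?F a)) (\<eta> a) \<theta> = Id C (G (?F a))"
      using a \<theta> \<eta>[OF a] by (intro faithful[of "G (?F a)" "G (?F a)"])
        (simp_all add: compC idC G FO FC FId e'e)
    ultimately show "is_iso C a (G (?F a)) (\<eta> a)"
      unfolding is_iso_def using \<eta>[OF a] \<theta> by blast
    fix b f assume b: "b \<in> Obj C" and f: "f \<in> Hom C a b"
    let ?f = "onArr F a b f"
    have f': "?f \<in> Hom D (?F a) (?F b)" using a b f by (simp add: FH)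
    have "Comp D (?F a) (?F b) (?F (G (?F b))) (e' (?F b)) ?f =
        Comp D (?F a) (?F (G (?F a))) (?F (G (?F b))) (H (?F a) (?F b) ?f) (e' (?F a))"
    proof (rule e_mono)
      have "Comp D (?F a) (?F (G (?F b))) (?F b) (e (?F b))
          (Comp D (?F a) (?F (G (?F a))) (?F (G (?F b))) (H (?F a) (?F b) ?f) (e' (?F a))) =
          Comp D (?F a) (?F (G (?F a))) (?F b)
            (Comp D (?F (G (?F a))) (?F a) (?F b) ?f (e (?F a))) (e' (?F a))"
        using a b f' by (subst assocD) (simp_all add: compD FG e e' H FO eH FO)
      also have "\<dots> = ?f"
        using a b f' by (subst assocD[symmetric]) (simp_all add: compD FG e e' H FO ee' FO idrD)
      also have "\<dots> = Comp D (?F a) (?F (G (?F b))) (?F b) (e (?F b))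
          (Comp D (?F a) (?F b) (?F (G (?F b))) (e' (?F b)) ?f)"
        using a b f' by (subst assocD) (simp_all add: compD FG e e' H FO ee' FO idlD)
      finally show "Comp D (?F a) (?F (G (?F b))) (?F b) (e (?F b))
          (Comp D (?F a) (?F b) (?F (G (?F b))) (e' (?F b)) ?f) =
        Comp D (?F a) (?F (G (?F b))) (?F b) (e (?F b))
          (Comp D (?F a) (?F (G (?F a))) (?F (G (?F b))) (H (?F a) (?F b) ?f) (e' (?F a)))" ..
    qed (use a b f' in \<open>simp_all add: FG H compD e e' FO G\<close>)
    then show "Comp C a b (G (?F b)) (\<eta> b) f =
        Comp C a (G (?F a)) (G (?F b)) (L (G (?F a)) (G (?F b)) (H (?F a) (?F b) ?f)) (\<eta> a)"
      using a b f f' \<eta>[OF a] \<eta>[OF b]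
      by (intro faithful[of a "G (?F b)"]) (simp_all add: compC G FO FG FC L H)
  qed
  moreover have "natural_iso D D (comp_func F GF) id_func e"
    unfolding natural_iso_def id_func_def comp_func_def is_iso_def
    using e e' ee' e'e by (auto simp: GFs L G H eH intro!: bexI[of _ "e' _"])
  ultimately show ?thesis
    unfolding is_equivalence_def using F funG by blast
qed

section \<open>Residuated lattices\<close>

context residuated_lattice
begin

lemmas closed [simp] = join_closed meet_closed imp_closed m_closed one_closed

lemma meet_idem: "x \<in> carrier A \<Longrightarrow> x \<curlywedge> x = x"
  by (metis join_meet_absorb meet_join_absorb meet_closed)

lemma le_refl [simp]: "x \<in> carrier A \<Longrightarrow> x \<preceq> x"
  by (simp add: rle_def meet_idem)

lemma le_antisym: "\<lbrakk>x \<preceq> y; y \<preceq> x; x \<in> carrier A; y \<in> carrier A\<rbrakk> \<Longrightarrow> x = y"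
  unfolding rle_def by (metis meet_comm)

lemma le_trans: "\<lbrakk>x \<preceq> y; y \<preceq> z; x \<in> carrier A; y \<in> carrier A; z \<in> carrier A\<rbrakk> \<Longrightarrow> x \<preceq> z"
  unfolding rle_def by (metis meet_assoc)

lemma meet_le1 [simp]: "\<lbrakk>x \<in> carrier A; y \<in> carrier A\<rbrakk> \<Longrightarrow> x \<curlywedge> y \<preceq> x"
  unfolding rle_def by (metis meet_assoc meet_comm meet_idem meet_closed)

lemma meet_le2 [simp]: "\<lbrakk>x \<in> carrier A; y \<in> carrier A\<rbrakk> \<Longrightarrow> x \<curlywedge> y \<preceq> y"
  by (metis meet_comm meet_le1)

lemma meet_left_comm:
  "\<lbrakk>x \<in> carrier A; y \<in> carrier A; z \<in> carrier A\<rbrakk> \<Longrightarrow> x \<curlywedge> (y \<curlywedge> z) = y \<curlywedge> (x \<curlywedge> z)"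
  by (metis meet_assoc meet_comm)

lemma meet_greatest:
  "\<lbrakk>z \<preceq> x; z \<preceq> y; x \<in> carrier A; y \<in> carrier A; z \<in> carrier A\<rbrakk> \<Longrightarrow> z \<preceq> x \<curlywedge> y"
  unfolding rle_def by (metis meet_assoc)

lemma le_iff_join: "\<lbrakk>x \<in> carrier A; y \<in> carrier A\<rbrakk> \<Longrightarrow> x \<preceq> y \<longleftrightarrow> x \<curlyvee> y = y"
  unfolding rle_def by (metis join_comm join_meet_absorb meet_comm meet_join_absorb)

lemma join_ge1 [simp]: "\<lbrakk>x \<in> carrier A; y \<in> carrier A\<rbrakk> \<Longrightarrow> x \<preceq> x \<curlyvee> y"
  by (simp add: rle_def meet_join_absorb)

lemma join_ge2 [simp]: "\<lbrakk>x \<in> carrier A; y \<in> carrier A\<rbrakk> \<Longrightarrow> y \<preceq> x \<curlyvee> y"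
  by (metis join_comm join_ge1)

lemma join_least:
  "\<lbrakk>x \<preceq> z; y \<preceq> z; x \<in> carrier A; y \<in> carrier A; z \<in> carrier A\<rbrakk> \<Longrightarrow> x \<curlyvee> y \<preceq> z"
  by (simp add: le_iff_join join_assoc)

lemma le_joinI1: "\<lbrakk>z \<preceq> x; x \<in> carrier A; y \<in> carrier A; z \<in> carrier A\<rbrakk> \<Longrightarrow> z \<preceq> x \<curlyvee> y"
  by (meson join_ge1 join_closed le_trans)

lemma le_joinI2: "\<lbrakk>z \<preceq> y; x \<in> carrier A; y \<in> carrier A; z \<in> carrier A\<rbrakk> \<Longrightarrow> z \<preceq> x \<curlyvee> y"
  by (meson join_ge2 join_closed le_trans)

lemma meet_leI1: "\<lbrakk>x \<preceq> z; x \<in> carrier A; y \<in> carrier A; z \<in> carrier A\<rbrakk> \<Longrightarrow> x \<curlywedge> y \<preceq> z"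
  by (meson meet_le1 meet_closed le_trans)

lemma meet_leI2: "\<lbrakk>y \<preceq> z; x \<in> carrier A; y \<in> carrier A; z \<in> carrier A\<rbrakk> \<Longrightarrow> x \<curlywedge> y \<preceq> z"
  by (meson meet_le2 meet_closed le_trans)

lemma le_one_iff: "x \<in> carrier A \<Longrightarrow> \<one> \<preceq> x \<longleftrightarrow> x = \<one>"
  by (metis le_antisym le_refl le_top one_closed)

lemma mult_imp_le: "\<lbrakk>x \<in> carrier A; y \<in> carrier A\<rbrakk> \<Longrightarrow> x \<otimes> (x \<leadsto> y) \<preceq> y"
  by (metis residuation imp_closed le_refl m_comm)

lemma mult_mono1: "\<lbrakk>x \<preceq> y; x \<in> carrier A; y \<in> carrier A; z \<in> carrier A\<rbrakk> \<Longrightarrow> x \<otimes> z \<preceq> y \<otimes> z"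
  by (metis residuation imp_closed le_refl le_trans m_closed)

lemma mult_mono2: "\<lbrakk>x \<preceq> y; x \<in> carrier A; y \<in> carrier A; z \<in> carrier A\<rbrakk> \<Longrightarrow> z \<otimes> x \<preceq> z \<otimes> y"
  by (metis mult_mono1 m_comm)

lemma mult_mono:
  "\<lbrakk>x \<preceq> y; u \<preceq> v; x \<in> carrier A; y \<in> carrier A; u \<in> carrier A; v \<in> carrier A\<rbrakk>
    \<Longrightarrow> x \<otimes> u \<preceq> y \<otimes> v"
  by (meson mult_mono1 mult_mono2 le_trans m_closed)

lemma mult_le1 [simp]: "\<lbrakk>x \<in> carrier A; y \<in> carrier A\<rbrakk> \<Longrightarrow> x \<otimes> y \<preceq> x"
  by (metis mult_mono2 le_top one_closed r_one)

lemma mult_le2 [simp]: "\<lbrakk>x \<in> carrier A; y \<in> carrier A\<rbrakk> \<Longrightarrow> x \<otimes> y \<preceq> y"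
  by (metis mult_le1 m_comm)

lemma mult_leI1: "\<lbrakk>x \<preceq> z; x \<in> carrier A; y \<in> carrier A; z \<in> carrier A\<rbrakk> \<Longrightarrow> x \<otimes> y \<preceq> z"
  by (meson mult_le1 m_closed le_trans)

lemma mult_leI2: "\<lbrakk>y \<preceq> z; x \<in> carrier A; y \<in> carrier A; z \<in> carrier A\<rbrakk> \<Longrightarrow> x \<otimes> y \<preceq> z"
  by (meson mult_le2 m_closed le_trans)

lemma mult_le_meet: "\<lbrakk>x \<in> carrier A; y \<in> carrier A\<rbrakk> \<Longrightarrow> x \<otimes> y \<preceq> x \<curlywedge> y"
  by (simp add: meet_greatest)

lemma imp_eq_one_iff: "\<lbrakk>x \<in> carrier A; y \<in> carrier A\<rbrakk> \<Longrightarrow> x \<leadsto> y = \<one> \<longleftrightarrow> x \<preceq> y"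
  by (metis residuation imp_closed le_one_iff l_one one_closed)

lemma imp_refl [simp]: "x \<in> carrier A \<Longrightarrow> x \<leadsto> x = \<one>"
  by (simp add: imp_eq_one_iff)

lemma imp_one [simp]: "x \<in> carrier A \<Longrightarrow> x \<leadsto> \<one> = \<one>"
  by (simp add: imp_eq_one_iff le_top)

lemma one_imp [simp]: "x \<in> carrier A \<Longrightarrow> \<one> \<leadsto> x = x"
  by (metis (no_types, lifting) le_antisym imp_closed le_refl one_closed r_one residuation)

lemma le_imp: "\<lbrakk>x \<in> carrier A; y \<in> carrier A\<rbrakk> \<Longrightarrow> y \<preceq> x \<leadsto> y"
  by (metis mult_le1 residuation)

lemma join_one [simp]: "x \<in> carrier A \<Longrightarrow> x \<curlyvee> \<one> = \<one>" "x \<in> carrier A \<Longrightarrow> \<one> \<curlyvee> x = \<one>"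
  by (metis le_iff_join le_top one_closed, metis join_comm le_iff_join le_top one_closed)

lemma meet_one [simp]: "x \<in> carrier A \<Longrightarrow> x \<curlywedge> \<one> = x" "x \<in> carrier A \<Longrightarrow> \<one> \<curlywedge> x = x"
  by (metis rle_def le_top, metis meet_comm rle_def le_top one_closed)

text \<open>Multiplication by \<open>x\<close> is left adjoint to \<open>x \<leadsto> _\<close> and
  therefore preserves joins.\<close>

lemma mult_join_distrib:
  assumes [simp]: "x \<in> carrier A" "y \<in> carrier A" "z \<in> carrier A"
  shows "x \<otimes> (y \<curlyvee> z) = (x \<otimes> y) \<curlyvee> (x \<otimes> z)"
proof (rule le_antisym)
  have "y \<curlyvee> z \<preceq> x \<leadsto> ((x \<otimes> y) \<curlyvee> (x \<otimes> z))"
    by (intro join_least) (simp_all flip: residuation add: m_comm[of _ x])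
  then show "x \<otimes> (y \<curlyvee> z) \<preceq> (x \<otimes> y) \<curlyvee> (x \<otimes> z)"
    by (simp flip: residuation add: m_comm[of _ x])
qed (simp_all add: join_least mult_mono2)

lemma join_mult_distrib:
  "\<lbrakk>x \<in> carrier A; y \<in> carrier A; z \<in> carrier A\<rbrakk> \<Longrightarrow> (y \<curlyvee> z) \<otimes> x = (y \<otimes> x) \<curlyvee> (z \<otimes> x)"
  by (simp add: m_comm[of _ x] mult_join_distrib)

text \<open>By residuation and associativity both sides have the same elements below them.\<close>

lemma imp_mult:
  assumes [simp]: "x \<in> carrier A" "y \<in> carrier A" "z \<in> carrier A"
  shows "(x \<otimes> y) \<leadsto> z = x \<leadsto> (y \<leadsto> z)"
proof -
  have "w \<preceq> (x \<otimes> y) \<leadsto> z \<longleftrightarrow> w \<preceq> x \<leadsto> (y \<leadsto> z)" if "w \<in> carrier A" for w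
    using that by (simp flip: residuation add: m_assoc)
  then show ?thesis
    by (meson assms imp_closed le_antisym le_refl m_closed)
qed

lemma imp_antimono:
  "\<lbrakk>x \<preceq> y; x \<in> carrier A; y \<in> carrier A; z \<in> carrier A\<rbrakk> \<Longrightarrow> y \<leadsto> z \<preceq> x \<leadsto> z"
  by (meson imp_closed le_refl le_trans m_closed mult_mono2 residuation)

end

section \<open>Boolean and dense elements of Stonean residuated lattices\<close>

context bounded_residuated_lattice
begin

declare bot_closed [simp]

lemma neg_closed [simp]: "x \<in> carrier A \<Longrightarrow> \<sim> x \<in> carrier A"
  by (simp add: rneg_def)

lemma le_bot_iff: "x \<in> carrier A \<Longrightarrow> x \<preceq> \<zero> \<longleftrightarrow> x = \<zero>"
  by (metis bot_closed bot_le le_antisym le_refl)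

lemma mult_bot [simp]: "x \<in> carrier A \<Longrightarrow> x \<otimes> \<zero> = \<zero>" "x \<in> carrier A \<Longrightarrow> \<zero> \<otimes> x = \<zero>"
  by (metis bot_closed mult_le2 le_bot_iff m_closed, metis bot_closed mult_le1 le_bot_iff m_closed)

lemma join_bot [simp]: "x \<in> carrier A \<Longrightarrow> x \<curlyvee> \<zero> = x" "x \<in> carrier A \<Longrightarrow> \<zero> \<curlyvee> x = x"
  by (metis bot_closed bot_le join_comm le_iff_join, metis bot_closed bot_le le_iff_join)

lemma meet_bot [simp]: "x \<in> carrier A \<Longrightarrow> x \<curlywedge> \<zero> = \<zero>" "x \<in> carrier A \<Longrightarrow> \<zero> \<curlywedge> x = \<zero>"
  by (metis bot_closed bot_le meet_comm rle_def, metis bot_le rle_def)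

lemma bot_imp [simp]: "x \<in> carrier A \<Longrightarrow> \<zero> \<leadsto> x = \<one>"
  by (simp add: imp_eq_one_iff bot_le)

lemma le_neg_iff: "\<lbrakk>x \<in> carrier A; y \<in> carrier A\<rbrakk> \<Longrightarrow> x \<preceq> \<sim> y \<longleftrightarrow> x \<otimes> y = \<zero>"
  by (simp add: rneg_def le_bot_iff flip: residuation)

lemma mult_neg [simp]: "x \<in> carrier A \<Longrightarrow> x \<otimes> \<sim> x = \<zero>" "x \<in> carrier A \<Longrightarrow> \<sim> x \<otimes> x = \<zero>"
  by (metis le_neg_iff le_refl m_comm neg_closed, metis le_neg_iff le_refl neg_closed)

lemma neg_antimono: "\<lbrakk>x \<preceq> y; x \<in> carrier A; y \<in> carrier A\<rbrakk> \<Longrightarrow> \<sim> y \<preceq> \<sim> x"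
  by (simp add: rneg_def imp_antimono)

lemma le_neg_neg: "x \<in> carrier A \<Longrightarrow> x \<preceq> \<sim> (\<sim> x)"
  by (simp add: le_neg_iff)

lemma neg_neg_neg [simp]: "x \<in> carrier A \<Longrightarrow> \<sim> (\<sim> (\<sim> x)) = \<sim> x"
  by (meson le_antisym le_neg_neg neg_antimono neg_closed)

lemma neg_one [simp]: "\<sim> \<one> = \<zero>"
  by (metis mult_neg(2) neg_closed one_closed r_one)

lemma neg_bot [simp]: "\<sim> \<zero> = \<one>"
  by (simp add: rneg_def)

lemma neg_mult: "\<lbrakk>x \<in> carrier A; y \<in> carrier A\<rbrakk> \<Longrightarrow> \<sim> (x \<otimes> y) = x \<leadsto> \<sim> y"
  by (simp add: rneg_def imp_mult)

lemma neg_join: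
  assumes [simp]: "x \<in> carrier A" "y \<in> carrier A"
  shows "\<sim> (x \<curlyvee> y) = \<sim> x \<curlywedge> \<sim> y"
proof (rule le_antisym)
  have "(\<sim> x \<curlywedge> \<sim> y) \<otimes> x \<preceq> \<zero>" "(\<sim> x \<curlywedge> \<sim> y) \<otimes> y \<preceq> \<zero>"
    by (simp_all add: residuation flip: rneg_def)
  then show "\<sim> x \<curlywedge> \<sim> y \<preceq> \<sim> (x \<curlyvee> y)"
    by (simp add: le_neg_iff mult_join_distrib le_bot_iff)
qed (simp_all add: meet_greatest neg_antimono)

lemma dense_elemsI: "\<lbrakk>d \<in> carrier A; \<sim> d = \<zero>\<rbrakk> \<Longrightarrow> d \<in> dense_elems A"
  by (simp add: dense_elems_def)

lemma dense_elemsD [simp]: "d \<in> dense_elems A \<Longrightarrow> d \<in> carrier A" "d \<in> dense_elems A \<Longrightarrow> \<sim> d = \<zero>"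
  by (simp_all add: dense_elems_def)

lemma dense_up: "\<lbrakk>d \<preceq> x; d \<in> dense_elems A; x \<in> carrier A\<rbrakk> \<Longrightarrow> x \<in> dense_elems A"
  by (metis dense_elemsI dense_elemsD le_bot_iff neg_antimono neg_closed)

text \<open>For products, \<open>\<sim> (d \<otimes> e) = d \<leadsto> \<sim> e = \<sim> d\<close>.
  Meets lie above products, and joins and implications lie above a dense argument, so
  \<open>dense_up\<close> covers them.\<close>

lemma dense_closed [simp]:
  "\<one> \<in> dense_elems A"
  "\<lbrakk>d \<in> dense_elems A; e \<in> dense_elems A\<rbrakk> \<Longrightarrow> d \<otimes> e \<in> dense_elems A"
  "\<lbrakk>d \<in> dense_elems A; e \<in> dense_elems A\<rbrakk> \<Longrightarrow> d \<curlywedge> e \<in> dense_elems A"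
  "\<lbrakk>d \<in> dense_elems A; x \<in> carrier A\<rbrakk> \<Longrightarrow> d \<curlyvee> x \<in> dense_elems A"
  "\<lbrakk>d \<in> dense_elems A; x \<in> carrier A\<rbrakk> \<Longrightarrow> x \<curlyvee> d \<in> dense_elems A"
  "\<lbrakk>d \<in> dense_elems A; x \<in> carrier A\<rbrakk> \<Longrightarrow> x \<leadsto> d \<in> dense_elems A"
proof -
  show mult: "d \<otimes> e \<in> dense_elems A" if "d \<in> dense_elems A" "e \<in> dense_elems A" for d e
    using that by (intro dense_elemsI) (simp_all add: neg_mult flip: rneg_def)
  show "d \<curlywedge> e \<in> dense_elems A" if "d \<in> dense_elems A" "e \<in> dense_elems A" for d e
    using dense_up[OF mult_le_meet mult] that by simp
qed ((rule dense_elemsI; simp), (rule dense_up[of d]; simp add: le_imp)+)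

lemma residuated_lattice_D_alg: "residuated_lattice (D_alg A)"
proof -
  have [simp]: "rle (D_alg A) = rle A"
    by (simp add: fun_eq_iff rle_def D_alg_def)
  show ?thesis
    by unfold_locales
      (auto simp: D_alg_def m_assoc join_assoc meet_assoc join_meet_absorb meet_join_absorb
        residuation[unfolded rle_def] le_top[unfolded rle_def] rle_def
        intro: m_comm join_comm meet_comm)
qed

end

section \<open>Boolean elements and case distinction along them\<close>

context bounded_residuated_lattice
begin

lemma boolean_elemsI:
  "\<lbrakk>c \<in> carrier A; c \<curlyvee> \<sim> c = \<one>; c \<curlywedge> \<sim> c = \<zero>\<rbrakk> \<Longrightarrow> c \<in> boolean_elems A"
  by (simp add: boolean_elems_def)

lemma boolean_elemsD:
  assumes "c \<in> boolean_elems A"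
  shows boolean_carrier [simp]: "c \<in> carrier A" and "c \<curlyvee> \<sim> c = \<one>" and "c \<curlywedge> \<sim> c = \<zero>"
  using assms by (simp_all add: boolean_elems_def)

text \<open>Multiplication distributes over \<open>c \<curlyvee> \<sim> c = \<one>\<close>, so an
  inequality may be checked on \<open>c\<close> and on \<open>\<sim> c\<close> separately. Most
  later inequalities about Boolean elements are proved this way.\<close>

lemma boolean_le_cases:
  assumes c: "c \<in> boolean_elems A" and [simp]: "x \<in> carrier A" "z \<in> carrier A"
    and "c \<otimes> x \<preceq> z" "\<sim> c \<otimes> x \<preceq> z"
  shows "x \<preceq> z"
proof -
  have [simp]: "c \<in> carrier A" using c by simp
  have "x = (c \<curlyvee> \<sim> c) \<otimes> x" using c by (simp add: boolean_elemsD)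
  also have "\<dots> = (c \<otimes> x) \<curlyvee> (\<sim> c \<otimes> x)" by (simp add: join_mult_distrib)
  also have "\<dots> \<preceq> z" using assms by (simp add: join_least)
  finally show ?thesis .
qed

text \<open>On \<open>c\<close> the nontrivial inequality is monotonicity, and on
  \<open>\<sim> c\<close> its left side vanishes.\<close>

lemma boolean_meet_eq_mult:
  assumes c: "c \<in> boolean_elems A" and [simp]: "x \<in> carrier A"
  shows "c \<curlywedge> x = c \<otimes> x"
proof (rule le_antisym)
  have [simp]: "c \<in> carrier A" using c by simp
  show "c \<curlywedge> x \<preceq> c \<otimes> x"
  proof (rule boolean_le_cases[OF c])
    have "\<sim> c \<otimes> (c \<curlywedge> x) \<preceq> \<sim> c \<otimes> c" by (intro mult_mono2) simp_all
    then show "\<sim> c \<otimes> (c \<curlywedge> x) \<preceq> c \<otimes> x" by (simp add: le_bot_iff bot_le)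
  qed (simp_all add: mult_mono2)
qed (use c in \<open>simp_all add: mult_le_meet\<close>)

lemma boolean_idem: "c \<in> boolean_elems A \<Longrightarrow> c \<otimes> c = c"
  using boolean_meet_eq_mult[of c c] by (simp add: meet_idem)

lemma boolean_neg_neg: "c \<in> boolean_elems A \<Longrightarrow> \<sim> (\<sim> c) = c"
  by (rule le_antisym, rule boolean_le_cases[of c]) (simp_all add: le_neg_neg bot_le)

end

section \<open>Boolean elements of Stonean residuated lattices and the decomposition of an
  element\<close>

context stonean_residuated_lattice
begin

text \<open>For \<open>c = \<sim> (\<sim> c)\<close> the Stonean identity reads
  \<open>\<sim> c \<curlyvee> c = \<one>\<close>, and negating this join yields
  \<open>c \<curlywedge> \<sim> c = \<zero>\<close>. Hence the negations are Boolean.\<close>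

lemma booleanI:
  assumes [simp]: "c \<in> carrier A" and c: "\<sim> (\<sim> c) = c"
  shows "c \<in> boolean_elems A"
proof -
  have 1: "c \<curlyvee> \<sim> c = \<one>"
    using stonean[of c] c join_comm[of c "\<sim> c"] by simp
  have "c \<curlywedge> \<sim> c = \<zero>"
    using neg_join[of "\<sim> c" "c"] c 1 join_comm[of c "\<sim> c"] by simp
  with 1 show ?thesis by (intro boolean_elemsI) simp_all
qed

lemma boolean_neg [simp]: "x \<in> carrier A \<Longrightarrow> \<sim> x \<in> boolean_elems A"
  by (intro booleanI) simp_all

lemma boolean_bounds [simp]: "\<zero> \<in> boolean_elems A" "\<one> \<in> boolean_elems A"
  by (rule booleanI; simp)+

text \<open>It suffices that the double negation \<open>?u\<close> of the join lies below the join.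
  On \<open>c\<close> this is clear; on \<open>\<sim> c\<close> the element \<open>?u\<close> is
  disjoint from \<open>\<sim> d\<close>, hence below \<open>\<sim> (\<sim> d) = d\<close>.\<close>

lemma boolean_join [simp]:
  assumes c: "c \<in> boolean_elems A" and d: "d \<in> boolean_elems A"
  shows "c \<curlyvee> d \<in> boolean_elems A"
proof -
  have [simp]: "c \<in> carrier A" "d \<in> carrier A" using c d by simp_all
  have nn: "\<sim> (\<sim> c) = c" "\<sim> (\<sim> d) = d" using c d by (simp_all add: boolean_neg_neg)
  let ?u = "\<sim> (\<sim> (c \<curlyvee> d))"
  have u: "?u = \<sim> (\<sim> c \<otimes> \<sim> d)" by (simp add: neg_join boolean_meet_eq_mult)
  have "?u \<preceq> c \<curlyvee> d"
  proof (rule boolean_le_cases[OF c])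
    show "c \<otimes> ?u \<preceq> c \<curlyvee> d" by (intro mult_leI1 le_joinI1) simp_all
    have "(\<sim> c \<otimes> ?u) \<otimes> \<sim> d = (\<sim> c \<otimes> \<sim> d) \<otimes> ?u"
      by (simp add: m_ac)
    also have "\<dots> = \<zero>" unfolding u by simp
    finally have "\<sim> c \<otimes> ?u \<preceq> \<sim> (\<sim> d)" by (simp add: le_neg_iff)
    then show "\<sim> c \<otimes> ?u \<preceq> c \<curlyvee> d" by (intro le_joinI2) (simp_all add: nn)
  qed simp_all
  then have "?u = c \<curlyvee> d" by (intro le_antisym) (simp_all add: le_neg_neg)
  then show ?thesis by (intro booleanI) simp_all
qed

lemma boolean_meet [simp]:
  assumes c: "c \<in> boolean_elems A" and d: "d \<in> boolean_elems A"
  shows "c \<curlywedge> d \<in> boolean_elems A"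
proof -
  have "c \<curlywedge> d = \<sim> (\<sim> c \<curlyvee> \<sim> d)" using c d by (simp add: neg_join boolean_neg_neg)
  then show ?thesis using c d by simp
qed

lemma boolean_mult [simp]:
  "\<lbrakk>c \<in> boolean_elems A; d \<in> boolean_elems A\<rbrakk> \<Longrightarrow> c \<otimes> d \<in> boolean_elems A"
  using boolean_meet[of c d] by (simp add: boolean_meet_eq_mult)

lemma neg_meet_boolean:
  "\<lbrakk>c \<in> boolean_elems A; d \<in> boolean_elems A\<rbrakk> \<Longrightarrow> \<sim> (c \<curlywedge> d) = \<sim> c \<curlyvee> \<sim> d"
  using neg_join[of "\<sim> c" "\<sim> d"] boolean_neg_neg[of "\<sim> c \<curlyvee> \<sim> d"]
  by (simp add: boolean_neg_neg)

text \<open>Meets of Boolean elements are products, so distributivity is inherited from the product,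
  although the lattice itself need not be distributive.\<close>

lemma boolean_alg_B_alg: "boolean_alg (B_alg A)"
proof unfold_locales
  fix x y z assume "x \<in> carrier (B_alg A)" "y \<in> carrier (B_alg A)" "z \<in> carrier (B_alg A)"
  then show "bmeet (B_alg A) x (bjoin (B_alg A) y z) =
      bjoin (B_alg A) (bmeet (B_alg A) x y) (bmeet (B_alg A) x z)"
    by (simp add: B_alg_def boolean_meet_eq_mult mult_join_distrib)
qed (auto simp: B_alg_def boolean_elemsD join_assoc meet_assoc join_meet_absorb meet_join_absorb
       intro: join_comm meet_comm)

lemma dense_join_neg [simp]: "x \<in> carrier A \<Longrightarrow> x \<curlyvee> \<sim> x \<in> dense_elems A"
  by (rule dense_elemsI) (simp_all add: neg_join boolean_elemsD)

lemma decompose: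
  assumes [simp]: "x \<in> carrier A"
  shows "\<sim> (\<sim> x) \<otimes> (x \<curlyvee> \<sim> x) = x"
proof -
  have "\<sim> (\<sim> x) \<otimes> (x \<curlyvee> \<sim> x) = \<sim> (\<sim> x) \<otimes> x"
    by (simp add: mult_join_distrib)
  also have "\<dots> = \<sim> (\<sim> x) \<curlywedge> x" by (simp add: boolean_meet_eq_mult)
  also have "\<dots> = x" using le_neg_neg[of x] by (simp add: rle_def meet_comm)
  finally show ?thesis .
qed

lemma meet_boolean:
  assumes c: "c \<in> boolean_elems A" and b: "b \<in> boolean_elems A"
    and [simp]: "d \<in> carrier A" "e \<in> carrier A"
  shows "(c \<otimes> d) \<curlywedge> (b \<otimes> e) = (c \<otimes> b) \<otimes> (d \<curlywedge> e)"
proof -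
  note [simp] = boolean_carrier[OF c] boolean_carrier[OF b]
  have "(c \<curlywedge> d) \<curlywedge> (b \<curlywedge> e) = (c \<curlywedge> b) \<curlywedge> (d \<curlywedge> e)"
    by (simp add: meet_assoc meet_left_comm)
  then show ?thesis using c b by (simp add: boolean_meet_eq_mult)
qed

text \<open>In the next two identities \<open>c\<close> and \<open>b\<close> split the algebra into four regions, on each of
  which \<open>c\<close> and \<open>b\<close> are constant; on each region the identity is clear.\<close>

lemma join_boolean_dense:
  assumes c: "c \<in> boolean_elems A" and b: "b \<in> boolean_elems A"
    and [simp]: "d \<in> carrier A" "e \<in> carrier A"
  shows "(c \<otimes> d) \<curlyvee> (b \<otimes> e) = (c \<curlyvee> b) \<otimes> ((b \<curlyvee> d) \<curlywedge> (c \<curlyvee> e) \<curlywedge> (d \<curlyvee> e))" (is "?l = ?r")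
proof (rule le_antisym)
  note [simp] = boolean_carrier[OF c] boolean_carrier[OF b]
  have r: "?r = (c \<curlyvee> b) \<curlywedge> ((b \<curlyvee> d) \<curlywedge> (c \<curlyvee> e) \<curlywedge> (d \<curlyvee> e))"
    using c b by (simp add: boolean_meet_eq_mult)
  show "?l \<preceq> ?r" unfolding r
    by (intro join_least meet_greatest)
      (simp_all add: mult_leI1 mult_leI2 le_joinI1 le_joinI2)
  have r1: "?r \<preceq> c \<curlyvee> b" and r2: "?r \<preceq> b \<curlyvee> d" and r3: "?r \<preceq> c \<curlyvee> e" and r4: "?r \<preceq> d \<curlyvee> e"
    unfolding r by (simp_all add: meet_leI1 meet_leI2)
  have rc [simp]: "?r \<in> carrier A" by simp
  \<comment> \<open>An upper bound \<open>g \<curlyvee> z\<close> shrinks to \<open>z\<close>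
    outside \<open>g\<close>. Each factor of \<open>?r\<close> thus gives the bound wanted on the
    region where its Boolean part vanishes.\<close>
  have neg: "\<sim> g \<otimes> w \<preceq> z" if "g \<in> carrier A" "w \<in> carrier A" "z \<in> carrier A" "w \<preceq> g \<curlyvee> z" for g w z
  proof -
    have "\<sim> g \<otimes> w \<preceq> \<sim> g \<otimes> (g \<curlyvee> z)" using that by (simp add: mult_mono2)
    also have "\<dots> = \<sim> g \<otimes> z" using that by (simp add: mult_join_distrib)
    finally show ?thesis
      by (rule le_trans) (use that in simp_all)
  qed
  show "?r \<preceq> ?l"
  proof (rule boolean_le_cases[OF c])
    have "\<sim> c \<otimes> ?r \<preceq> b \<curlywedge> e"
      using r1 r3 by (intro meet_greatest neg) simp_all
    then show "\<sim> c \<otimes> ?r \<preceq> ?l"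
      using b by (intro le_joinI2) (simp_all add: boolean_meet_eq_mult)
    show "c \<otimes> ?r \<preceq> ?l"
    proof (rule boolean_le_cases[OF b])
      have "\<sim> b \<otimes> (c \<otimes> ?r) \<preceq> c \<curlywedge> d"
        by (intro meet_greatest neg mult_leI2[OF mult_le1] mult_leI2[OF r2]) simp_all
      then show "\<sim> b \<otimes> (c \<otimes> ?r) \<preceq> ?l"
        using c by (intro le_joinI1) (simp_all add: boolean_meet_eq_mult)
      have "b \<otimes> (c \<otimes> ?r) \<preceq> b \<otimes> (c \<otimes> (d \<curlyvee> e))"
        using r4 by (intro mult_mono2) simp_all
      also have "\<dots> = (b \<otimes> (c \<otimes> d)) \<curlyvee> (c \<otimes> (b \<otimes> e))"
        by (simp add: mult_join_distrib m_lcomm)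
      finally show "b \<otimes> (c \<otimes> ?r) \<preceq> ?l"
        by (rule le_trans) (intro join_least, simp_all add: le_joinI1 le_joinI2)
    qed simp_all
  qed simp_all
qed (use c b in simp_all)

lemma imp_boolean_dense:
  assumes c: "c \<in> boolean_elems A" and b: "b \<in> boolean_elems A"
    and d: "d \<in> dense_elems A" and [simp]: "e \<in> carrier A"
  shows "(c \<otimes> d) \<leadsto> (b \<otimes> e) = (\<sim> c \<curlyvee> b) \<otimes> (\<sim> (c \<otimes> b) \<curlyvee> (d \<leadsto> e))" (is "?l = ?r")
proof (rule le_antisym)
  note [simp] = boolean_carrier[OF c] boolean_carrier[OF b] dense_elemsD[OF d]
  have cb: "c \<otimes> b \<in> boolean_elems A" using c b by simp
  have lc [simp]: "?l \<in> carrier A" by simp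
  have l: "?l \<otimes> (c \<otimes> d) \<preceq> b \<otimes> e" by (simp add: residuation)
  have "?l \<preceq> \<sim> c \<curlyvee> b"
  proof (rule boolean_le_cases[OF c])
    \<comment> \<open>On \<open>c\<close> outside \<open>b\<close> the target vanishes, so
      \<open>?l\<close> lies there below \<open>d \<leadsto> \<zero>\<close>, which is
      \<open>\<zero>\<close> because \<open>d\<close> is dense.\<close>
    have "(c \<otimes> ?l \<otimes> \<sim> b) \<otimes> d = \<sim> b \<otimes> (?l \<otimes> (c \<otimes> d))" by (simp add: m_ac)
    also have "\<dots> \<preceq> \<sim> b \<otimes> (b \<otimes> e)" by (intro mult_mono2 l) simp_all
    also have "\<dots> = \<zero>" by (simp flip: m_assoc)
    finally have "c \<otimes> ?l \<otimes> \<sim> b \<preceq> d \<leadsto> \<zero>" by (simp add: residuation)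
    then have "c \<otimes> ?l \<otimes> \<sim> b = \<zero>" by (simp add: le_bot_iff flip: rneg_def)
    then have "c \<otimes> ?l \<preceq> \<sim> (\<sim> b)" by (simp add: le_neg_iff le_bot_iff)
    then show "c \<otimes> ?l \<preceq> \<sim> c \<curlyvee> b" using b by (intro le_joinI2) (simp_all add: boolean_neg_neg)
  qed (simp_all add: mult_leI1 le_joinI1)
  moreover have "?l \<preceq> \<sim> (c \<otimes> b) \<curlyvee> (d \<leadsto> e)"
  proof (rule boolean_le_cases[OF cb])
    have "(c \<otimes> b \<otimes> ?l) \<otimes> d = b \<otimes> (?l \<otimes> (c \<otimes> d))" by (simp add: m_ac)
    also have "\<dots> \<preceq> e" by (intro mult_leI2 le_trans[OF l]) simp_all
    finally have "(c \<otimes> b \<otimes> ?l) \<otimes> d \<preceq> e" by simp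
    then have "c \<otimes> b \<otimes> ?l \<preceq> d \<leadsto> e" by (simp add: residuation)
    then show "c \<otimes> b \<otimes> ?l \<preceq> \<sim> (c \<otimes> b) \<curlyvee> (d \<leadsto> e)" by (intro le_joinI2) simp_all
  qed (simp_all add: mult_leI1 le_joinI1)
  ultimately have "?l \<preceq> (\<sim> c \<curlyvee> b) \<curlywedge> (\<sim> (c \<otimes> b) \<curlyvee> (d \<leadsto> e))"
    by (intro meet_greatest) simp_all
  then show "?l \<preceq> ?r" using b by (simp add: boolean_meet_eq_mult)
  \<comment> \<open>Multiplying by \<open>c\<close> removes \<open>\<sim> c\<close> from the first
    factor; the remaining \<open>c \<otimes> b\<close> removes \<open>\<sim> (c \<otimes> b)\<close>
    from the second.\<close>
  have "c \<otimes> ?r = (c \<otimes> b) \<otimes> (\<sim> (c \<otimes> b) \<curlyvee> (d \<leadsto> e))"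
    by (simp add: mult_join_distrib flip: m_assoc)
  also have "\<dots> = c \<otimes> b \<otimes> (d \<leadsto> e)" by (simp add: mult_join_distrib)
  finally have cr: "c \<otimes> ?r = c \<otimes> b \<otimes> (d \<leadsto> e)" .
  have "?r \<otimes> (c \<otimes> d) = (c \<otimes> ?r) \<otimes> d" by (simp add: m_ac)
  also have "\<dots> = c \<otimes> (b \<otimes> (d \<otimes> (d \<leadsto> e)))" unfolding cr by (simp add: m_ac)
  also have "\<dots> \<preceq> b \<otimes> e" by (intro mult_leI2 mult_mono2 mult_imp_le) simp_all
  finally show "?r \<preceq> ?l" by (simp add: residuation)
qed (use c b d in simp_all)

end

section \<open>Membership in a subvariety\<close>

text \<open>A homomorphism from a subalgebra \<open>U\<close>. The closure conditions are part of
  the notion because \<open>A\<close> is not yet known to satisfy any law; its laws are to be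
  derived from such maps.\<close>

definition brl_subhom ::
  "('a, 'm) brlat_scheme \<Rightarrow> 'a set \<Rightarrow> ('b, 'n) brlat_scheme \<Rightarrow> ('a \<Rightarrow> 'b) \<Rightarrow> bool" where
  "brl_subhom A U B p \<longleftrightarrow> \<one>\<^bsub>A\<^esub> \<in> U \<and> \<zero>\<^bsub>A\<^esub> \<in> U \<and> p \<in> U \<rightarrow> carrier B \<and>
     p \<one>\<^bsub>A\<^esub> = \<one>\<^bsub>B\<^esub> \<and> p \<zero>\<^bsub>A\<^esub> = \<zero>\<^bsub>B\<^esub> \<and>
     (\<forall>x\<in>U. \<forall>y\<in>U.
        x \<otimes>\<^bsub>A\<^esub> y \<in> U \<and> x \<leadsto>\<^bsub>A\<^esub> y \<in> U \<and> x \<curlyvee>\<^bsub>A\<^esub> y \<in> U \<and> x \<curlywedge>\<^bsub>A\<^esub> y \<in> U \<and>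
        p (x \<otimes>\<^bsub>A\<^esub> y) = p x \<otimes>\<^bsub>B\<^esub> p y \<and> p (x \<leadsto>\<^bsub>A\<^esub> y) = p x \<leadsto>\<^bsub>B\<^esub> p y \<and>
        p (x \<curlyvee>\<^bsub>A\<^esub> y) = p x \<curlyvee>\<^bsub>B\<^esub> p y \<and> p (x \<curlywedge>\<^bsub>A\<^esub> y) = p x \<curlywedge>\<^bsub>B\<^esub> p y)"

fun rterm_vars :: "rterm \<Rightarrow> nat set" where
  "rterm_vars (Var n) = {n}"
| "rterm_vars Top = {}"
| "rterm_vars Bot = {}"
| "rterm_vars (Mult s t) = rterm_vars s \<union> rterm_vars t"
| "rterm_vars (Imp s t) = rterm_vars s \<union> rterm_vars t"
| "rterm_vars (Join s t) = rterm_vars s \<union> rterm_vars t"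
| "rterm_vars (Meet s t) = rterm_vars s \<union> rterm_vars t"

lemma finite_rterm_vars [simp]: "finite (rterm_vars t)"
  by (induction t) auto

lemma subhom_rterm_val:
  assumes "brl_subhom A U B p" "\<forall>n\<in>rterm_vars t. v n \<in> U \<and> w n = p (v n)"
  shows "rterm_val A v t \<in> U \<and> p (rterm_val A v t) = rterm_val B w t"
  using assms(2)
  by (induction t) (insert assms(1), auto simp: brl_subhom_def)

text \<open>Closure without laws: all that has to be known about an algebra before its axioms are
  obtained by separation.\<close>

locale brl_closed =
  fixes A :: "('a, 'm) brlat_scheme"
  assumes ops_closed [simp]: "\<one>\<^bsub>A\<^esub> \<in> carrier A" "\<zero>\<^bsub>A\<^esub> \<in> carrier A"
    "\<lbrakk>x \<in> carrier A; y \<in> carrier A\<rbrakk> \<Longrightarrow> x \<otimes>\<^bsub>A\<^esub> y \<in> carrier A"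
    "\<lbrakk>x \<in> carrier A; y \<in> carrier A\<rbrakk> \<Longrightarrow> x \<leadsto>\<^bsub>A\<^esub> y \<in> carrier A"
    "\<lbrakk>x \<in> carrier A; y \<in> carrier A\<rbrakk> \<Longrightarrow> x \<curlyvee>\<^bsub>A\<^esub> y \<in> carrier A"
    "\<lbrakk>x \<in> carrier A; y \<in> carrier A\<rbrakk> \<Longrightarrow> x \<curlywedge>\<^bsub>A\<^esub> y \<in> carrier A"
begin

lemma rterm_val_closed [simp]: "\<forall>n. v n \<in> carrier A \<Longrightarrow> rterm_val A v t \<in> carrier A"
  by (induction t) auto

end

text \<open>Identities involve finitely many elements at a time, so it suffices that any two distinct
  elements can be separated by a homomorphism that is only defined on a subalgebra, as long as the
  subalgebra can be chosen to contain any given finite set.\<close>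

locale brl_separated = brl_closed A + B: stonean_residuated_lattice B
  for A :: "('a, 'm) brlat_scheme" and B :: "('b, 'n) brlat_scheme" +
  assumes separated: "\<lbrakk>finite X; X \<subseteq> carrier A; x \<in> carrier A; y \<in> carrier A; x \<noteq> y\<rbrakk>
    \<Longrightarrow> \<exists>U p. X \<subseteq> U \<and> brl_subhom A U B p \<and> p x \<noteq> p y"
begin

lemma eqI:
  assumes "finite X" "X \<subseteq> carrier A" "x \<in> carrier A" "y \<in> carrier A"
    and eq: "\<And>U p. \<lbrakk>X \<subseteq> U; brl_subhom A U B p\<rbrakk> \<Longrightarrow> p x = p y"
  shows "x = y"
proof (rule ccontr)
  assume "x \<noteq> y"
  then obtain U p where "X \<subseteq> U" "brl_subhom A U B p" "p x \<noteq> p y"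
    using separated[OF assms(1-4)] by auto
  with eq[of U p] show False by simp
qed

lemma satisfies_separated:
  assumes E: "satisfies B E"
  shows "satisfies A E"
  unfolding satisfies_def
proof (intro ballI, clarify)
  fix s t and v :: "nat \<Rightarrow> 'a" assume st: "(s, t) \<in> E" and v: "\<forall>n. v n \<in> carrier A"
  let ?V = "rterm_vars s \<union> rterm_vars t"
  show "rterm_val A v s = rterm_val A v t"
  proof (rule eqI[of "v ` ?V"])
    fix U p assume U: "v ` ?V \<subseteq> U" and p: "brl_subhom A U B p"
    \<comment> \<open>Outside \<open>?V\<close> the value \<open>v n\<close> may lie outside
      \<open>U\<close>, where \<open>p\<close> is not controlled, so \<open>\<one>\<close> serves as
      a default in \<open>carrier B\<close>.\<close>
    define w where "w n = (if n \<in> ?V then p (v n) else \<one>\<^bsub>B\<^esub>)" for n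
    have "\<forall>n. w n \<in> carrier B"
      using U p B.one_closed by (auto simp: w_def brl_subhom_def)
    then have "rterm_val B w s = rterm_val B w t"
      using E st unfolding satisfies_def by blast
    moreover have "p (rterm_val A v s) = rterm_val B w s" "p (rterm_val A v t) = rterm_val B w t"
      using U by (auto intro!: subhom_rterm_val[OF p, THEN conjunct2] simp: w_def)
    ultimately show "p (rterm_val A v s) = p (rterm_val A v t)" by simp
  qed (use v in auto)
qed

text \<open>All axioms except residuation are equations and transfer by \<open>eqI\<close>.
  Residuation transfers because the order is expressed by meets: every partial homomorphism
  preserves it, and all of them together reflect it (\<open>leI\<close>).\<close>

lemma stonean_separated: "stonean_residuated_lattice A"
proof -
  have mem: "p x \<in> carrier B" if "brl_subhom A U B p" "x \<in> U" for x U p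
    using that by (auto simp: brl_subhom_def)
  have hom:
      "x \<otimes>\<^bsub>A\<^esub> y \<in> U \<and> x \<leadsto>\<^bsub>A\<^esub> y \<in> U \<and> x \<curlyvee>\<^bsub>A\<^esub> y \<in> U \<and> x \<curlywedge>\<^bsub>A\<^esub> y \<in> U"
      "p (x \<otimes>\<^bsub>A\<^esub> y) = p x \<otimes>\<^bsub>B\<^esub> p y" "p (x \<leadsto>\<^bsub>A\<^esub> y) = p x \<leadsto>\<^bsub>B\<^esub> p y"
      "p (x \<curlyvee>\<^bsub>A\<^esub> y) = p x \<curlyvee>\<^bsub>B\<^esub> p y" "p (x \<curlywedge>\<^bsub>A\<^esub> y) = p x \<curlywedge>\<^bsub>B\<^esub> p y"
    if "brl_subhom A U B p" "x \<in> U" "y \<in> U" for x y U p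
    using that by (auto simp: brl_subhom_def)
  have const: "p \<one>\<^bsub>A\<^esub> = \<one>\<^bsub>B\<^esub>" "p \<zero>\<^bsub>A\<^esub> = \<zero>\<^bsub>B\<^esub>" "\<one>\<^bsub>A\<^esub> \<in> U" "\<zero>\<^bsub>A\<^esub> \<in> U"
    if "brl_subhom A U B p" for U p
    using that by (auto simp: brl_subhom_def)
  have le_iff: "p x \<preceq>\<^bsub>B\<^esub> p y" if "x \<preceq>\<^bsub>A\<^esub> y" "x \<in> U" "y \<in> U" "brl_subhom A U B p" for x y U p
    using that hom(5)[of U p x y] by (simp add: rle_def)
  have leI: "x \<preceq>\<^bsub>A\<^esub> y"
    if "finite X" "X \<subseteq> carrier A" "x \<in> carrier A" "y \<in> carrier A"
      "\<And>U p. \<lbrakk>X \<subseteq> U; brl_subhom A U B p\<rbrakk> \<Longrightarrow> x \<in> U \<and> y \<in> U \<and> p x \<preceq>\<^bsub>B\<^esub> p y" for X x y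
    unfolding rle_def
  proof (rule eqI[of X])
    fix U p assume U: "X \<subseteq> U" "brl_subhom A U B p"
    then show "p (x \<curlywedge>\<^bsub>A\<^esub> y) = p x"
      using that(5)[OF U] hom(5)[of U p x y] by (simp add: rle_def)
  qed (use that in auto)
  show ?thesis
  proof unfold_locales
    fix x y z assume xyz: "x \<in> carrier A" "y \<in> carrier A" "z \<in> carrier A"
    show "x \<otimes>\<^bsub>A\<^esub> y \<otimes>\<^bsub>A\<^esub> z = x \<otimes>\<^bsub>A\<^esub> (y \<otimes>\<^bsub>A\<^esub> z)"
      by (rule eqI[of "{x, y, z}"]) (use xyz in \<open>auto simp: hom mem B.m_assoc\<close>)
    show "x \<curlyvee>\<^bsub>A\<^esub> y \<curlyvee>\<^bsub>A\<^esub> z = x \<curlyvee>\<^bsub>A\<^esub> (y \<curlyvee>\<^bsub>A\<^esub> z)"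
      by (rule eqI[of "{x, y, z}"]) (use xyz in \<open>auto simp: hom mem B.join_assoc\<close>)
    show "x \<curlywedge>\<^bsub>A\<^esub> y \<curlywedge>\<^bsub>A\<^esub> z = x \<curlywedge>\<^bsub>A\<^esub> (y \<curlywedge>\<^bsub>A\<^esub> z)"
      by (rule eqI[of "{x, y, z}"]) (use xyz in \<open>auto simp: hom mem B.meet_assoc\<close>)
    show "(x \<otimes>\<^bsub>A\<^esub> y \<preceq>\<^bsub>A\<^esub> z) = (x \<preceq>\<^bsub>A\<^esub> y \<leadsto>\<^bsub>A\<^esub> z)"
    proof
      assume le: "x \<otimes>\<^bsub>A\<^esub> y \<preceq>\<^bsub>A\<^esub> z"
      show "x \<preceq>\<^bsub>A\<^esub> y \<leadsto>\<^bsub>A\<^esub> z"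
      proof (rule leI[of "{x, y, z}"])
        fix U p assume U: "{x, y, z} \<subseteq> U" and p: "brl_subhom A U B p"
        have "p (x \<otimes>\<^bsub>A\<^esub> y) \<preceq>\<^bsub>B\<^esub> p z" using U p by (intro le_iff[OF le, of U]) (auto simp: hom)
        then show "x \<in> U \<and> y \<leadsto>\<^bsub>A\<^esub> z \<in> U \<and> p x \<preceq>\<^bsub>B\<^esub> p (y \<leadsto>\<^bsub>A\<^esub> z)"
          using U p by (simp add: hom[OF p] mem[OF p] B.residuation)
      qed (use xyz in auto)
    next
      assume le: "x \<preceq>\<^bsub>A\<^esub> y \<leadsto>\<^bsub>A\<^esub> z"
      show "x \<otimes>\<^bsub>A\<^esub> y \<preceq>\<^bsub>A\<^esub> z"
      proof (rule leI[of "{x, y, z}"])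
        fix U p assume U: "{x, y, z} \<subseteq> U" and p: "brl_subhom A U B p"
        have "p x \<preceq>\<^bsub>B\<^esub> p (y \<leadsto>\<^bsub>A\<^esub> z)" using U p by (intro le_iff[OF le, of U]) (auto simp: hom)
        then show "x \<otimes>\<^bsub>A\<^esub> y \<in> U \<and> z \<in> U \<and> p (x \<otimes>\<^bsub>A\<^esub> y) \<preceq>\<^bsub>B\<^esub> p z"
          using U p by (simp add: hom[OF p] mem[OF p] B.residuation)
      qed (use xyz in auto)
    qed
  next
    fix x y assume xy: "x \<in> carrier A" "y \<in> carrier A"
    show "x \<otimes>\<^bsub>A\<^esub> y = y \<otimes>\<^bsub>A\<^esub> x"
      by (rule eqI[of "{x, y}"]) (use xy in \<open>auto simp: hom mem intro: B.m_comm\<close>)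
    show "x \<curlyvee>\<^bsub>A\<^esub> y = y \<curlyvee>\<^bsub>A\<^esub> x"
      by (rule eqI[of "{x, y}"]) (use xy in \<open>auto simp: hom mem intro: B.join_comm\<close>)
    show "x \<curlywedge>\<^bsub>A\<^esub> y = y \<curlywedge>\<^bsub>A\<^esub> x"
      by (rule eqI[of "{x, y}"]) (use xy in \<open>auto simp: hom mem intro: B.meet_comm\<close>)
    show "x \<curlyvee>\<^bsub>A\<^esub> (x \<curlywedge>\<^bsub>A\<^esub> y) = x"
      by (rule eqI[of "{x, y}"]) (use xy in \<open>auto simp: hom mem B.join_meet_absorb\<close>)
    show "x \<curlywedge>\<^bsub>A\<^esub> (x \<curlyvee>\<^bsub>A\<^esub> y) = x"
      by (rule eqI[of "{x, y}"]) (use xy in \<open>auto simp: hom mem B.meet_join_absorb\<close>)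
  next
    fix x assume x: "x \<in> carrier A"
    show "\<one>\<^bsub>A\<^esub> \<otimes>\<^bsub>A\<^esub> x = x" "x \<otimes>\<^bsub>A\<^esub> \<one>\<^bsub>A\<^esub> = x"
      by (rule eqI[of "{x}"]; use x in \<open>auto simp: hom mem const\<close>)+
    show "x \<preceq>\<^bsub>A\<^esub> \<one>\<^bsub>A\<^esub>"
      by (rule leI[of "{x}"]) (use x in \<open>auto simp: hom mem const B.le_top\<close>)
    show "\<zero>\<^bsub>A\<^esub> \<preceq>\<^bsub>A\<^esub> x"
      by (rule leI[of "{x}"]) (use x in \<open>auto simp: hom mem const B.bot_le\<close>)
    show "(\<sim>\<^bsub>A\<^esub> x) \<curlyvee>\<^bsub>A\<^esub> (\<sim>\<^bsub>A\<^esub> (\<sim>\<^bsub>A\<^esub> x)) = \<one>\<^bsub>A\<^esub>"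
      unfolding rneg_def
      by (rule eqI[of "{x}"]) (use x in \<open>auto simp: hom mem const B.stonean[unfolded rneg_def]\<close>)
  qed simp_all
qed

end

lemma subvariety_separated:
  assumes "B \<in> subvariety E" "brl_separated A B"
  shows "A \<in> subvariety E"
  using assms brl_separated.satisfies_separated brl_separated.stonean_separated
  unfolding subvariety_def by blast

section \<open>The algebra S(D), and S(D(A)) as a member of the subvariety\<close>

lemma S_alg_simps [simp]:
  "carrier (S_alg D) = insert None (Some ` carrier D)"
  "\<one>\<^bsub>S_alg D\<^esub> = Some \<one>\<^bsub>D\<^esub>" "\<zero>\<^bsub>S_alg D\<^esub> = None"
  "Some a \<otimes>\<^bsub>S_alg D\<^esub> Some b = Some (a \<otimes>\<^bsub>D\<^esub> b)"
  "None \<otimes>\<^bsub>S_alg D\<^esub> y = None" "x \<otimes>\<^bsub>S_alg D\<^esub> None = None"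
  "Some a \<leadsto>\<^bsub>S_alg D\<^esub> Some b = Some (a \<leadsto>\<^bsub>D\<^esub> b)"
  "None \<leadsto>\<^bsub>S_alg D\<^esub> y = Some \<one>\<^bsub>D\<^esub>" "Some a \<leadsto>\<^bsub>S_alg D\<^esub> None = None"
  "Some a \<curlyvee>\<^bsub>S_alg D\<^esub> Some b = Some (a \<curlyvee>\<^bsub>D\<^esub> b)"
  "None \<curlyvee>\<^bsub>S_alg D\<^esub> y = y" "x \<curlyvee>\<^bsub>S_alg D\<^esub> None = x"
  "Some a \<curlywedge>\<^bsub>S_alg D\<^esub> Some b = Some (a \<curlywedge>\<^bsub>D\<^esub> b)"
  "None \<curlywedge>\<^bsub>S_alg D\<^esub> y = None" "x \<curlywedge>\<^bsub>S_alg D\<^esub> None = None"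
  "\<sim>\<^bsub>S_alg D\<^esub> None = Some \<one>\<^bsub>D\<^esub>" "\<sim>\<^bsub>S_alg D\<^esub> (Some a) = None"
  by (simp_all add: S_alg_def rneg_def split: option.splits)

lemma S_alg_le_simps [simp]:
  "None \<preceq>\<^bsub>S_alg D\<^esub> y" "Some a \<preceq>\<^bsub>S_alg D\<^esub> Some b \<longleftrightarrow> a \<preceq>\<^bsub>D\<^esub> b" "\<not> Some a \<preceq>\<^bsub>S_alg D\<^esub> None"
  by (simp_all add: rle_def)

lemma (in residuated_lattice) stonean_S_alg: "stonean_residuated_lattice (S_alg A)"
  by unfold_locales
    (auto simp: m_assoc join_assoc meet_assoc join_meet_absorb meet_join_absorb residuation
       le_top meet_idem join_ge1 imp_closed
     intro: m_comm join_comm meet_comm)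

text \<open>Closure under isomorphic copies of subalgebras: one injective homomorphism on the whole
  carrier separates all pairs.\<close>

lemma subvariety_embedded:
  assumes B: "B \<in> subvariety E" and A: "brl_closed A"
    and p: "brl_subhom A (carrier A) B p" "inj_on p (carrier A)"
  shows "A \<in> subvariety E"
proof (rule subvariety_separated[OF B], intro brl_separated.intro A)
  show "stonean_residuated_lattice B" using B by (simp add: subvariety_def)
  show "brl_separated_axioms A B"
    using p by unfold_locales (auto simp: inj_on_def)
qed

lemma brl_nontrivial:
  assumes "bounded_residuated_lattice A" "x \<in> carrier A" "x \<noteq> \<one>\<^bsub>A\<^esub>"
  shows "\<zero>\<^bsub>A\<^esub> \<noteq> \<one>\<^bsub>A\<^esub>"
proof -
  interpret bounded_residuated_lattice A by fact
  show ?thesis using assms(2,3) bot_le le_one_iff by metis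
qed

text \<open>If \<open>A\<close> is nontrivial, \<open>\<zero>\<close> is not dense and S(D(A))
  embeds in \<open>A\<close> with the new least element sent to \<open>\<zero>\<close>. If
  \<open>A\<close> is trivial, \<open>\<zero>\<close> is itself dense and this fails; S(D(A)) then
  has two elements and embeds in the nontrivial member \<open>A0\<close>.\<close>

lemma D_alg_in_star:
  assumes A: "A \<in> subvariety E"
    and A0: "A0 \<in> subvariety E" and x0: "x \<in> carrier A0" "x \<noteq> \<one>\<^bsub>A0\<^esub>"
  shows "D_alg A \<in> subvariety_star E"
proof -
  interpret stonean_residuated_lattice A using A by (simp add: subvariety_def)
  interpret A0: stonean_residuated_lattice A0 using A0 by (simp add: subvariety_def)
  interpret D: residuated_lattice "D_alg A" by (rule residuated_lattice_D_alg)
  have closed: "brl_closed (S_alg (D_alg A))"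
    by unfold_locales auto
  have c: "carrier (D_alg A) = dense_elems A" by (simp add: D_alg_def)
  have "S_alg (D_alg A) \<in> subvariety E"
  proof (cases "\<zero>\<^bsub>A\<^esub> = \<one>\<^bsub>A\<^esub>")
    case True
    then have "dense_elems A \<subseteq> {\<one>\<^bsub>A\<^esub>}"
      using bot_le le_one_iff dense_elemsD(1) by (metis singletonI subsetI)
    moreover have "\<zero>\<^bsub>A0\<^esub> \<noteq> \<one>\<^bsub>A0\<^esub>"
      using x0 A0.bounded_residuated_lattice_axioms by (rule brl_nontrivial[rotated])
    ultimately show ?thesis
      by (intro subvariety_embedded[OF A0 closed, of "case_option \<zero>\<^bsub>A0\<^esub> (\<lambda>_. \<one>\<^bsub>A0\<^esub>)"])
        (auto simp: brl_subhom_def inj_on_def c D.closed[unfolded c] D.one_closed[unfolded c]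
          simp flip: rneg_def)
  next
    case False
    then have "\<zero>\<^bsub>A\<^esub> \<notin> dense_elems A"
      using dense_elemsD(2)[of "\<zero>\<^bsub>A\<^esub>"] by auto
    then show ?thesis
      by (intro subvariety_embedded[OF A closed, of "case_option \<zero>\<^bsub>A\<^esub> (\<lambda>d. d)"])
        (auto simp: brl_subhom_def inj_on_def D_alg_def simp flip: rneg_def)
  qed
  then show ?thesis
    using residuated_lattice_D_alg by (simp add: subvariety_star_def)
qed

section \<open>The categories\<close>

context residuated_lattice
begin

lemma i_filterD:
  assumes F: "i_filter A F"
  shows "F \<subseteq> carrier A" "\<one> \<in> F"
    and i_filter_up: "\<lbrakk>x \<in> F; x \<preceq> y; y \<in> carrier A\<rbrakk> \<Longrightarrow> y \<in> F"
    and i_filter_mult: "\<lbrakk>x \<in> F; y \<in> F\<rbrakk> \<Longrightarrow> x \<otimes> y \<in> F"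
proof -
  show sub: "F \<subseteq> carrier A" and one: "\<one> \<in> F" using F by (simp_all add: i_filter_def)
  have mp: "y \<in> F" if "x \<in> F" "x \<leadsto> y \<in> F" "y \<in> carrier A" for x y
    using F that sub unfolding i_filter_def by blast
  show up: "y \<in> F" if "x \<in> F" "x \<preceq> y" "y \<in> carrier A" for x y
    using mp[of x y] that one sub imp_eq_one_iff[of x y] by auto
  show "x \<otimes> y \<in> F" if "x \<in> F" "y \<in> F" for x y
  proof -
    have [simp]: "x \<in> carrier A" "y \<in> carrier A" using that sub by auto
    have "y \<preceq> x \<leadsto> (x \<otimes> y)" by (simp add: m_comm flip: residuation)
    then have "x \<leadsto> (x \<otimes> y) \<in> F" using up[OF that(2)] by simp
    then show ?thesis using mp[OF that(1)] by simp
  qed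
qed

lemma i_filter_meet:
  assumes F: "i_filter A F" and xy: "x \<in> F" "y \<in> F"
  shows "x \<curlywedge> y \<in> F"
proof -
  have "x \<in> carrier A" "y \<in> carrier A" using i_filterD(1)[OF F] xy by auto
  then show ?thesis using i_filter_up[OF F i_filter_mult[OF F xy]] by (simp add: mult_le_meet)
qed

lemma i_filterI:
  assumes "F \<subseteq> carrier A" "\<one> \<in> F" "\<And>x y. \<lbrakk>x \<in> F; x \<preceq> y; y \<in> carrier A\<rbrakk> \<Longrightarrow> y \<in> F"
    "\<And>x y. \<lbrakk>x \<in> F; y \<in> F\<rbrakk> \<Longrightarrow> x \<otimes> y \<in> F"
  shows "i_filter A F"
  unfolding i_filter_def
proof (intro conjI ballI impI)
  fix x y assume "x \<in> carrier A" "y \<in> carrier A" "x \<in> F" "x \<leadsto> y \<in> F"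
  then show "y \<in> F" using assms(3)[of "x \<otimes> (x \<leadsto> y)" y] assms(4) mult_imp_le by simp
qed (use assms in auto)

lemma i_filters_bottom: "\<bottom>\<^bsub>i_filters A\<^esub> = {\<one>}"
  unfolding bottom_def
proof (rule some_equality)
  have "i_filter A {\<one>}" by (rule i_filterI) (auto simp: le_one_iff)
  then show least: "least (i_filters A) {\<one>} (carrier (i_filters A))"
    by (auto simp: least_def i_filters_def i_filterD)
  show "F = {\<one>}" if "least (i_filters A) F (carrier (i_filters A))" for F
    using that least by (auto simp: least_def i_filters_def)
qed

lemma i_filters_top: "\<top>\<^bsub>i_filters A\<^esub> = carrier A"
  unfolding top_def
proof (rule some_equality)
  have "i_filter A (carrier A)" by (rule i_filterI) auto
  then show greatest: "greatest (i_filters A) (carrier A) (carrier (i_filters A))"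
    by (auto simp: greatest_def i_filters_def dest: i_filterD)
  show "F = carrier A" if "greatest (i_filters A) F (carrier (i_filters A))" for F
    using that greatest by (auto simp: greatest_def i_filters_def)
qed

lemma i_filters_meet:
  assumes "i_filter A F" "i_filter A G"
  shows "F \<sqinter>\<^bsub>i_filters A\<^esub> G = F \<inter> G"
  unfolding meet_def inf_def
proof (rule some_equality)
  have "i_filter A (F \<inter> G)"
    by (rule i_filterI) (use assms in \<open>auto dest: i_filterD intro: i_filter_up i_filter_mult\<close>)
  then show greatest: "greatest (i_filters A) (F \<inter> G) (Lower (i_filters A) {F, G})"
    using assms by (auto simp: greatest_def i_filters_def Lower_def)
  show "H = F \<inter> G" if "greatest (i_filters A) H (Lower (i_filters A) {F, G})" for H
    using that greatest unfolding greatest_def i_filters_def by (simp add: subset_antisym)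
qed

text \<open>An i-filter is the same as an upward closed submonoid, so the least one containing
  \<open>F\<close> and \<open>G\<close> consists of the elements above a product from
  \<open>F\<close> and \<open>G\<close>.\<close>

lemma i_filters_join:
  assumes F: "i_filter A F" and G: "i_filter A G"
  shows "F \<squnion>\<^bsub>i_filters A\<^esub> G = {x \<in> carrier A. \<exists>u\<in>F. \<exists>w\<in>G. u \<otimes> w \<preceq> x}" (is "_ = ?H")
  unfolding join_def sup_def
proof (rule some_equality)
  have sub: "u \<in> carrier A" "w \<in> carrier A" if "u \<in> F" "w \<in> G" for u w
    using that F G by (auto dest: i_filterD)
  have "i_filter A ?H"
  proof (rule i_filterI)
    show "\<one> \<in> ?H" using F G by (auto intro!: bexI[of _ \<one>] simp: i_filterD)
    show "y \<in> ?H" if "x \<in> ?H" "x \<preceq> y" "y \<in> carrier A" for x y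
      using that le_trans[of _ x y] m_closed[OF sub] by blast
    show "x \<otimes> y \<in> ?H" if "x \<in> ?H" "y \<in> ?H" for x y
    proof -
      obtain u w where u: "u \<in> F" "w \<in> G" "u \<otimes> w \<preceq> x" using \<open>x \<in> ?H\<close> by blast
      obtain u' w' where u': "u' \<in> F" "w' \<in> G" "u' \<otimes> w' \<preceq> y" using \<open>y \<in> ?H\<close> by blast
      have [simp]: "u \<in> carrier A" "w \<in> carrier A" "u' \<in> carrier A" "w' \<in> carrier A"
        "x \<in> carrier A" "y \<in> carrier A"
        using u u' that by (auto dest: sub)
      have "(u \<otimes> u') \<otimes> (w \<otimes> w') = (u \<otimes> w) \<otimes> (u' \<otimes> w')" by (simp add: m_ac)
      also have "\<dots> \<preceq> x \<otimes> y" using u u' by (simp add: mult_mono)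
      finally show ?thesis
        using i_filter_mult[OF F u(1) u'(1)] i_filter_mult[OF G u(2) u'(2)] by auto
    qed
  qed auto
  moreover have "F \<subseteq> ?H"
    using i_filterD(1)[OF F] i_filterD(2)[OF G] by (intro subsetI CollectI conjI bexI) auto
  moreover have "G \<subseteq> ?H"
    using i_filterD(2)[OF F] i_filterD(1)[OF G] by (intro subsetI CollectI conjI bexI) auto
  moreover have "?H \<subseteq> K" if "i_filter A K" "F \<subseteq> K" "G \<subseteq> K" for K
    using that by (auto intro: i_filter_up[OF that(1) i_filter_mult[OF that(1)]])
  ultimately show least: "least (i_filters A) ?H (Upper (i_filters A) {F, G})"
    using assms by (auto simp: least_def i_filters_def Upper_def)
  show "H = ?H" if "least (i_filters A) H (Upper (i_filters A) {F, G})" for H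
    using that least unfolding least_def i_filters_def by (simp add: subset_antisym)
qed

lemma filter_hom_iff:
  "filter_hom B A \<phi> \<longleftrightarrow> (\<forall>a\<in>carrier B. i_filter A (\<phi> a)) \<and>
     \<phi> (bbot B) = {\<one>} \<and> \<phi> (btop B) = carrier A \<and>
     (\<forall>a\<in>carrier B. \<forall>b\<in>carrier B.
        \<phi> (bjoin B a b) = {x \<in> carrier A. \<exists>u\<in>\<phi> a. \<exists>w\<in>\<phi> b. u \<otimes> w \<preceq> x} \<and>
        \<phi> (bmeet B a b) = \<phi> a \<inter> \<phi> b)"
proof -
  have "\<phi> \<in> carrier B \<rightarrow> carrier (i_filters A) \<longleftrightarrow> (\<forall>a\<in>carrier B. i_filter A (\<phi> a))"
    by (auto simp: i_filters_def)
  then show ?thesis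
    unfolding filter_hom_def i_filters_bottom i_filters_top
    by (simp add: i_filters_join i_filters_meet cong: conj_cong ball_cong)
qed

end

section \<open>The filter map of a Stonean residuated lattice\<close>

context stonean_residuated_lattice
begin

lemma phi_iff: "x \<in> phi A a \<longleftrightarrow> x \<in> dense_elems A \<and> \<sim> a \<preceq> x"
  by (simp add: phi_def)

lemma filter_hom_phi: "filter_hom (B_alg A) (D_alg A) (phi A)"
proof -
  interpret D: residuated_lattice "D_alg A" by (rule residuated_lattice_D_alg)
  have [simp]: "rle (D_alg A) = rle A" by (simp add: fun_eq_iff rle_def D_alg_def)
  have [simp]: "carrier (D_alg A) = dense_elems A" "monoid.mult (D_alg A) = monoid.mult A"
    "\<one>\<^bsub>D_alg A\<^esub> = \<one>"
    by (simp_all add: D_alg_def)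
  have filter: "i_filter (D_alg A) (phi A a)" if a: "a \<in> boolean_elems A" for a
  proof (rule D.i_filterI)
    have [simp]: "a \<in> carrier A" using a by simp
    fix x y
    show "x \<otimes>\<^bsub>D_alg A\<^esub> y \<in> phi A a" if "x \<in> phi A a" "y \<in> phi A a"
      using that mult_mono[of "\<sim> a" x "\<sim> a" y] by (simp add: phi_iff boolean_idem)
    show "y \<in> phi A a" if "x \<in> phi A a" "rle (D_alg A) x y" "y \<in> carrier (D_alg A)"
      using that by (auto simp: phi_iff intro: le_trans[of _ x])
  qed (use a in \<open>auto simp: phi_iff le_top\<close>)
  have join: "phi A (a \<curlyvee> b) = {x \<in> dense_elems A. \<exists>u\<in>phi A a. \<exists>w\<in>phi A b. u \<otimes> w \<preceq> x}" (is "_ = ?H")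
    if a: "a \<in> boolean_elems A" and b: "b \<in> boolean_elems A" for a b
  proof (intro Set.set_eqI iffI)
    note [simp] = boolean_carrier[OF a] boolean_carrier[OF b]
    have neg: "\<sim> (a \<curlyvee> b) = \<sim> a \<otimes> \<sim> b" by (simp add: neg_join boolean_meet_eq_mult)
    fix x
    { assume x: "x \<in> phi A (a \<curlyvee> b)"
      then have [simp]: "x \<in> dense_elems A" and le: "\<sim> a \<otimes> \<sim> b \<preceq> x" by (simp_all add: phi_iff neg)
      \<comment> \<open>The witnesses are \<open>x \<curlyvee> \<sim> a\<close> and
        \<open>x \<curlyvee> \<sim> b\<close>. When their product is expanded, every term has a
        factor \<open>x\<close> except \<open>\<sim> a \<otimes> \<sim> b\<close>, which is below
        \<open>x\<close> by assumption.\<close>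
      have "(x \<curlyvee> \<sim> a) \<otimes> (x \<curlyvee> \<sim> b) \<preceq> x"
        using le by (simp add: mult_join_distrib join_mult_distrib join_least)
      moreover have "x \<curlyvee> \<sim> a \<in> phi A a" "x \<curlyvee> \<sim> b \<in> phi A b" by (simp_all add: phi_iff)
      ultimately show "x \<in> ?H" by auto }
    assume "x \<in> ?H"
    then obtain u w where uw: "u \<in> phi A a" "w \<in> phi A b" "u \<otimes> w \<preceq> x" and x: "x \<in> dense_elems A"
      by blast
    then have "\<sim> a \<otimes> \<sim> b \<preceq> u \<otimes> w" by (intro mult_mono) (auto simp: phi_iff)
    then have "\<sim> a \<otimes> \<sim> b \<preceq> x" by (rule le_trans) (use uw x in \<open>auto simp: phi_iff\<close>)
    then show "x \<in> phi A (a \<curlyvee> b)" using x by (simp add: phi_iff neg)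
  qed
  have meet: "phi A (a \<curlywedge> b) = phi A a \<inter> phi A b"
    if a: "a \<in> boolean_elems A" and b: "b \<in> boolean_elems A" for a b
  proof -
    note [simp] = boolean_carrier[OF a] boolean_carrier[OF b]
    have "\<sim> a \<curlyvee> \<sim> b \<preceq> x \<longleftrightarrow> \<sim> a \<preceq> x \<and> \<sim> b \<preceq> x" if "x \<in> carrier A" for x
      using that by (meson join_ge1 join_ge2 join_least le_trans neg_closed join_closed a b boolean_carrier)
    then show ?thesis by (auto simp: phi_iff neg_meet_boolean a b)
  qed
  have "phi A \<zero> = {\<one>}" "phi A \<one> = dense_elems A"
    by (auto simp: phi_iff le_one_iff bot_le)
  then show ?thesis
    unfolding D.filter_hom_iff using filter join meet by (simp add: B_alg_def)
qed

end

section \<open>Composition of homomorphisms and the two categories\<close>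

lemma rl_hom_id: "residuated_lattice A \<Longrightarrow> rl_hom A A (\<lambda>x\<in>carrier A. x)"
  by (simp add: rl_hom_def residuated_lattice.closed)

lemma rl_hom_compose:
  "\<lbrakk>residuated_lattice A; rl_hom A A' f; rl_hom A' A'' g\<rbrakk> \<Longrightarrow> rl_hom A A'' (compose (carrier A) g f)"
  by (auto simp: rl_hom_def compose_def residuated_lattice.closed Pi_iff)

lemma brl_hom_id: "bounded_residuated_lattice A \<Longrightarrow> brl_hom A A (\<lambda>x\<in>carrier A. x)"
  by (simp add: brl_hom_def rl_hom_id bounded_residuated_lattice.bot_closed
      bounded_residuated_lattice.axioms)

lemma brl_hom_compose:
  "\<lbrakk>bounded_residuated_lattice A; brl_hom A A' f; brl_hom A' A'' g\<rbrakk>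
    \<Longrightarrow> brl_hom A A'' (compose (carrier A) g f)"
  by (auto simp: brl_hom_def rl_hom_compose bounded_residuated_lattice.bot_closed compose_eq
      bounded_residuated_lattice.axioms)

lemma boolean_hom_id: "boolean_alg B \<Longrightarrow> boolean_hom B B (\<lambda>x\<in>carrier B. x)"
  unfolding boolean_hom_def boolean_alg_def boolean_alg_axioms_def lattice_ops_def by simp

lemma boolean_hom_compose:
  "\<lbrakk>boolean_alg B; boolean_hom B B' f; boolean_hom B' B'' g\<rbrakk>
    \<Longrightarrow> boolean_hom B B'' (compose (carrier B) g f)"
  unfolding boolean_hom_def boolean_alg_def boolean_alg_axioms_def lattice_ops_def
  by (auto simp: compose_def Pi_iff)

lemma brl_hom_funcset: "brl_hom A A' f \<Longrightarrow> f \<in> carrier A \<rightarrow> carrier A'"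
  by (simp add: brl_hom_def rl_hom_def)

lemma category_subvariety_cat: "category (subvariety_cat E)"
  unfolding category_def
proof (intro conjI ballI)
  note [simp] = subvariety_cat_def subvariety_def
  have [dest]: "bounded_residuated_lattice A" if "stonean_residuated_lattice A" for A :: "'a brlat"
    using that by (simp add: stonean_residuated_lattice.axioms)
  fix A A' A'' A''' :: "'a brlat" and f g h
  show "Id (subvariety_cat E) A \<in> Hom (subvariety_cat E) A A" if "A \<in> Obj (subvariety_cat E)"
    using that by (auto intro: brl_hom_id)
  assume A: "A \<in> Obj (subvariety_cat E)" and f: "f \<in> Hom (subvariety_cat E) A A'"
  then show "Comp (subvariety_cat E) A A A' f (Id (subvariety_cat E) A) = f"
    "Comp (subvariety_cat E) A A' A' (Id (subvariety_cat E) A') f = f"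
    by (auto intro: compose_Id Id_compose dest: brl_hom_funcset)
  assume g: "g \<in> Hom (subvariety_cat E) A' A''"
  show "Comp (subvariety_cat E) A A' A'' g f \<in> Hom (subvariety_cat E) A A''"
    using f g A by (auto intro: brl_hom_compose)
  assume h: "h \<in> Hom (subvariety_cat E) A'' A'''"
  show "Comp (subvariety_cat E) A A'' A''' h (Comp (subvariety_cat E) A A' A'' g f) =
      Comp (subvariety_cat E) A A' A''' (Comp (subvariety_cat E) A' A'' A''' h g) f"
    using f by (auto intro: compose_assoc dest: brl_hom_funcset)
qed

lemma category_full_subcategory: "category C \<Longrightarrow> category (full_subcategory C P)"
  unfolding category_def full_subcategory_def by simp

lemma filter_hom_subset: "\<lbrakk>filter_hom B D \<phi>; a \<in> carrier B\<rbrakk> \<Longrightarrow> \<phi> a \<subseteq> carrier D"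
  by (auto simp: filter_hom_def i_filters_def i_filter_def)

lemma triple_cat_simps:
  "X \<in> Obj triple_cat \<longleftrightarrow> is_triple X"
  "(h, k) \<in> Hom triple_cat X Y \<longleftrightarrow>
     h \<in> extensional (carrier (boolean_part X)) \<and> boolean_hom (boolean_part X) (boolean_part Y) h \<and>
     k \<in> extensional (carrier (dense_part X)) \<and> rl_hom (dense_part X) (dense_part Y) k \<and>
     (\<forall>a\<in>carrier (boolean_part X). k ` filter_map X a \<subseteq> filter_map Y (h a))"
  "Id triple_cat X = (\<lambda>x\<in>carrier (boolean_part X). x, \<lambda>x\<in>carrier (dense_part X). x)"
  "Comp triple_cat X Y Z (h', k') (h, k) =
     (compose (carrier (boolean_part X)) h' h, compose (carrier (dense_part X)) k' k)"
  by (simp_all add: triple_cat_def)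

lemma category_triple_cat: "category triple_cat"
  unfolding category_def
proof (intro conjI ballI)
  note [simp] = triple_cat_simps
  have funcset: "h \<in> carrier (boolean_part X) \<rightarrow> carrier (boolean_part Y)"
      "k \<in> carrier (dense_part X) \<rightarrow> carrier (dense_part Y)"
    if "(h, k) \<in> Hom triple_cat X Y" for h k and X Y :: "('a, 'b) triple"
    using that by (simp_all add: boolean_hom_def rl_hom_def)
  fix X Y Z W :: "('a, 'b) triple" and f g l
  show "Id triple_cat X \<in> Hom triple_cat X X" if "X \<in> Obj triple_cat"
    using that filter_hom_subset by (fastforce simp: is_triple_def boolean_hom_id rl_hom_id)
  assume X: "X \<in> Obj triple_cat" and f: "f \<in> Hom triple_cat X Y"
  obtain h k where hk: "f = (h, k)" by (cases f)
  note fhk = funcset[OF f[unfolded hk]]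
  show "Comp triple_cat X X Y f (Id triple_cat X) = f"
    "Comp triple_cat X Y Y (Id triple_cat Y) f = f"
    using f fhk by (auto simp: hk intro: compose_Id Id_compose)
  assume g: "g \<in> Hom triple_cat Y Z"
  obtain h' k' where hk': "g = (h', k')" by (cases g)
  show "Comp triple_cat X Y Z g f \<in> Hom triple_cat X Z"
  proof -
    have "compose (carrier (dense_part X)) k' k ` filter_map X a
        \<subseteq> filter_map Z (compose (carrier (boolean_part X)) h' h a)"
      if a: "a \<in> carrier (boolean_part X)" for a
    proof -
      have "filter_map X a \<subseteq> carrier (dense_part X)"
        using X a by (auto simp: is_triple_def dest: filter_hom_subset)
      then have "compose (carrier (dense_part X)) k' k ` filter_map X a = k' ` k ` filter_map X a"
        by (auto simp: compose_def image_iff subset_iff)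
      also have "\<dots> \<subseteq> k' ` filter_map Y (h a)" using f a by (intro image_mono) (simp add: hk)
      also have "\<dots> \<subseteq> filter_map Z (h' (h a))" using g a fhk by (auto simp: hk' Pi_iff)
      finally show ?thesis using a by (simp add: compose_eq)
    qed
    then show ?thesis
      using f g X by (auto simp: hk hk' is_triple_def intro: boolean_hom_compose rl_hom_compose)
  qed
  show "Comp triple_cat X Z W l (Comp triple_cat X Y Z g f) =
      Comp triple_cat X Y W (Comp triple_cat Y Z W l g) f"
    using fhk by (cases l) (simp add: hk hk' compose_assoc)
qed

section \<open>The functor is full and faithful\<close>

locale brl_hom_stonean = A: stonean_residuated_lattice A + A': stonean_residuated_lattice A'
  for A :: "('a, 'm) brlat_scheme" and A' :: "('b, 'n) brlat_scheme" +
  fixes f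
  assumes hom: "brl_hom A A' f"
begin

lemma hom_simps [simp]:
  "x \<in> carrier A \<Longrightarrow> f x \<in> carrier A'" "f \<one>\<^bsub>A\<^esub> = \<one>\<^bsub>A'\<^esub>" "f \<zero>\<^bsub>A\<^esub> = \<zero>\<^bsub>A'\<^esub>"
  "\<lbrakk>x \<in> carrier A; y \<in> carrier A\<rbrakk> \<Longrightarrow> f (x \<otimes>\<^bsub>A\<^esub> y) = f x \<otimes>\<^bsub>A'\<^esub> f y"
  "\<lbrakk>x \<in> carrier A; y \<in> carrier A\<rbrakk> \<Longrightarrow> f (x \<leadsto>\<^bsub>A\<^esub> y) = f x \<leadsto>\<^bsub>A'\<^esub> f y"
  "\<lbrakk>x \<in> carrier A; y \<in> carrier A\<rbrakk> \<Longrightarrow> f (x \<curlyvee>\<^bsub>A\<^esub> y) = f x \<curlyvee>\<^bsub>A'\<^esub> f y"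
  "\<lbrakk>x \<in> carrier A; y \<in> carrier A\<rbrakk> \<Longrightarrow> f (x \<curlywedge>\<^bsub>A\<^esub> y) = f x \<curlywedge>\<^bsub>A'\<^esub> f y"
  using hom by (auto simp: brl_hom_def rl_hom_def)

lemma hom_neg [simp]: "x \<in> carrier A \<Longrightarrow> f (\<sim>\<^bsub>A\<^esub> x) = \<sim>\<^bsub>A'\<^esub> f x"
  by (simp add: rneg_def)

lemma hom_le: "\<lbrakk>x \<preceq>\<^bsub>A\<^esub> y; x \<in> carrier A; y \<in> carrier A\<rbrakk> \<Longrightarrow> f x \<preceq>\<^bsub>A'\<^esub> f y"
  unfolding rle_def by (metis hom_simps(7))

lemma hom_dense [simp]: "d \<in> dense_elems A \<Longrightarrow> f d \<in> dense_elems A'"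
  by (rule A'.dense_elemsI) (simp_all flip: hom_neg)

lemma hom_boolean [simp]: "c \<in> boolean_elems A \<Longrightarrow> f c \<in> boolean_elems A'"
  by (rule A'.booleanI) (simp_all add: A.boolean_neg_neg flip: hom_neg)

lemma boolean_hom_restrict: "boolean_hom (B_alg A) (B_alg A') (restrict f (boolean_elems A))"
  by (auto simp: boolean_hom_def B_alg_def)

lemma rl_hom_restrict: "rl_hom (D_alg A) (D_alg A') (restrict f (dense_elems A))"
  by (auto simp: rl_hom_def D_alg_def)

lemma hom_phi: "a \<in> boolean_elems A \<Longrightarrow> f ` phi A a \<subseteq> phi A' (f a)"
  using hom_le by (fastforce simp: A.phi_iff A'.phi_iff simp flip: hom_neg)

end

lemma is_triple_T:
  assumes "stonean_residuated_lattice A"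
  shows "is_triple \<lparr>boolean_part = B_alg A, dense_part = D_alg A, filter_map = phi A\<rparr>"
proof -
  interpret stonean_residuated_lattice A by fact
  show ?thesis
    by (simp add: is_triple_def boolean_alg_B_alg residuated_lattice_D_alg filter_hom_phi)
qed

lemma subvariety_triple_cat_simps:
  "X \<in> Obj (subvariety_triple_cat E) \<longleftrightarrow> is_triple X \<and> dense_part X \<in> subvariety_star E"
  "Hom (subvariety_triple_cat E) = Hom triple_cat"
  "Id (subvariety_triple_cat E) = Id triple_cat"
  "Comp (subvariety_triple_cat E) = Comp triple_cat"
  by (simp_all add: subvariety_triple_cat_def full_subcategory_def triple_cat_simps)

lemma subvariety_cat_simps:
  "Obj (subvariety_cat E) = subvariety E"
  "f \<in> Hom (subvariety_cat E) A A' \<longleftrightarrow> f \<in> extensional (carrier A) \<and> brl_hom A A' f"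
  "Id (subvariety_cat E) A = (\<lambda>x\<in>carrier A. x)"
  "Comp (subvariety_cat E) A A' A'' g f = compose (carrier A) g f"
  by (simp_all add: subvariety_cat_def)

lemma T_func_simps:
  "onObj T_func A = \<lparr>boolean_part = B_alg A, dense_part = D_alg A, filter_map = phi A\<rparr>"
  "onArr T_func A A' f = (restrict f (boolean_elems A), restrict f (dense_elems A))"
  by (simp_all add: T_func_def)

lemma carrier_B_alg_D_alg:
  "carrier (B_alg A) = boolean_elems A" "carrier (D_alg A) = dense_elems A"
  by (simp_all add: B_alg_def D_alg_def)

lemma is_functor_T:
  assumes A0: "A0 \<in> subvariety E" "x \<in> carrier A0" "x \<noteq> \<one>\<^bsub>A0\<^esub>"
  shows "is_functor (subvariety_cat E) (subvariety_triple_cat E) T_func"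
  unfolding is_functor_def
proof (intro conjI ballI)
  note simps = subvariety_cat_simps subvariety_triple_cat_simps T_func_simps triple_cat_simps
    carrier_B_alg_D_alg
  show "category (subvariety_cat E)" by (rule category_subvariety_cat)
  show "category (subvariety_triple_cat E)"
    unfolding subvariety_triple_cat_def by (intro category_full_subcategory category_triple_cat)
  fix A assume "A \<in> Obj (subvariety_cat E)"
  then have A: "A \<in> subvariety E" by (simp add: simps)
  then interpret A: stonean_residuated_lattice A by (simp add: subvariety_def)
  show "onObj T_func A \<in> Obj (subvariety_triple_cat E)"
    using D_alg_in_star[OF A A0] A.stonean_residuated_lattice_axioms by (simp add: simps is_triple_T)
  have "boolean_elems A \<subseteq> carrier A" "dense_elems A \<subseteq> carrier A" by auto
  note sub = this
  show "onArr T_func A A (Id (subvariety_cat E) A) = Id (subvariety_triple_cat E) (onObj T_func A)"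
    using sub by (auto simp: simps restrict_def fun_eq_iff)
  fix A' f assume "A' \<in> Obj (subvariety_cat E)" and f: "f \<in> Hom (subvariety_cat E) A A'"
  then interpret A': stonean_residuated_lattice A' by (simp add: subvariety_def simps)
  interpret f: brl_hom_stonean A A' f using f by unfold_locales (simp add: simps)
  have "restrict f (dense_elems A) ` phi A a \<subseteq> phi A' (restrict f (boolean_elems A) a)"
    if a: "a \<in> boolean_elems A" for a
    using f.hom_phi[OF a] a by (auto simp: phi_def)
  then show "onArr T_func A A' f \<in> Hom (subvariety_triple_cat E) (onObj T_func A) (onObj T_func A')"
    using f.boolean_hom_restrict f.rl_hom_restrict by (simp add: simps)
  fix A'' g
  show "onArr T_func A A'' (Comp (subvariety_cat E) A A' A'' g f) =
      Comp (subvariety_triple_cat E) (onObj T_func A) (onObj T_func A') (onObj T_func A'')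
        (onArr T_func A' A'' g) (onArr T_func A A' f)"
    using sub by (auto simp: simps restrict_def compose_def fun_eq_iff)
qed

lemma T_faithful:
  assumes "stonean_residuated_lattice A" "stonean_residuated_lattice A'"
    and f: "f \<in> extensional (carrier A)" "brl_hom A A' f"
    and g: "g \<in> extensional (carrier A)" "brl_hom A A' g"
    and eq: "onArr T_func A A' f = onArr T_func A A' g"
  shows "f = g"
proof (rule extensionalityI[OF f(1) g(1)])
  interpret A: stonean_residuated_lattice A by fact
  interpret A': stonean_residuated_lattice A' by fact
  interpret f: brl_hom_stonean A A' f by unfold_locales (rule f)
  interpret g: brl_hom_stonean A A' g by unfold_locales (rule g)
  have B: "f c = g c" if "c \<in> boolean_elems A" for c
    using eq that unfolding T_func_simps by (metis Pair_inject restrict_apply')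
  have D: "f d = g d" if "d \<in> dense_elems A" for d
    using eq that unfolding T_func_simps by (metis Pair_inject restrict_apply')
  fix x assume x: "x \<in> carrier A"
  \<comment> \<open>Only the outer product is expanded: the rules for negation and join are withheld
    so that \<open>B\<close> and \<open>D\<close> apply to the Boolean and the dense factor as
    wholes.\<close>
  have "f (\<sim>\<^bsub>A\<^esub> (\<sim>\<^bsub>A\<^esub> x) \<otimes>\<^bsub>A\<^esub> (x \<curlyvee>\<^bsub>A\<^esub> (\<sim>\<^bsub>A\<^esub> x))) = g (\<sim>\<^bsub>A\<^esub> (\<sim>\<^bsub>A\<^esub> x) \<otimes>\<^bsub>A\<^esub> (x \<curlyvee>\<^bsub>A\<^esub> (\<sim>\<^bsub>A\<^esub> x)))"
    using B[of "\<sim>\<^bsub>A\<^esub> (\<sim>\<^bsub>A\<^esub> x)"] D[of "x \<curlyvee>\<^bsub>A\<^esub> (\<sim>\<^bsub>A\<^esub> x)"] x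
    by (simp del: f.hom_neg g.hom_neg f.hom_simps(6) g.hom_simps(6))
  then show "f x = g x" using x by (simp add: A.decompose)
qed

lemma T_full:
  assumes "stonean_residuated_lattice A" "stonean_residuated_lattice A'"
    and hk: "(h, k) \<in> Hom triple_cat (onObj T_func A) (onObj T_func A')"
  shows "\<exists>f. f \<in> extensional (carrier A) \<and> brl_hom A A' f \<and> onArr T_func A A' f = (h, k)"
proof -
  interpret A: stonean_residuated_lattice A by fact
  interpret A': stonean_residuated_lattice A' by fact
  let ?B = "boolean_elems A" and ?D = "dense_elems A"
  have h_ext: "h \<in> extensional ?B" and k_ext: "k \<in> extensional ?D"
    using hk by (simp_all add: triple_cat_simps T_func_simps carrier_B_alg_D_alg)
  have h [simp]: "c \<in> ?B \<Longrightarrow> h c \<in> boolean_elems A'" "h \<zero>\<^bsub>A\<^esub> = \<zero>\<^bsub>A'\<^esub>" "h \<one>\<^bsub>A\<^esub> = \<one>\<^bsub>A'\<^esub>"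
    "c \<in> ?B \<Longrightarrow> h (\<sim>\<^bsub>A\<^esub> c) = \<sim>\<^bsub>A'\<^esub> h c"
    "\<lbrakk>b \<in> ?B; c \<in> ?B\<rbrakk> \<Longrightarrow> h (b \<curlyvee>\<^bsub>A\<^esub> c) = h b \<curlyvee>\<^bsub>A'\<^esub> h c"
    "\<lbrakk>b \<in> ?B; c \<in> ?B\<rbrakk> \<Longrightarrow> h (b \<curlywedge>\<^bsub>A\<^esub> c) = h b \<curlywedge>\<^bsub>A'\<^esub> h c" for b c
    using hk by (auto simp: triple_cat_simps T_func_simps boolean_hom_def B_alg_def)
  have k [simp]: "d \<in> ?D \<Longrightarrow> k d \<in> dense_elems A'" "k \<one>\<^bsub>A\<^esub> = \<one>\<^bsub>A'\<^esub>"
    "\<lbrakk>d \<in> ?D; e \<in> ?D\<rbrakk> \<Longrightarrow> k (d \<otimes>\<^bsub>A\<^esub> e) = k d \<otimes>\<^bsub>A'\<^esub> k e"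
    "\<lbrakk>d \<in> ?D; e \<in> ?D\<rbrakk> \<Longrightarrow> k (d \<leadsto>\<^bsub>A\<^esub> e) = k d \<leadsto>\<^bsub>A'\<^esub> k e"
    "\<lbrakk>d \<in> ?D; e \<in> ?D\<rbrakk> \<Longrightarrow> k (d \<curlyvee>\<^bsub>A\<^esub> e) = k d \<curlyvee>\<^bsub>A'\<^esub> k e"
    "\<lbrakk>d \<in> ?D; e \<in> ?D\<rbrakk> \<Longrightarrow> k (d \<curlywedge>\<^bsub>A\<^esub> e) = k d \<curlywedge>\<^bsub>A'\<^esub> k e" for d e
    using hk by (auto simp: triple_cat_simps T_func_simps rl_hom_def D_alg_def)
  have phi: "\<sim>\<^bsub>A'\<^esub> h a \<preceq>\<^bsub>A'\<^esub> k d" if "a \<in> ?B" "d \<in> ?D" "\<sim>\<^bsub>A\<^esub> a \<preceq>\<^bsub>A\<^esub> d" for a d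
    using hk that by (auto simp: triple_cat_simps T_func_simps phi_def B_alg_def)
  have hmult [simp]: "h (b \<otimes>\<^bsub>A\<^esub> c) = h b \<otimes>\<^bsub>A'\<^esub> h c" if "b \<in> ?B" "c \<in> ?B" for b c
    using h(6)[OF that] that by (simp add: A.boolean_meet_eq_mult A'.boolean_meet_eq_mult)
  \<comment> \<open>The inclusion condition on \<open>(h, k)\<close> enters here, twice. Since
    \<open>(c \<curlyvee> d) \<leadsto> d\<close> lies in the filter of \<open>c\<close>, its image
    is above \<open>\<sim> (h c)\<close>, which gives the upper bound; since
    \<open>c \<curlyvee> d\<close> lies in the filter of \<open>\<sim> c\<close>, its image is above
    \<open>h c\<close>.\<close>
  have key: "k (c \<curlyvee>\<^bsub>A\<^esub> d) = h c \<curlyvee>\<^bsub>A'\<^esub> k d" if c: "c \<in> ?B" and d: "d \<in> ?D" for c d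
  proof (rule A'.le_antisym)
    note [simp] = c d
    have cd [simp]: "c \<curlyvee>\<^bsub>A\<^esub> d \<in> ?D" by simp
    have "\<sim>\<^bsub>A\<^esub> c \<otimes>\<^bsub>A\<^esub> (c \<curlyvee>\<^bsub>A\<^esub> d) \<preceq>\<^bsub>A\<^esub> d" by (simp add: A.mult_join_distrib)
    then have "\<sim>\<^bsub>A'\<^esub> h c \<preceq>\<^bsub>A'\<^esub> k (c \<curlyvee>\<^bsub>A\<^esub> d) \<leadsto>\<^bsub>A'\<^esub> k d"
      using phi[of c "(c \<curlyvee>\<^bsub>A\<^esub> d) \<leadsto>\<^bsub>A\<^esub> d"] by (simp add: A.residuation)
    then have "\<sim>\<^bsub>A'\<^esub> h c \<otimes>\<^bsub>A'\<^esub> k (c \<curlyvee>\<^bsub>A\<^esub> d) \<preceq>\<^bsub>A'\<^esub> k d"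
      by (simp add: A'.residuation)
    then show "k (c \<curlyvee>\<^bsub>A\<^esub> d) \<preceq>\<^bsub>A'\<^esub> h c \<curlyvee>\<^bsub>A'\<^esub> k d"
      by (intro A'.boolean_le_cases[of "h c" "k (c \<curlyvee>\<^bsub>A\<^esub> d)"])
        (simp_all add: A'.le_joinI1 A'.le_joinI2)
    have "k d \<preceq>\<^bsub>A'\<^esub> k (c \<curlyvee>\<^bsub>A\<^esub> d)"
      using k(4)[of d "c \<curlyvee>\<^bsub>A\<^esub> d"] A.imp_eq_one_iff[of d "c \<curlyvee>\<^bsub>A\<^esub> d"]
        A'.imp_eq_one_iff[of "k d" "k (c \<curlyvee>\<^bsub>A\<^esub> d)"] by (simp del: k(4))
    moreover have "h c \<preceq>\<^bsub>A'\<^esub> k (c \<curlyvee>\<^bsub>A\<^esub> d)"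
      using phi[of "\<sim>\<^bsub>A\<^esub> c" "c \<curlyvee>\<^bsub>A\<^esub> d"] by (simp add: A.boolean_neg_neg A'.boolean_neg_neg)
    ultimately show "h c \<curlyvee>\<^bsub>A'\<^esub> k d \<preceq>\<^bsub>A'\<^esub> k (c \<curlyvee>\<^bsub>A\<^esub> d)"
      by (intro A'.join_least) simp_all
  qed (use c d in simp_all)
  define f where "f = (\<lambda>x\<in>carrier A. h (\<sim>\<^bsub>A\<^esub> (\<sim>\<^bsub>A\<^esub> x)) \<otimes>\<^bsub>A'\<^esub> k (x \<curlyvee>\<^bsub>A\<^esub> (\<sim>\<^bsub>A\<^esub> x)))"
  \<comment> \<open>\<open>f\<close> is defined by the canonical decomposition but may be evaluated
    on any other: the canonical dense factor of \<open>c \<otimes> d\<close> is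
    \<open>\<sim> c \<curlyvee> d\<close>, and multiplying its image by \<open>h c\<close> removes
    the first term. This freedom is what makes \<open>ops\<close> computable.\<close>
  have f: "f (c \<otimes>\<^bsub>A\<^esub> d) = h c \<otimes>\<^bsub>A'\<^esub> k d" if c: "c \<in> ?B" and d: "d \<in> ?D" for c d
  proof -
    note [simp] = c d
    have n: "\<sim>\<^bsub>A\<^esub> (c \<otimes>\<^bsub>A\<^esub> d) = \<sim>\<^bsub>A\<^esub> c" by (simp add: A.neg_mult flip: rneg_def)
    have "(c \<otimes>\<^bsub>A\<^esub> d) \<curlyvee>\<^bsub>A\<^esub> (\<sim>\<^bsub>A\<^esub> c) = \<sim>\<^bsub>A\<^esub> c \<curlyvee>\<^bsub>A\<^esub> d" (is "?l = ?r")
    proof (rule A.le_antisym)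
      show "?l \<preceq>\<^bsub>A\<^esub> ?r" by (simp add: A.join_least A.le_joinI2)
      show "?r \<preceq>\<^bsub>A\<^esub> ?l"
      proof (rule A.boolean_le_cases[of c])
        show "c \<otimes>\<^bsub>A\<^esub> ?r \<preceq>\<^bsub>A\<^esub> ?l" by (simp add: A.mult_join_distrib)
        show "(\<sim>\<^bsub>A\<^esub> c) \<otimes>\<^bsub>A\<^esub> ?r \<preceq>\<^bsub>A\<^esub> ?l" by (intro A.mult_leI1 A.le_joinI2) simp_all
      qed simp_all
    qed simp_all
    then have "f (c \<otimes>\<^bsub>A\<^esub> d) = h c \<otimes>\<^bsub>A'\<^esub> (\<sim>\<^bsub>A'\<^esub> h c \<curlyvee>\<^bsub>A'\<^esub> k d)"
      by (simp add: f_def n A.boolean_neg_neg key)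
    also have "\<dots> = h c \<otimes>\<^bsub>A'\<^esub> k d" by (simp add: A'.mult_join_distrib)
    finally show ?thesis .
  qed
  have dec: "\<exists>c\<in>?B. \<exists>d\<in>?D. x = c \<otimes>\<^bsub>A\<^esub> d" if "x \<in> carrier A" for x
    using that A.decompose[of x] A.boolean_neg[of "\<sim>\<^bsub>A\<^esub> x"] A.dense_join_neg[of x] A.neg_closed
    by metis
  have fB: "f c = h c" if "c \<in> ?B" for c
    using f[OF that, of "\<one>\<^bsub>A\<^esub>"] that by simp
  have fD: "f d = k d" if "d \<in> ?D" for d
    using f[OF _ that, of "\<one>\<^bsub>A\<^esub>"] that by simp
  have ops: "f (x \<otimes>\<^bsub>A\<^esub> y) = f x \<otimes>\<^bsub>A'\<^esub> f y \<and> f (x \<leadsto>\<^bsub>A\<^esub> y) = f x \<leadsto>\<^bsub>A'\<^esub> f y \<and>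
      f (x \<curlyvee>\<^bsub>A\<^esub> y) = f x \<curlyvee>\<^bsub>A'\<^esub> f y \<and> f (x \<curlywedge>\<^bsub>A\<^esub> y) = f x \<curlywedge>\<^bsub>A'\<^esub> f y"
    if xy: "x \<in> carrier A" "y \<in> carrier A" for x y
  proof -
    obtain c d where x: "x = c \<otimes>\<^bsub>A\<^esub> d" and [simp]: "c \<in> ?B" "d \<in> ?D" using dec[OF xy(1)] by blast
    obtain b e where y: "y = b \<otimes>\<^bsub>A\<^esub> e" and [simp]: "b \<in> ?B" "e \<in> ?D" using dec[OF xy(2)] by blast
    have fx: "f x = h c \<otimes>\<^bsub>A'\<^esub> k d" and fy: "f y = h b \<otimes>\<^bsub>A'\<^esub> k e" by (simp_all add: x y f)
    have "x \<otimes>\<^bsub>A\<^esub> y = (c \<otimes>\<^bsub>A\<^esub> b) \<otimes>\<^bsub>A\<^esub> (d \<otimes>\<^bsub>A\<^esub> e)" by (simp add: x y A.m_ac)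
    then have "f (x \<otimes>\<^bsub>A\<^esub> y) = (h c \<otimes>\<^bsub>A'\<^esub> h b) \<otimes>\<^bsub>A'\<^esub> (k d \<otimes>\<^bsub>A'\<^esub> k e)" by (simp add: f)
    then have 1: "f (x \<otimes>\<^bsub>A\<^esub> y) = f x \<otimes>\<^bsub>A'\<^esub> f y" by (simp add: fx fy A'.m_ac)
    have "x \<curlywedge>\<^bsub>A\<^esub> y = (c \<otimes>\<^bsub>A\<^esub> b) \<otimes>\<^bsub>A\<^esub> (d \<curlywedge>\<^bsub>A\<^esub> e)" unfolding x y by (rule A.meet_boolean) simp_all
    then have "f (x \<curlywedge>\<^bsub>A\<^esub> y) = (h c \<otimes>\<^bsub>A'\<^esub> h b) \<otimes>\<^bsub>A'\<^esub> (k d \<curlywedge>\<^bsub>A'\<^esub> k e)" by (simp add: f)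
    also have "\<dots> = f x \<curlywedge>\<^bsub>A'\<^esub> f y" unfolding fx fy by (rule A'.meet_boolean[symmetric]) simp_all
    finally have 2: "f (x \<curlywedge>\<^bsub>A\<^esub> y) = f x \<curlywedge>\<^bsub>A'\<^esub> f y" .
    have "f (x \<curlyvee>\<^bsub>A\<^esub> y) = (h c \<curlyvee>\<^bsub>A'\<^esub> h b) \<otimes>\<^bsub>A'\<^esub>
        ((h b \<curlyvee>\<^bsub>A'\<^esub> k d) \<curlywedge>\<^bsub>A'\<^esub> (h c \<curlyvee>\<^bsub>A'\<^esub> k e) \<curlywedge>\<^bsub>A'\<^esub> (k d \<curlyvee>\<^bsub>A'\<^esub> k e))"
      unfolding x y by (simp add: A.join_boolean_dense f key)
    also have "\<dots> = f x \<curlyvee>\<^bsub>A'\<^esub> f y" unfolding fx fy by (simp add: A'.join_boolean_dense)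
    finally have 3: "f (x \<curlyvee>\<^bsub>A\<^esub> y) = f x \<curlyvee>\<^bsub>A'\<^esub> f y" .
    have "f (x \<leadsto>\<^bsub>A\<^esub> y) = (\<sim>\<^bsub>A'\<^esub> h c \<curlyvee>\<^bsub>A'\<^esub> h b) \<otimes>\<^bsub>A'\<^esub>
        (\<sim>\<^bsub>A'\<^esub> (h c \<otimes>\<^bsub>A'\<^esub> h b) \<curlyvee>\<^bsub>A'\<^esub> (k d \<leadsto>\<^bsub>A'\<^esub> k e))"
      unfolding x y by (simp add: A.imp_boolean_dense f key)
    also have "\<dots> = f x \<leadsto>\<^bsub>A'\<^esub> f y" unfolding fx fy by (simp add: A'.imp_boolean_dense)
    finally show ?thesis using 1 2 3 by simp
  qed
  have "f \<one>\<^bsub>A\<^esub> = \<one>\<^bsub>A'\<^esub>" "f \<zero>\<^bsub>A\<^esub> = \<zero>\<^bsub>A'\<^esub>" by (simp_all add: fB)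
  moreover have "f \<in> carrier A \<rightarrow> carrier A'" by (simp add: f_def)
  ultimately have "brl_hom A A' f" using ops by (simp add: brl_hom_def rl_hom_def)
  moreover have "restrict f ?B = h" "restrict f ?D = k"
    using h_ext k_ext by (auto simp: fB fD extensional_def fun_eq_iff)
  ultimately show ?thesis unfolding T_func_simps by (auto simp: f_def)
qed

section \<open>Restriction operators of a triple\<close>

context boolean_alg
begin

lemma b_closed [simp]:
  "bbot B \<in> carrier B" "btop B \<in> carrier B" "x \<in> carrier B \<Longrightarrow> bcompl B x \<in> carrier B"
  "\<lbrakk>x \<in> carrier B; y \<in> carrier B\<rbrakk> \<Longrightarrow> bjoin B x y \<in> carrier B"
  "\<lbrakk>x \<in> carrier B; y \<in> carrier B\<rbrakk> \<Longrightarrow> bmeet B x y \<in> carrier B"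
  by (simp_all add: bbot_closed btop_closed bcompl_closed join_closed meet_closed)

lemma b_meet_idem [simp]: "x \<in> carrier B \<Longrightarrow> bmeet B x x = x"
  by (metis join_meet_absorb meet_join_absorb meet_closed)

lemma b_meet_left_comm:
  "\<lbrakk>x \<in> carrier B; y \<in> carrier B; z \<in> carrier B\<rbrakk>
    \<Longrightarrow> bmeet B x (bmeet B y z) = bmeet B y (bmeet B x z)"
  by (metis meet_assoc meet_comm)

lemmas b_meet_ac = meet_assoc meet_comm b_meet_left_comm

lemma b_meet_bot [simp]:
  "x \<in> carrier B \<Longrightarrow> bmeet B x (bbot B) = bbot B" "x \<in> carrier B \<Longrightarrow> bmeet B (bbot B) x = bbot B"
  by (metis bbot_closed join_bbot join_comm meet_comm meet_join_absorb,
      metis bbot_closed join_bbot join_comm meet_join_absorb)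

lemma b_units [simp]:
  "x \<in> carrier B \<Longrightarrow> bmeet B x (btop B) = x" "x \<in> carrier B \<Longrightarrow> bmeet B (btop B) x = x"
  "x \<in> carrier B \<Longrightarrow> bjoin B x (bbot B) = x" "x \<in> carrier B \<Longrightarrow> bjoin B (bbot B) x = x"
  using meet_btop join_bbot meet_comm join_comm btop_closed bbot_closed by metis+

lemma b_join_idem [simp]: "x \<in> carrier B \<Longrightarrow> bjoin B x x = x"
  by (metis b_meet_idem join_meet_absorb)

lemma b_compl [simp]:
  assumes "x \<in> carrier B"
  shows "bmeet B x (bcompl B x) = bbot B" "bmeet B (bcompl B x) x = bbot B"
    "bjoin B x (bcompl B x) = btop B" "bjoin B (bcompl B x) x = btop B"
  using assms by (simp_all add: meet_bcompl join_bcompl meet_comm[of "bcompl B x"] join_comm[of "bcompl B x"])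

lemma compl_unique:
  assumes [simp]: "x \<in> carrier B" "y \<in> carrier B"
    and xy: "bmeet B x y = bbot B" "bjoin B x y = btop B"
  shows "bcompl B x = y"
proof -
  have "bcompl B x = bmeet B (bcompl B x) (bjoin B x y)" by (simp add: xy)
  also have "\<dots> = bmeet B (bcompl B x) y" by (simp add: distrib)
  also have "\<dots> = bmeet B y (bjoin B x (bcompl B x))"
    using xy(1) by (simp add: distrib meet_comm[of y] del: b_compl b_units(1))
  also have "\<dots> = y" by simp
  finally show ?thesis .
qed

lemma compl_compl [simp]: "x \<in> carrier B \<Longrightarrow> bcompl B (bcompl B x) = x"
  by (rule compl_unique) simp_all

lemma compl_bounds [simp]: "bcompl B (bbot B) = btop B" "bcompl B (btop B) = bbot B"
  by (rule compl_unique; simp)+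

end

section \<open>Congruences of i-filters and the restriction operators\<close>

locale triple_data = B: boolean_alg B + D: residuated_lattice D
  for B :: "('b, 'm) balg_scheme" and D :: "('d, 'n) rlat_scheme" (structure) +
  fixes \<phi> :: "'b \<Rightarrow> 'd set"
  assumes \<phi>: "filter_hom B D \<phi>"
begin

abbreviation bm (infixl \<open>\<sqdot>\<close> 70) where "a \<sqdot> b \<equiv> bmeet B a b"
abbreviation bc (\<open>\<complement>_\<close> [81] 80) where "\<complement>a \<equiv> bcompl B a"

text \<open>The congruence of the i-filter \<open>F\<close>. For
  \<open>F = \<phi> (\<complement>c)\<close> it means agreement on \<open>c\<close>, since elements
  of this filter are to be thought of as \<open>\<one>\<close> on \<open>c\<close>.\<close>

definition cong :: "'d set \<Rightarrow> 'd \<Rightarrow> 'd \<Rightarrow> bool" where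
  "cong F d e \<longleftrightarrow> d \<in> carrier D \<and> e \<in> carrier D \<and> d \<leadsto> e \<in> F \<and> e \<leadsto> d \<in> F"

lemma phi_filter [simp]: "a \<in> carrier B \<Longrightarrow> i_filter D (\<phi> a)"
  and phi_bot: "\<phi> (bbot B) = {\<one>}"
  and phi_top: "\<phi> (btop B) = carrier D"
  and phi_meet: "\<lbrakk>a \<in> carrier B; b \<in> carrier B\<rbrakk> \<Longrightarrow> \<phi> (a \<sqdot> b) = \<phi> a \<inter> \<phi> b"
  and phi_join: "\<lbrakk>a \<in> carrier B; b \<in> carrier B\<rbrakk>
    \<Longrightarrow> \<phi> (bjoin B a b) = {x \<in> carrier D. \<exists>u\<in>\<phi> a. \<exists>w\<in>\<phi> b. u \<otimes> w \<preceq> x}"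
  using \<phi> by (simp_all add: D.filter_hom_iff)

lemma phi_carrier [simp]: "\<lbrakk>d \<in> \<phi> a; a \<in> carrier B\<rbrakk> \<Longrightarrow> d \<in> carrier D"
  using D.i_filterD(1)[OF phi_filter] by blast

lemma phi_compl_disjoint: "\<lbrakk>d \<in> \<phi> c; d \<in> \<phi> (\<complement>c); c \<in> carrier B\<rbrakk> \<Longrightarrow> d = \<one>"
  using phi_meet[of c "\<complement>c"] phi_bot by auto

text \<open>In the function picture: agreement on \<open>a\<close> implies agreement on the smaller
  \<open>a \<sqdot> b\<close>.\<close>

lemma phi_compl_mono:
  assumes [simp]: "a \<in> carrier B" "b \<in> carrier B"
  shows "\<phi> (\<complement>a) \<subseteq> \<phi> (\<complement>(a \<sqdot> b))"
proof -
  have "\<complement>a = \<complement>a \<sqdot> bjoin B (a \<sqdot> b) (\<complement>(a \<sqdot> b))" by simp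
  also have "\<dots> = \<complement>a \<sqdot> \<complement>(a \<sqdot> b)"
    by (subst B.distrib) (simp_all flip: B.meet_assoc)
  finally show ?thesis using phi_meet[of "\<complement>a" "\<complement>(a \<sqdot> b)"] by auto
qed

context
  fixes F assumes F: "i_filter D F"
begin

lemma cong_le:
  assumes "x \<in> F" "y \<in> F" "x \<otimes> y \<preceq> d \<leadsto> e" "d \<in> carrier D" "e \<in> carrier D"
  shows "d \<leadsto> e \<in> F"
  using D.i_filter_up[OF F D.i_filter_mult[OF F assms(1,2)] assms(3)] assms(4,5) by simp

lemma cong_refl: "d \<in> carrier D \<Longrightarrow> cong F d d"
  by (simp add: cong_def D.i_filterD(2)[OF F])

lemma cong_sym: "cong F d e \<Longrightarrow> cong F e d"
  by (simp add: cong_def)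

lemma mult_imp_imp:
  assumes [simp]: "d \<in> carrier D" "e \<in> carrier D" "g \<in> carrier D"
  shows "(d \<leadsto> e) \<otimes> (e \<leadsto> g) \<preceq> d \<leadsto> g"
proof -
  have "(d \<leadsto> e) \<otimes> (e \<leadsto> g) \<otimes> d = (d \<otimes> (d \<leadsto> e)) \<otimes> (e \<leadsto> g)" by (simp add: D.m_ac)
  also have "\<dots> \<preceq> e \<otimes> (e \<leadsto> g)" by (intro D.mult_mono1 D.mult_imp_le) simp_all
  finally have "(d \<leadsto> e) \<otimes> (e \<leadsto> g) \<otimes> d \<preceq> g"
    by (rule D.le_trans) (simp_all add: D.mult_imp_le)
  then show ?thesis by (simp add: D.residuation)
qed

lemma cong_trans: "\<lbrakk>cong F d e; cong F e g\<rbrakk> \<Longrightarrow> cong F d g"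
  unfolding cong_def by (auto intro: cong_le mult_imp_imp)

lemma cong_one_iff: "d \<in> carrier D \<Longrightarrow> cong F d \<one> \<longleftrightarrow> d \<in> F"
  by (simp add: cong_def D.i_filterD(2)[OF F])

text \<open>The elements \<open>u\<close> and \<open>w\<close> contain both implications, hence lie
  in \<open>F\<close> and are symmetric up to commutativity. One inequality, required for all
  arguments, therefore yields both halves of the congruence.\<close>

lemma cong_op:
  assumes de: "cong F d e" "cong F d' e'"
    and op: "\<And>x y. \<lbrakk>x \<in> carrier D; y \<in> carrier D\<rbrakk> \<Longrightarrow> f x y \<in> carrier D"
    and le: "\<And>d e d' e' u w. \<lbrakk>d \<in> carrier D; e \<in> carrier D; d' \<in> carrier D; e' \<in> carrier D;
        u = (d \<leadsto> e) \<otimes> (e \<leadsto> d); w = (d' \<leadsto> e') \<otimes> (e' \<leadsto> d')\<rbrakk>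
      \<Longrightarrow> (u \<otimes> w) \<otimes> f d d' \<preceq> f e e'"
  shows "cong F (f d d') (f e e')"
proof -
  have [simp]: "d \<in> carrier D" "e \<in> carrier D" "d' \<in> carrier D" "e' \<in> carrier D"
    using de by (auto simp: cong_def)
  let ?u = "(d \<leadsto> e) \<otimes> (e \<leadsto> d)" and ?w = "(d' \<leadsto> e') \<otimes> (e' \<leadsto> d')"
  have uw: "?u \<in> F" "?w \<in> F" using de by (auto simp: cong_def intro: D.i_filter_mult[OF F])
  have "?u \<otimes> ?w \<preceq> f d d' \<leadsto> f e e'"
    using le[of d e d' e' ?u ?w] op by (simp flip: D.residuation)
  moreover have "?u \<otimes> ?w \<preceq> f e e' \<leadsto> f d d'"
    using le[of e d e' d' ?u ?w] op by (simp add: D.m_comm flip: D.residuation)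
  ultimately show ?thesis unfolding cong_def using op by (simp add: cong_le[OF uw])
qed

lemma cong_mult: "\<lbrakk>cong F d e; cong F d' e'\<rbrakk> \<Longrightarrow> cong F (d \<otimes> d') (e \<otimes> e')"
proof (rule cong_op[where f = "monoid.mult D"])
  fix d e d' e' u w
  assume [simp]: "d \<in> carrier D" "e \<in> carrier D" "d' \<in> carrier D" "e' \<in> carrier D"
    and u: "u = (d \<leadsto> e) \<otimes> (e \<leadsto> d)" and w: "w = (d' \<leadsto> e') \<otimes> (e' \<leadsto> d')"
  have [simp]: "u \<in> carrier D" "w \<in> carrier D" by (simp_all add: u w)
  have "u \<otimes> d \<preceq> e" "w \<otimes> d' \<preceq> e'" unfolding u w by (simp_all add: D.residuation)
  then have "(u \<otimes> d) \<otimes> (w \<otimes> d') \<preceq> e \<otimes> e'" by (intro D.mult_mono) simp_all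
  then show "(u \<otimes> w) \<otimes> (d \<otimes> d') \<preceq> e \<otimes> e'" by (simp add: D.m_ac)
qed simp_all

lemma cong_imp: "\<lbrakk>cong F d e; cong F d' e'\<rbrakk> \<Longrightarrow> cong F (d \<leadsto> d') (e \<leadsto> e')"
proof (rule cong_op[where f = "rimp D"])
  fix d e d' e' u w
  assume [simp]: "d \<in> carrier D" "e \<in> carrier D" "d' \<in> carrier D" "e' \<in> carrier D"
    and u: "u = (d \<leadsto> e) \<otimes> (e \<leadsto> d)" and w: "w = (d' \<leadsto> e') \<otimes> (e' \<leadsto> d')"
  have [simp]: "u \<in> carrier D" "w \<in> carrier D" by (simp_all add: u w)
  have 1: "u \<otimes> e \<preceq> d" and 2: "w \<otimes> d' \<preceq> e'" unfolding u w by (simp_all add: D.residuation)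
  have "(u \<otimes> w) \<otimes> (d \<leadsto> d') \<otimes> e = w \<otimes> ((u \<otimes> e) \<otimes> (d \<leadsto> d'))" by (simp add: D.m_ac)
  also have "\<dots> \<preceq> w \<otimes> (d \<otimes> (d \<leadsto> d'))" using 1 by (intro D.mult_mono1 D.mult_mono2) simp_all
  finally have "(u \<otimes> w) \<otimes> (d \<leadsto> d') \<otimes> e \<preceq> w \<otimes> d'"
    by (rule D.le_trans) (simp_all add: D.mult_imp_le D.mult_mono2)
  from D.le_trans[OF this 2] show "(u \<otimes> w) \<otimes> (d \<leadsto> d') \<preceq> e \<leadsto> e'" by (simp add: D.residuation)
qed simp_all

lemma cong_join: "\<lbrakk>cong F d e; cong F d' e'\<rbrakk> \<Longrightarrow> cong F (d \<curlyvee> d') (e \<curlyvee> e')"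
proof (rule cong_op[where f = "rjoin D"])
  fix d e d' e' u w
  assume [simp]: "d \<in> carrier D" "e \<in> carrier D" "d' \<in> carrier D" "e' \<in> carrier D"
    and u: "u = (d \<leadsto> e) \<otimes> (e \<leadsto> d)" and w: "w = (d' \<leadsto> e') \<otimes> (e' \<leadsto> d')"
  have [simp]: "u \<in> carrier D" "w \<in> carrier D" by (simp_all add: u w)
  have 1: "u \<otimes> d \<preceq> e" and 2: "w \<otimes> d' \<preceq> e'" unfolding u w by (simp_all add: D.residuation)
  have "w \<otimes> (u \<otimes> d) \<preceq> e" "u \<otimes> (w \<otimes> d') \<preceq> e'" using 1 2 by (simp_all add: D.mult_leI2)
  then have "(u \<otimes> w) \<otimes> d \<preceq> e \<curlyvee> e'" "(u \<otimes> w) \<otimes> d' \<preceq> e \<curlyvee> e'"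
    by (simp_all add: D.m_ac D.le_joinI1 D.le_joinI2)
  then show "(u \<otimes> w) \<otimes> (d \<curlyvee> d') \<preceq> e \<curlyvee> e'" by (simp add: D.mult_join_distrib D.join_least)
qed simp_all

lemma cong_meet: "\<lbrakk>cong F d e; cong F d' e'\<rbrakk> \<Longrightarrow> cong F (d \<curlywedge> d') (e \<curlywedge> e')"
proof (rule cong_op[where f = "rmeet D"])
  fix d e d' e' u w
  assume [simp]: "d \<in> carrier D" "e \<in> carrier D" "d' \<in> carrier D" "e' \<in> carrier D"
    and u: "u = (d \<leadsto> e) \<otimes> (e \<leadsto> d)" and w: "w = (d' \<leadsto> e') \<otimes> (e' \<leadsto> d')"
  have [simp]: "u \<in> carrier D" "w \<in> carrier D" by (simp_all add: u w)
  have 1: "u \<otimes> d \<preceq> e" and 2: "w \<otimes> d' \<preceq> e'" unfolding u w by (simp_all add: D.residuation)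
  have "(u \<otimes> w) \<otimes> (d \<curlywedge> d') \<preceq> u \<otimes> d" "(u \<otimes> w) \<otimes> (d \<curlywedge> d') \<preceq> w \<otimes> d'"
    by (intro D.mult_mono; simp)+
  then show "(u \<otimes> w) \<otimes> (d \<curlywedge> d') \<preceq> e \<curlywedge> e'"
    using D.le_trans[OF _ 1] D.le_trans[OF _ 2] by (intro D.meet_greatest) simp_all
qed simp_all

end

lemma cong_mono: "\<lbrakk>cong F d e; F \<subseteq> G\<rbrakk> \<Longrightarrow> cong G d e"
  by (auto simp: cong_def)

text \<open>Both implications between \<open>d\<close> and \<open>e\<close> lie in two complementary
  filters, whose intersection is \<open>{\<one>}\<close>.\<close>

lemma cong_unique:
  assumes "cong (\<phi> (\<complement>c)) d e" "cong (\<phi> c) d e" "c \<in> carrier B"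
  shows "d = e"
  using assms D.imp_eq_one_iff[of d e] D.imp_eq_one_iff[of e d] D.le_antisym[of d e]
    phi_compl_disjoint[of _ c] by (simp add: cong_def)

text \<open>Think of elements of \<open>D\<close> as functions on the Stone space of \<open>B\<close>: \<open>res c d\<close> agrees with
  \<open>d\<close> on \<open>c\<close> and is \<open>\<one>\<close> elsewhere.\<close>

definition res :: "'b \<Rightarrow> 'd \<Rightarrow> 'd" where
  "res c d = (THE y. cong (\<phi> (\<complement>c)) y d \<and> cong (\<phi> c) y \<one>)"

lemma res_eqI:
  assumes y: "cong (\<phi> (\<complement>c)) y d" "cong (\<phi> c) y \<one>" and c: "c \<in> carrier B"
  shows "res c d = y"
  unfolding res_def
proof (rule the_equality)
  fix z assume "cong (\<phi> (\<complement>c)) z d \<and> cong (\<phi> c) z \<one>"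
  then show "z = y"
    using y c by (intro cong_unique[of c]) (meson phi_filter cong_trans cong_sym B.bcompl_closed)+
qed (use y in simp)

text \<open>Chinese remainder: \<open>\<phi> c\<close> and \<open>\<phi> (\<complement>c)\<close>
  generate all of \<open>D\<close>, so \<open>u \<otimes> w \<preceq> d\<close> for some
  \<open>u\<close> and \<open>w\<close> in them. The solution is \<open>u \<curlyvee> d\<close>: it
  is in \<open>\<phi> c\<close> as it lies above \<open>u\<close>, and it is congruent to
  \<open>d\<close> because \<open>(u \<curlyvee> d) \<otimes> w \<preceq> d\<close>.\<close>

lemma res_exists:
  assumes [simp]: "c \<in> carrier B" "d \<in> carrier D"
  shows "\<exists>y. cong (\<phi> (\<complement>c)) y d \<and> cong (\<phi> c) y \<one>"
proof -
  have "d \<in> \<phi> (bjoin B c (\<complement>c))" by (simp add: phi_top)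
  then obtain u w where u: "u \<in> \<phi> c" and w: "w \<in> \<phi> (\<complement>c)" and le: "u \<otimes> w \<preceq> d"
    by (auto simp del: B.b_compl simp: phi_join)
  have [simp]: "u \<in> carrier D" "w \<in> carrier D" using u w by simp_all
  have "(u \<curlyvee> d) \<otimes> w \<preceq> d"
    using le by (simp add: D.join_mult_distrib D.join_least)
  then have "w \<preceq> (u \<curlyvee> d) \<leadsto> d" by (simp add: D.m_comm flip: D.residuation)
  then have "(u \<curlyvee> d) \<leadsto> d \<in> \<phi> (\<complement>c)" using D.i_filter_up[OF _ w] by simp
  moreover have "d \<leadsto> (u \<curlyvee> d) = \<one>" by (simp add: D.imp_eq_one_iff)
  ultimately have "cong (\<phi> (\<complement>c)) (u \<curlyvee> d) d" by (simp add: cong_def D.i_filterD(2))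
  moreover have "u \<curlyvee> d \<in> \<phi> c" using D.i_filter_up[OF _ u] by simp
  ultimately show ?thesis by (auto simp: cong_one_iff)
qed

lemma res_cong:
  assumes "c \<in> carrier B" "d \<in> carrier D"
  shows "cong (\<phi> (\<complement>c)) (res c d) d" "cong (\<phi> c) (res c d) \<one>"
  using res_exists[OF assms] res_eqI[OF _ _ assms(1)] by auto

lemma res_closed [simp]: "\<lbrakk>c \<in> carrier B; d \<in> carrier D\<rbrakk> \<Longrightarrow> res c d \<in> carrier D"
  using res_cong(1) by (auto simp: cong_def)

lemma res_in_phi [simp]: "\<lbrakk>c \<in> carrier B; d \<in> carrier D\<rbrakk> \<Longrightarrow> res c d \<in> \<phi> c"
  using res_cong(2) by (simp add: cong_one_iff)

lemma res_one [simp]: "c \<in> carrier B \<Longrightarrow> res c \<one> = \<one>"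
  by (rule res_eqI) (simp_all add: cong_refl)

lemma res_top [simp]: "d \<in> carrier D \<Longrightarrow> res (btop B) d = d"
  by (rule res_eqI) (simp_all add: cong_def phi_top phi_bot)

lemma res_bot [simp]: "d \<in> carrier D \<Longrightarrow> res (bbot B) d = \<one>"
  by (rule res_eqI) (simp_all add: cong_def phi_top phi_bot)

text \<open>The two congruences that characterise \<open>res\<close> respect the operations, and
  each operation sends \<open>\<one>\<close> and \<open>\<one>\<close> to \<open>\<one>\<close>. So
  \<open>res c\<close> is an endomorphism.\<close>

lemma res_ops [simp]:
  assumes "c \<in> carrier B" "d \<in> carrier D" "e \<in> carrier D"
  shows "res c (d \<otimes> e) = res c d \<otimes> res c e" "res c (d \<leadsto> e) = res c d \<leadsto> res c e"
    "res c (d \<curlyvee> e) = res c d \<curlyvee> res c e" "res c (d \<curlywedge> e) = res c d \<curlywedge> res c e"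
proof -
  note d = res_cong[OF assms(1,2)] and e = res_cong[OF assms(1,3)]
  have F: "i_filter D (\<phi> (\<complement>c))" "i_filter D (\<phi> c)" using assms by simp_all
  show "res c (d \<otimes> e) = res c d \<otimes> res c e"
    using cong_mult[OF F(1) d(1) e(1)] cong_mult[OF F(2) d(2) e(2)] assms
    by (intro res_eqI) simp_all
  show "res c (d \<leadsto> e) = res c d \<leadsto> res c e"
    using cong_imp[OF F(1) d(1) e(1)] cong_imp[OF F(2) d(2) e(2)] assms
    by (intro res_eqI) simp_all
  show "res c (d \<curlyvee> e) = res c d \<curlyvee> res c e"
    using cong_join[OF F(1) d(1) e(1)] cong_join[OF F(2) d(2) e(2)] assms
    by (intro res_eqI) simp_all
  show "res c (d \<curlywedge> e) = res c d \<curlywedge> res c e"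
    using cong_meet[OF F(1) d(1) e(1)] cong_meet[OF F(2) d(2) e(2)] assms
    by (intro res_eqI) simp_all
qed

text \<open>The implication from \<open>d\<close> to \<open>res c d\<close> lies in
  \<open>\<phi> c\<close>, being above \<open>res c d\<close>, and in
  \<open>\<phi> (\<complement>c)\<close> by congruence; so it is \<open>\<one>\<close>.\<close>

lemma le_res:
  assumes [simp]: "c \<in> carrier B" "d \<in> carrier D"
  shows "d \<preceq> res c d"
proof -
  have "d \<leadsto> res c d \<in> \<phi> c"
    using D.i_filter_up[of "\<phi> c" "res c d" "d \<leadsto> res c d"] by (simp add: D.le_imp)
  moreover have "d \<leadsto> res c d \<in> \<phi> (\<complement>c)" using res_cong(1)[of c d] by (simp add: cong_def)
  ultimately show ?thesis using phi_compl_disjoint[of _ c] D.imp_eq_one_iff[of d "res c d"] by simp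
qed

lemma res_res [simp]:
  assumes [simp]: "a \<in> carrier B" "b \<in> carrier B" "d \<in> carrier D"
  shows "res a (res b d) = res (a \<sqdot> b) d"
proof (rule sym, rule res_eqI)
  have "cong (\<phi> (\<complement>(a \<sqdot> b))) (res a (res b d)) (res b d)"
    by (rule cong_mono[OF res_cong(1) phi_compl_mono]) simp_all
  moreover have "cong (\<phi> (\<complement>(a \<sqdot> b))) (res b d) d"
    using phi_compl_mono[of b a] by (intro cong_mono[OF res_cong(1)]) (simp_all add: B.meet_comm)
  ultimately show "cong (\<phi> (\<complement>(a \<sqdot> b))) (res a (res b d)) d"
    by (rule cong_trans[rotated]) simp
  \<comment> \<open>By construction the element is in \<open>\<phi> a\<close>; it is in
    \<open>\<phi> b\<close> too, because restricting by \<open>a\<close> only moves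
    \<open>res b d\<close> upwards.\<close>
  have "res a (res b d) \<in> \<phi> b"
    using D.i_filter_up[of "\<phi> b" "res b d" "res a (res b d)"] le_res[of a "res b d"] by simp
  then have "res a (res b d) \<in> \<phi> (a \<sqdot> b)" by (simp add: phi_meet)
  then show "cong (\<phi> (a \<sqdot> b)) (res a (res b d)) \<one>" by (simp add: cong_one_iff)
qed simp

text \<open>On \<open>a\<close> the second factor is \<open>\<one>\<close> and on
  \<open>\<complement>a\<close> the first, so the product agrees with \<open>d\<close> on
  both.\<close>

lemma res_split:
  assumes [simp]: "a \<in> carrier B" "d \<in> carrier D"
  shows "res a d \<otimes> res (\<complement>a) d = d"
proof (rule cong_unique[of a])
  show "cong (\<phi> (\<complement>a)) (res a d \<otimes> res (\<complement>a) d) d"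
    using cong_mult[OF _ res_cong(1)[of a d] res_cong(2)[of "\<complement>a" d]] by simp
  show "cong (\<phi> a) (res a d \<otimes> res (\<complement>a) d) d"
    using cong_mult[OF _ res_cong(2)[of a d], of "res (\<complement>a) d" d] res_cong(1)[of "\<complement>a" d] by simp
qed simp

lemma in_phi_iff: "\<lbrakk>a \<in> carrier B; d \<in> carrier D\<rbrakk> \<Longrightarrow> d \<in> \<phi> a \<longleftrightarrow> res a d = d"
  by (metis phi_filter cong_refl cong_one_iff res_eqI res_in_phi B.bcompl_closed)

lemma in_phi_iff_compl:
  assumes [simp]: "a \<in> carrier B" "d \<in> carrier D"
  shows "d \<in> \<phi> a \<longleftrightarrow> res (\<complement>a) d = \<one>"
proof
  assume "d \<in> \<phi> a"
  then have "res (\<complement>a) d = res (\<complement>a) (res a d)" by (simp add: in_phi_iff del: res_res)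
  then show "res (\<complement>a) d = \<one>" by simp
next
  assume "res (\<complement>a) d = \<one>"
  then show "d \<in> \<phi> a" using res_split[of a d] by (simp add: in_phi_iff)
qed

end

section \<open>The algebra of a triple\<close>

text \<open>The element \<open>j (a, d)\<close> with \<open>d \<in> \<phi> a\<close> stands for the function that is \<open>d\<close> on \<open>a\<close>
  and \<open>\<zero>\<close> elsewhere; the injection \<open>j\<close> only serves to code pairs in a given type.\<close>

locale triple_algebra = triple_data B D \<phi>
  for B :: "('b, 'm) balg_scheme" and D :: "('d, 'n) rlat_scheme" (structure) and \<phi> +
  fixes j :: "'b \<times> 'd \<Rightarrow> 'u"
  assumes inj: "inj j"
begin

definition fs :: "'u \<Rightarrow> 'b" where "fs x = fst (inv_into UNIV j x)"
definition sn :: "'u \<Rightarrow> 'd" where "sn x = snd (inv_into UNIV j x)"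

lemma fs_sn [simp]: "fs (j (a, d)) = a" "sn (j (a, d)) = d"
  by (simp_all add: fs_def sn_def inv_f_f[OF inj])

lemma j_eq_iff [simp]: "j (a, d) = j (b, e) \<longleftrightarrow> a = b \<and> d = e"
  using inj by (auto dest: injD)

text \<open>The operations are pointwise, and \<open>res\<close> restores the normal form in which
  the second component is \<open>\<one>\<close> outside the first. In the join, where both arguments
  are nonzero only \<open>sn x \<curlyvee> sn y\<close> differs from \<open>\<one>\<close>; where
  just one is nonzero, the other second component is \<open>\<one>\<close>, and only the restriction
  of the nonzero one remains. An implication is \<open>\<zero>\<close> exactly where
  \<open>x\<close> is nonzero and \<open>y\<close> is zero.\<close>

definition glue :: "'u brlat" where
  "glue =
     \<lparr>carrier = {j (a, d) | a d. a \<in> carrier B \<and> d \<in> \<phi> a},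
      monoid.mult = (\<lambda>x y. j (fs x \<sqdot> fs y, res (fs x \<sqdot> fs y) (sn x \<otimes> sn y))),
      one = j (btop B, \<one>),
      rimp = (\<lambda>x y. j (bjoin B (\<complement>fs x) (fs y), res (fs x \<sqdot> fs y) (sn x \<leadsto> sn y))),
      rjoin = (\<lambda>x y. j (bjoin B (fs x) (fs y),
        res (\<complement>fs y) (sn x) \<curlywedge> res (\<complement>fs x) (sn y) \<curlywedge> (sn x \<curlyvee> sn y))),
      rmeet = (\<lambda>x y. j (fs x \<sqdot> fs y, res (fs x \<sqdot> fs y) (sn x \<curlywedge> sn y))),
      rbot = j (bbot B, \<one>)\<rparr>"

lemma glue_simps [simp]:
  "\<one>\<^bsub>glue\<^esub> = j (btop B, \<one>)" "\<zero>\<^bsub>glue\<^esub> = j (bbot B, \<one>)"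
  "j (a, d) \<otimes>\<^bsub>glue\<^esub> j (b, e) = j (a \<sqdot> b, res (a \<sqdot> b) (d \<otimes> e))"
  "j (a, d) \<leadsto>\<^bsub>glue\<^esub> j (b, e) = j (bjoin B (\<complement>a) b, res (a \<sqdot> b) (d \<leadsto> e))"
  "j (a, d) \<curlyvee>\<^bsub>glue\<^esub> j (b, e) = j (bjoin B a b, res (\<complement>b) d \<curlywedge> res (\<complement>a) e \<curlywedge> (d \<curlyvee> e))"
  "j (a, d) \<curlywedge>\<^bsub>glue\<^esub> j (b, e) = j (a \<sqdot> b, res (a \<sqdot> b) (d \<curlywedge> e))"
  "j (a, d) \<in> carrier glue \<longleftrightarrow> a \<in> carrier B \<and> d \<in> \<phi> a"
  by (auto simp: glue_def)

lemma glue_cases: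
  assumes "x \<in> carrier glue"
  obtains a d where "x = j (a, d)" "a \<in> carrier B" "d \<in> \<phi> a" "d \<in> carrier D"
  using assms unfolding glue_def by auto

lemma phi_mono_join:
  assumes [simp]: "a \<in> carrier B" "b \<in> carrier B"
  shows "\<phi> a \<subseteq> \<phi> (bjoin B a b)" "\<phi> b \<subseteq> \<phi> (bjoin B a b)"
proof -
  have *: "\<phi> a \<subseteq> \<phi> (bjoin B a b)" if [simp]: "a \<in> carrier B" "b \<in> carrier B" for a b
    using phi_meet[of a "bjoin B a b"] by (auto simp: B.meet_join_absorb)
  show "\<phi> a \<subseteq> \<phi> (bjoin B a b)" by (rule *) simp_all
  show "\<phi> b \<subseteq> \<phi> (bjoin B a b)" using *[of b a] by (simp add: B.join_comm)
qed

lemma brl_closed_glue: "brl_closed glue"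
proof
  show "\<one>\<^bsub>glue\<^esub> \<in> carrier glue" "\<zero>\<^bsub>glue\<^esub> \<in> carrier glue"
    by (simp_all add: D.i_filterD(2))
  fix x y assume "x \<in> carrier glue" "y \<in> carrier glue"
  then obtain a d b e where x: "x = j (a, d)" and y: "y = j (b, e)" and d: "d \<in> \<phi> a" and e: "e \<in> \<phi> b"
    and [simp]: "a \<in> carrier B" "b \<in> carrier B" "d \<in> carrier D" "e \<in> carrier D"
    by (elim glue_cases)
  show "x \<otimes>\<^bsub>glue\<^esub> y \<in> carrier glue" "x \<curlywedge>\<^bsub>glue\<^esub> y \<in> carrier glue"
    unfolding x y by (simp_all del: res_ops)
  have "\<phi> (a \<sqdot> b) \<subseteq> \<phi> (bjoin B (\<complement>a) b)"
    using phi_mono_join(2)[of "\<complement>a" b] phi_meet[of a b] by auto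
  then show "x \<leadsto>\<^bsub>glue\<^esub> y \<in> carrier glue"
    unfolding x y using res_in_phi[of "a \<sqdot> b" "d \<leadsto> e"] by (auto simp del: res_ops res_in_phi)
  have d': "d \<in> \<phi> (bjoin B a b)" and e': "e \<in> \<phi> (bjoin B a b)"
    using d e phi_mono_join[of a b] by auto
  have F: "i_filter D (\<phi> (bjoin B a b))" by simp
  have "res (\<complement>b) d \<in> \<phi> (bjoin B a b)" "res (\<complement>a) e \<in> \<phi> (bjoin B a b)" "d \<curlyvee> e \<in> \<phi> (bjoin B a b)"
    using D.i_filter_up[OF F d'] D.i_filter_up[OF F e'] by (simp_all add: le_res)
  then have "res (\<complement>b) d \<curlywedge> res (\<complement>a) e \<curlywedge> (d \<curlyvee> e) \<in> \<phi> (bjoin B a b)"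
    by (intro D.i_filter_meet[OF F])
  then show "x \<curlyvee>\<^bsub>glue\<^esub> y \<in> carrier glue" unfolding x y by simp
qed

text \<open>For these elements \<open>c\<close> acts as a single point: it lies inside the support
  or misses it.\<close>

definition decided :: "'b \<Rightarrow> 'u set" where
  "decided c = {j (a, d) | a d. a \<in> carrier B \<and> d \<in> \<phi> a \<and> (c \<sqdot> a = c \<or> c \<sqdot> a = bbot B)}"

text \<open>The value at the point \<open>c\<close>: the dense component cut down to
  \<open>c\<close> inside the support, and the least element of S(D) outside it.\<close>

definition stalk :: "'b \<Rightarrow> 'u \<Rightarrow> 'd option" where
  "stalk c x = (if c \<sqdot> fs x = c then Some (res c (sn x)) else None)"

lemma decided_iff:
  "j (a, d) \<in> decided c \<longleftrightarrow> j (a, d) \<in> carrier glue \<and> (c \<sqdot> a = c \<or> c \<sqdot> a = bbot B)"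
  by (auto simp: decided_def)

lemma stalk_j: "stalk c (j (a, d)) = (if c \<sqdot> a = c then Some (res c d) else None)"
  by (simp add: stalk_def)

lemma meet_compl_decided:
  assumes [simp]: "c \<in> carrier B" "a \<in> carrier B"
  shows "c \<sqdot> a = c \<Longrightarrow> c \<sqdot> \<complement>a = bbot B" "c \<sqdot> a = bbot B \<Longrightarrow> c \<sqdot> \<complement>a = c"
proof -
  assume "c \<sqdot> a = c"
  then have "c \<sqdot> \<complement>a = (c \<sqdot> a) \<sqdot> \<complement>a" by simp
  then show "c \<sqdot> \<complement>a = bbot B" by (simp add: B.meet_assoc)
next
  assume "c \<sqdot> a = bbot B"
  then show "c \<sqdot> \<complement>a = c" using B.distrib[of c a "\<complement>a"] by simp
qed

lemma res_outside:
  assumes "c \<in> carrier B" "a \<in> carrier B" "d \<in> \<phi> a" "c \<sqdot> a = bbot B"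
  shows "res c d = \<one>"
  using res_res[of c a d] in_phi_iff[of a d] assms by (simp del: res_res)

text \<open>There are four cases, according to whether \<open>c\<close> lies in or misses the two
  supports. That \<open>c\<close> is nonzero keeps these alternatives exclusive, so that
  \<open>\<zero>\<close> goes to \<open>None\<close>.\<close>

lemma brl_subhom_stalk:
  assumes c: "c \<in> carrier B" "c \<noteq> bbot B"
  shows "brl_subhom glue (decided c) (S_alg D) (stalk c)"
proof -
  note [simp] = c c(2)[symmetric]
  have one: "\<one> \<in> \<phi> a" if "a \<in> carrier B" for a using that by (simp add: D.i_filterD(2))
  have "\<one>\<^bsub>glue\<^esub> \<in> decided c" "\<zero>\<^bsub>glue\<^esub> \<in> decided c" by (auto simp: decided_def one)
  moreover have "stalk c \<one>\<^bsub>glue\<^esub> = \<one>\<^bsub>S_alg D\<^esub>" "stalk c \<zero>\<^bsub>glue\<^esub> = \<zero>\<^bsub>S_alg D\<^esub>"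
    by (simp_all add: stalk_def)
  moreover have "stalk c \<in> decided c \<rightarrow> carrier (S_alg D)"
    by (auto simp: stalk_def decided_def)
  moreover have "x \<otimes>\<^bsub>glue\<^esub> y \<in> decided c \<and> x \<leadsto>\<^bsub>glue\<^esub> y \<in> decided c \<and>
        x \<curlyvee>\<^bsub>glue\<^esub> y \<in> decided c \<and> x \<curlywedge>\<^bsub>glue\<^esub> y \<in> decided c \<and>
        stalk c (x \<otimes>\<^bsub>glue\<^esub> y) = stalk c x \<otimes>\<^bsub>S_alg D\<^esub> stalk c y \<and>
        stalk c (x \<leadsto>\<^bsub>glue\<^esub> y) = stalk c x \<leadsto>\<^bsub>S_alg D\<^esub> stalk c y \<and>
        stalk c (x \<curlyvee>\<^bsub>glue\<^esub> y) = stalk c x \<curlyvee>\<^bsub>S_alg D\<^esub> stalk c y \<and>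
        stalk c (x \<curlywedge>\<^bsub>glue\<^esub> y) = stalk c x \<curlywedge>\<^bsub>S_alg D\<^esub> stalk c y"
    if xy: "x \<in> decided c" "y \<in> decided c" for x y
  proof -
    interpret G: brl_closed glue by (rule brl_closed_glue)
    obtain a d where x: "x = j (a, d)" and d: "d \<in> \<phi> a" and [simp]: "a \<in> carrier B"
      and a: "c \<sqdot> a = c \<or> c \<sqdot> a = bbot B"
      using xy(1) by (auto simp: decided_def)
    obtain b e where y: "y = j (b, e)" and e: "e \<in> \<phi> b" and [simp]: "b \<in> carrier B"
      and b: "c \<sqdot> b = c \<or> c \<sqdot> b = bbot B"
      using xy(2) by (auto simp: decided_def)
    have [simp]: "d \<in> carrier D" "e \<in> carrier D" using d e by simp_all
    have G: "j (a, d) \<in> carrier glue" "j (b, e) \<in> carrier glue" using d e by simp_all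
    have ab: "c \<sqdot> (a \<sqdot> b) = (c \<sqdot> a) \<sqdot> b" by (simp add: B.meet_assoc)
    note cl = G.ops_closed(3-6)[OF G]
    have rd: "res c d = \<one>" if "c \<sqdot> a = bbot B" by (rule res_outside[OF _ _ d that]) simp_all
    have re: "res c e = \<one>" if "c \<sqdot> b = bbot B" by (rule res_outside[OF _ _ e that]) simp_all
    \<comment> \<open>Outside a support the second component is \<open>\<one>\<close> on
      \<open>c\<close>; this makes \<open>sn x \<curlyvee> sn y\<close> disappear from the join when
      only one argument is nonzero on \<open>c\<close>.\<close>
    have m: "c \<sqdot> a = c \<and> c \<sqdot> \<complement>a = bbot B \<or> c \<sqdot> a = bbot B \<and> c \<sqdot> \<complement>a = c \<and> res c d = \<one>"
      "c \<sqdot> b = c \<and> c \<sqdot> \<complement>b = bbot B \<or> c \<sqdot> b = bbot B \<and> c \<sqdot> \<complement>b = c \<and> res c e = \<one>"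
      using a b rd re meet_compl_decided[of c a] meet_compl_decided[of c b] by auto
    have "x \<otimes>\<^bsub>glue\<^esub> y \<in> decided c \<and> x \<leadsto>\<^bsub>glue\<^esub> y \<in> decided c \<and>
        x \<curlyvee>\<^bsub>glue\<^esub> y \<in> decided c \<and> x \<curlywedge>\<^bsub>glue\<^esub> y \<in> decided c"
      unfolding x y glue_simps(3-6) decided_iff using cl m
      by (elim disjE conjE) (simp_all add: B.distrib ab del: glue_simps(7) res_ops)
    moreover have "stalk c (x \<otimes>\<^bsub>glue\<^esub> y) = stalk c x \<otimes>\<^bsub>S_alg D\<^esub> stalk c y \<and>
        stalk c (x \<leadsto>\<^bsub>glue\<^esub> y) = stalk c x \<leadsto>\<^bsub>S_alg D\<^esub> stalk c y \<and>
        stalk c (x \<curlyvee>\<^bsub>glue\<^esub> y) = stalk c x \<curlyvee>\<^bsub>S_alg D\<^esub> stalk c y \<and>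
        stalk c (x \<curlywedge>\<^bsub>glue\<^esub> y) = stalk c x \<curlywedge>\<^bsub>S_alg D\<^esub> stalk c y"
      unfolding x y glue_simps(3-6) stalk_j using m
      by (elim disjE conjE) (simp_all add: B.distrib ab)
    ultimately show ?thesis by blast
  qed
  ultimately show ?thesis unfolding brl_subhom_def by blast
qed

end

section \<open>Separation of elements by stalks\<close>

context triple_algebra
begin

text \<open>A finite substitute for an ultrafilter: cut \<open>c\<close> by each \<open>g\<close> in
  turn and keep a half on which \<open>Q\<close> survives. Decisions already made persist under
  further cutting.\<close>

lemma decide_finite:
  assumes "finite Y" "Y \<subseteq> carrier B" "c \<in> carrier B" "Q c"
    and split: "\<And>c g. \<lbrakk>c \<in> carrier B; g \<in> carrier B; Q c\<rbrakk> \<Longrightarrow> Q (c \<sqdot> g) \<or> Q (c \<sqdot> \<complement>g)"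
  shows "\<exists>c'\<in>carrier B. Q c' \<and> (\<forall>g\<in>Y. c' \<sqdot> g = c' \<or> c' \<sqdot> g = bbot B)"
  using assms(1,2)
proof (induction Y rule: finite_induct)
  case empty
  then show ?case using assms(3,4) by blast
next
  case (insert g Y)
  then obtain c' where c' [simp]: "c' \<in> carrier B" "Q c'"
    and Y: "\<forall>h\<in>Y. c' \<sqdot> h = c' \<or> c' \<sqdot> h = bbot B"
    by auto
  have g [simp]: "g \<in> carrier B" using insert.prems by simp
  have dec: "\<forall>h\<in>Y. (c' \<sqdot> k) \<sqdot> h = c' \<sqdot> k \<or> (c' \<sqdot> k) \<sqdot> h = bbot B" if [simp]: "k \<in> carrier B" for k
  proof
    fix h assume h: "h \<in> Y"
    then have [simp]: "h \<in> carrier B" using insert.prems by auto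
    have "(c' \<sqdot> k) \<sqdot> h = (c' \<sqdot> h) \<sqdot> k" by (simp add: B.b_meet_ac)
    then show "(c' \<sqdot> k) \<sqdot> h = c' \<sqdot> k \<or> (c' \<sqdot> k) \<sqdot> h = bbot B" using Y h by auto
  qed
  have "(c' \<sqdot> g) \<sqdot> g = c' \<sqdot> g" "(c' \<sqdot> \<complement>g) \<sqdot> g = bbot B" by (simp_all add: B.meet_assoc)
  then show ?case
    using split[of c' g] dec[of g] dec[of "\<complement>g"] by (metis B.b_closed(3,5) c' g insertE)
qed

lemma stalk_separates:
  assumes X: "finite X" "X \<subseteq> carrier glue" and xy: "x \<in> carrier glue" "y \<in> carrier glue" "x \<noteq> y"
  shows "\<exists>U p. X \<subseteq> U \<and> brl_subhom glue U (S_alg D) p \<and> p x \<noteq> p y"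
proof -
  obtain a d where x: "x = j (a, d)" and d: "d \<in> \<phi> a" and [simp]: "a \<in> carrier B" "d \<in> carrier D"
    using xy(1) by (rule glue_cases)
  obtain b e where y: "y = j (b, e)" and e: "e \<in> \<phi> b" and [simp]: "b \<in> carrier B" "e \<in> carrier D"
    using xy(2) by (rule glue_cases)
  \<comment> \<open>\<open>Q c\<close> says that \<open>x\<close> and \<open>y\<close> differ
    somewhere on \<open>c\<close>.\<close>
  define Q where "Q c \<longleftrightarrow> c \<sqdot> a \<noteq> c \<sqdot> b \<or> res c d \<noteq> res c e" for c
  \<comment> \<open>If \<open>x\<close> and \<open>y\<close> agreed on both halves of
    \<open>c\<close>, they would agree on \<open>c\<close>: the first components by distributivity,
    the second by \<open>res_split\<close>.\<close>
  have split: "Q (c \<sqdot> g) \<or> Q (c \<sqdot> \<complement>g)" if [simp]: "c \<in> carrier B" "g \<in> carrier B" and "Q c" for c g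
  proof (rule ccontr)
    assume "\<not> (Q (c \<sqdot> g) \<or> Q (c \<sqdot> \<complement>g))"
    then have m: "(c \<sqdot> g) \<sqdot> a = (c \<sqdot> g) \<sqdot> b" "(c \<sqdot> \<complement>g) \<sqdot> a = (c \<sqdot> \<complement>g) \<sqdot> b"
      and r: "res (c \<sqdot> g) d = res (c \<sqdot> g) e" "res (c \<sqdot> \<complement>g) d = res (c \<sqdot> \<complement>g) e"
      by (simp_all add: Q_def)
    have sp: "c \<sqdot> u = bjoin B ((c \<sqdot> g) \<sqdot> u) ((c \<sqdot> \<complement>g) \<sqdot> u)" if [simp]: "u \<in> carrier B" for u
    proof -
      have "c \<sqdot> u = (c \<sqdot> u) \<sqdot> bjoin B g (\<complement>g)" by simp
      also have "\<dots> = bjoin B ((c \<sqdot> u) \<sqdot> g) ((c \<sqdot> u) \<sqdot> \<complement>g)" by (subst B.distrib) simp_all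
      finally show ?thesis by (simp add: B.b_meet_ac)
    qed
    have "c \<sqdot> a = c \<sqdot> b" using sp[of a] sp[of b] m by simp
    moreover have rs: "res c u = res (c \<sqdot> g) u \<otimes> res (c \<sqdot> \<complement>g) u" if "u \<in> carrier D" for u
      using res_split[of g u] res_ops(1)[of c "res g u" "res (\<complement>g) u"] that by simp
    have "res c d = res c e" using rs[of d] rs[of e] r by simp
    ultimately show False using \<open>Q c\<close> by (simp add: Q_def)
  qed
  have "Q (btop B)" using xy(3) by (auto simp: Q_def x y)
  \<comment> \<open>The supports of \<open>x\<close> and \<open>y\<close> are decided along with
    those of \<open>X\<close>, so that \<open>stalk c\<close> can tell the two apart.\<close>
  moreover have "fs ` insert x (insert y X) \<subseteq> carrier B"
    using X(2) xy by (auto elim!: glue_cases)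
  ultimately obtain c where c [simp]: "c \<in> carrier B" and Q: "Q c"
    and dec: "\<forall>g \<in> fs ` insert x (insert y X). c \<sqdot> g = c \<or> c \<sqdot> g = bbot B"
    using decide_finite[of "fs ` insert x (insert y X)" "btop B" Q] split X(1) by auto
  have c0: "c \<noteq> bbot B" using Q by (auto simp: Q_def)
  have "z \<in> decided c" if "z \<in> X" for z
  proof -
    have "z \<in> carrier glue" using that X(2) by auto
    then obtain g u where z: "z = j (g, u)" "z \<in> carrier glue" using glue_cases by metis
    then show ?thesis using dec that by (auto simp: decided_iff simp del: glue_simps)
  qed
  moreover have "stalk c x \<noteq> stalk c y"
  proof -
    \<comment> \<open>If \<open>c\<close> lies in just one support, exactly one value is
      \<open>None\<close>. If it lies in both, \<open>Q c\<close> forces different restrictions. It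
      cannot miss both, since then both restrictions would be \<open>\<one>\<close>, against
      \<open>Q c\<close>.\<close>
    have ab: "c \<sqdot> a = c \<or> c \<sqdot> a = bbot B" "c \<sqdot> b = c \<or> c \<sqdot> b = bbot B"
      using dec by (simp_all add: x y)
    have "res c d = \<one>" if "c \<sqdot> a = bbot B" by (rule res_outside[OF _ _ d that]) simp_all
    moreover have "res c e = \<one>" if "c \<sqdot> b = bbot B" by (rule res_outside[OF _ _ e that]) simp_all
    ultimately show ?thesis using ab Q c0 unfolding x y stalk_j Q_def by auto
  qed
  ultimately show ?thesis using brl_subhom_stalk[OF c c0] by (intro exI[of _ "decided c"] exI[of _ "stalk c"]) auto
qed

lemma brl_separated_glue: "brl_separated glue (S_alg D)"
  by (intro brl_separated.intro brl_closed_glue D.stonean_S_alg brl_separated_axioms.intro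
      stalk_separates)

text \<open>The axioms hold in S(D) and are pulled back from there.\<close>

sublocale G: stonean_residuated_lattice glue
  by (rule brl_separated.stonean_separated[OF brl_separated_glue])

lemma glue_neg [simp]: "\<lbrakk>a \<in> carrier B; d \<in> carrier D\<rbrakk> \<Longrightarrow> \<sim>\<^bsub>glue\<^esub> j (a, d) = j (\<complement>a, \<one>)"
  by (simp add: rneg_def)

lemma one_in_phi [simp]: "a \<in> carrier B \<Longrightarrow> \<one> \<in> \<phi> a"
  by (simp add: D.i_filterD(2))

text \<open>Double negation replaces the second component by \<open>\<one>\<close>, and Boolean
  elements equal their double negation.\<close>

lemma boolean_elems_glue: "boolean_elems glue = {j (a, \<one>) | a. a \<in> carrier B}"
proof (intro subset_antisym subsetI)
  fix x assume x: "x \<in> boolean_elems glue"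
  then have "x \<in> carrier glue" by (rule G.boolean_carrier)
  then obtain a d where xj: "x = j (a, d)" and [simp]: "a \<in> carrier B" "d \<in> carrier D"
    by (rule glue_cases)
  show "x \<in> {j (a, \<one>) | a. a \<in> carrier B}"
    using G.boolean_neg_neg[OF x] by (auto simp: xj)
next
  fix x assume "x \<in> {j (a, \<one>) | a. a \<in> carrier B}"
  then show "x \<in> boolean_elems glue" by (auto intro!: G.booleanI)
qed

lemma dense_elems_glue: "dense_elems glue = {j (btop B, d) | d. d \<in> carrier D}"
proof (intro subset_antisym subsetI)
  fix x assume x: "x \<in> dense_elems glue"
  then have "x \<in> carrier glue" by (rule G.dense_elemsD)
  then obtain a d where xj: "x = j (a, d)" and [simp]: "a \<in> carrier B" "d \<in> carrier D"
    by (rule glue_cases)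
  have "\<complement>a = bbot B" using G.dense_elemsD(2)[OF x] by (simp add: xj)
  then have "a = btop B" using B.compl_compl[of a] by simp
  then show "x \<in> {j (btop B, d) | d. d \<in> carrier D}" by (auto simp: xj)
next
  fix x assume "x \<in> {j (btop B, d) | d. d \<in> carrier D}"
  then show "x \<in> dense_elems glue" by (auto intro!: G.dense_elemsI simp: phi_top)
qed

text \<open>The negation of \<open>j (a, \<one>)\<close> is
  \<open>j (\<complement>a, \<one>)\<close>. It lies below \<open>j (btop B, d)\<close> iff
  \<open>d\<close> restricts to \<open>\<one>\<close> on \<open>\<complement>a\<close>, that is, iff
  \<open>d\<close> is in \<open>\<phi> a\<close>.\<close>

lemma phi_glue:
  assumes [simp]: "a \<in> carrier B"
  shows "phi glue (j (a, \<one>)) = {j (btop B, d) | d. d \<in> \<phi> a}"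
proof -
  have "d \<in> \<phi> a \<longleftrightarrow> d \<in> carrier D \<and> res (\<complement>a) d = \<one>" for d
    using in_phi_iff_compl[of a d] phi_carrier[of d a] by auto
  then show ?thesis by (auto simp: phi_def dense_elems_glue rle_def)
qed

end

lemma T_essentially_surjective:
  fixes X :: "('u, 'u) triple" and j :: "'u \<times> 'u \<Rightarrow> 'u"
  assumes j: "inj j" and X: "is_triple X" "dense_part X \<in> subvariety_star E"
  shows "\<exists>A\<in>subvariety E. \<exists>e. is_iso triple_cat (onObj T_func A) X e"
proof -
  define B D \<phi> where "B = boolean_part X" and "D = dense_part X" and "\<phi> = filter_map X"
  interpret triple_algebra B D \<phi> j
    using j X(1) unfolding is_triple_def B_def D_def \<phi>_def
    by (simp add: triple_algebra_def triple_data_def triple_data_axioms_def triple_algebra_axioms_def)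
  have "S_alg D \<in> subvariety E" using X(2) by (simp add: subvariety_star_def D_def)
  then have glue: "glue \<in> subvariety E" by (rule subvariety_separated) (rule brl_separated_glue)
  let ?T = "onObj T_func glue"
  have cB: "carrier (boolean_part ?T) = {j (a, \<one>\<^bsub>D\<^esub>) | a. a \<in> carrier B}"
    and cD: "carrier (dense_part ?T) = {j (btop B, d) | d. d \<in> carrier D}"
    by (simp_all add: T_func_simps carrier_B_alg_D_alg boolean_elems_glue dense_elems_glue)
  \<comment> \<open>The isomorphism forgets the constant coordinate: Boolean elements have second
    component \<open>\<one>\<close>, dense elements have first component
    \<open>btop B\<close>.\<close>
  define h where "h = restrict fs {j (a, \<one>\<^bsub>D\<^esub>) | a. a \<in> carrier B}"
  define k where "k = restrict sn {j (btop B, d) | d. d \<in> carrier D}"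
  define h' where "h' = (\<lambda>a\<in>carrier B. j (a, \<one>\<^bsub>D\<^esub>))"
  define k' where "k' = (\<lambda>d\<in>carrier D. j (btop B, d))"
  have hk [simp]: "h (j (a, \<one>\<^bsub>D\<^esub>)) = a" "h' a = j (a, \<one>\<^bsub>D\<^esub>)" if "a \<in> carrier B" for a
    using that by (auto simp: h_def h'_def)
  have kk [simp]: "k (j (btop B, d)) = d" "k' d = j (btop B, d)" if "d \<in> carrier D" for d
    using that by (auto simp: k_def k'_def)
  have bparts: "bjoin (B_alg glue) = rjoin glue" "bmeet (B_alg glue) = rmeet glue"
    "bcompl (B_alg glue) = rneg glue" "bbot (B_alg glue) = \<zero>\<^bsub>glue\<^esub>" "btop (B_alg glue) = \<one>\<^bsub>glue\<^esub>"
    by (simp_all add: B_alg_def)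
  have dparts: "rjoin (D_alg glue) = rjoin glue" "rmeet (D_alg glue) = rmeet glue"
    "rimp (D_alg glue) = rimp glue" "monoid.mult (D_alg glue) = monoid.mult glue"
    "\<one>\<^bsub>D_alg glue\<^esub> = \<one>\<^bsub>glue\<^esub>"
    by (simp_all add: D_alg_def)
  note parts = bparts dparts T_func_simps carrier_B_alg_D_alg boolean_elems_glue dense_elems_glue
  have "boolean_hom (boolean_part ?T) B h" "boolean_hom B (boolean_part ?T) h'"
    by (auto simp: boolean_hom_def parts)
  moreover have "rl_hom (dense_part ?T) D k" "rl_hom D (dense_part ?T) k'"
    by (auto simp: rl_hom_def parts)
  \<comment> \<open>Both inclusions are needed: bijectivity alone would not make the inverse pair a
    morphism of triples.\<close>
  moreover have "\<forall>x\<in>carrier (boolean_part ?T). k ` filter_map ?T x \<subseteq> \<phi> (h x)"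
    "\<forall>a\<in>carrier B. k' ` \<phi> a \<subseteq> filter_map ?T (h' a)"
    by (auto simp: parts phi_glue phi_carrier)
  moreover have "h \<in> extensional (carrier (boolean_part ?T))" "k \<in> extensional (carrier (dense_part ?T))"
    "h' \<in> extensional (carrier B)" "k' \<in> extensional (carrier D)"
    unfolding cB cD by (simp_all add: h_def k_def h'_def k'_def)
  ultimately have hom: "(h, k) \<in> Hom triple_cat ?T X" "(h', k') \<in> Hom triple_cat X ?T"
    unfolding triple_cat_simps B_def[symmetric] D_def[symmetric] \<phi>_def[symmetric] by blast+
  have "Comp triple_cat ?T X ?T (h', k') (h, k) = Id triple_cat ?T"
    unfolding triple_cat_simps cB cD
    by (auto simp: compose_def fun_eq_iff restrict_def)
  moreover have "Comp triple_cat X ?T X (h, k) (h', k') = Id triple_cat X"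
    unfolding triple_cat_simps B_def[symmetric] D_def[symmetric]
    by (auto simp: compose_def fun_eq_iff restrict_def)
  ultimately have "is_iso triple_cat ?T X (h, k)"
    unfolding is_iso_def using hom by blast
  then show ?thesis using glue by blast
qed

lemma infinite_imp_inj_pair:
  assumes "infinite (UNIV :: 'u set)"
  shows "\<exists>j :: 'u \<times> 'u \<Rightarrow> 'u. inj j"
proof -
  obtain j :: "'u \<times> 'u \<Rightarrow> 'u" where "bij_betw j (UNIV \<times> UNIV) UNIV"
    using card_of_Times_same_infinite[OF assms] card_of_ordIso by metis
  then show ?thesis using bij_betw_imp_inj_on by auto
qed

(* All carriers are subsets of one infinite type 'u, which plays the role of the universe.
   If V consists of one-element algebras only, then V* is empty, since S(A) always has at least
   two elements, and T does not map V into T_V; hence V is required to be nontrivial. *)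

theorem theorem4p3:
  fixes E :: "(rterm \<times> rterm) set"
  assumes "infinite (UNIV :: 'u set)"
    and "\<exists>A \<in> (subvariety E :: 'u brlat set). \<exists>x\<in>carrier A. x \<noteq> \<one>\<^bsub>A\<^esub>"
  shows "is_equivalence (subvariety_cat E :: ('u brlat, 'u \<Rightarrow> 'u) cat)
           (subvariety_triple_cat E) T_func"
proof (rule is_equivalenceI)
  show "is_functor (subvariety_cat E :: ('u brlat, 'u \<Rightarrow> 'u) cat) (subvariety_triple_cat E) T_func"
    using assms(2) by (elim bexE) (rule is_functor_T)
next
  fix A A' :: "'u brlat" and g
  assume "A \<in> Obj (subvariety_cat E)" "A' \<in> Obj (subvariety_cat E)"
    and "g \<in> Hom (subvariety_triple_cat E) (onObj T_func A) (onObj T_func A')"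
  then show "\<exists>f\<in>Hom (subvariety_cat E) A A'. onArr T_func A A' f = g"
    using T_full[of A A' "fst g" "snd g"]
    by (auto simp: subvariety_cat_simps subvariety_triple_cat_simps subvariety_def)
next
  fix A A' :: "'u brlat" and f g
  assume "A \<in> Obj (subvariety_cat E)" "A' \<in> Obj (subvariety_cat E)"
    "f \<in> Hom (subvariety_cat E) A A'" "g \<in> Hom (subvariety_cat E) A A'"
    "onArr T_func A A' f = onArr T_func A A' g"
  then show "f = g"
    using T_faithful[of A A' f g] by (simp add: subvariety_cat_simps subvariety_def)
next
  fix X :: "('u, 'u) triple"
  assume "X \<in> Obj (subvariety_triple_cat E)"
  then have X: "is_triple X" "dense_part X \<in> subvariety_star E"
    by (simp_all add: subvariety_triple_cat_simps)
  \<comment> \<open>The algebra of a triple consists of pairs, which have to be coded in the type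
    that carries the triple.\<close>
  obtain j :: "'u \<times> 'u \<Rightarrow> 'u" where "inj j" using infinite_imp_inj_pair[OF assms(1)] ..
  from T_essentially_surjective[OF this X]
  show "\<exists>A\<in>Obj (subvariety_cat E). \<exists>e. is_iso (subvariety_triple_cat E) (onObj T_func A) X e"
    by (simp add: is_iso_def subvariety_cat_simps subvariety_triple_cat_simps)
qed

end
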